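(* Let $X$ be a separable Banach space, let $T:X\to X$ be a bounded linear operator and let $\omega:\mathbb N\to(1,+\infty)$ with $\omega(k)\to+\infty$. Suppose there exist $\alpha>1$, a dense set $\mathcal D\subset X$ and maps $S_n:\mathcal D\to X$, $n\geq0$, such that for every $x\in\mathcal D$: (i) $T^nS_nx=x$ for all $n$ and $T^mS_nx=S_{n-m}x$ for all $n>m$; (ii) $\|T^nx\|=O(n^{-\alpha})$ and $\|S_nx\|=O(n^{-\alpha})$ as $n\to\infty$. Then there exists a $T$-invariant Borel probability measure $\mu$ on $X$ with full support, with respect to which $T$ is strongly mixing, such that $E_\omega\subset L^2(X,\mathcal B,\mu)$ and such that for any $f,g\in E_\omega$ there is $C_{f,g,\alpha}$ with $|\mathrm{Cov}(f\circ T^n,g)|\leq C_{f,g,\alpha}n^{-\alpha}$ for all $n\geq1$. Moreover, for every $f\in E_\omega$ with $\int f\,d\mu=0$, the sequence $\frac1{\sqrt n}(f+f\circ T+\dots+f\circ T^{n-1})$ converges in distribution to a Gaussian random variable with zero mean and finite variance.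
   Context: $E_\omega$ denotes the set of functions $f:X\to\mathbb R$ which are infinitely (Fréchet) differentiable at $0$, satisfy $f(x)=\sum_{\kappa=0}^{\infty}\frac{D^\kappa f(0)}{\kappa!}(x,\dots,x)$ for all $x\in X$, and satisfy $\sup_{\kappa\geq0}\|D^\kappa f(0)\|\,\omega(\kappa)^\kappa<+\infty$. $T$-invariant: $\mu(T^{-1}A)=\mu(A)$ for Borel $A$; full support: $\mu(U)>0$ for every nonempty open $U$; strongly mixing: $\mu(A\cap T^{-n}B)\to\mu(A)\mu(B)$ for all Borel $A,B$. $\mathrm{Cov}(f,g)=\int fg\,d\mu-\int f\,d\mu\int g\,d\mu$. *)

theory Defs
  imports "HOL-Probability.Probability" "HOL-Library.Landau_Symbols"
begin

text \<open>Multilinear forms on a real normed space are represented as functions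
  on lists of arguments; a k-linear form only matters on lists of length k.\<close>

definition multilinear_form :: "nat \<Rightarrow> ('a::real_normed_vector list \<Rightarrow> real) \<Rightarrow> bool" where
  "multilinear_form k L \<longleftrightarrow>
     (\<forall>hs1 hs2 (a::real) x y. length hs1 + length hs2 + 1 = k \<longrightarrow>
        L (hs1 @ (a *\<^sub>R x + y) # hs2) = a * L (hs1 @ x # hs2) + L (hs1 @ y # hs2))"

definition bounded_multilinear_form :: "nat \<Rightarrow> ('a::real_normed_vector list \<Rightarrow> real) \<Rightarrow> bool" where
  "bounded_multilinear_form k L \<longleftrightarrow> multilinear_form k L \<and>
     (\<exists>C. \<forall>hs. length hs = k \<longrightarrow> \<bar>L hs\<bar> \<le> C * (\<Prod>h\<leftarrow>hs. norm h))"

definition mnorm :: "nat \<Rightarrow> ('a::real_normed_vector list \<Rightarrow> real) \<Rightarrow> real" where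
  "mnorm k L = Sup {\<bar>L hs\<bar> | hs. length hs = k \<and> (\<forall>h\<in>set hs. norm h \<le> 1)}"

text \<open>Df (Suc k) x is the Frechet derivative at x of the map
  y \<mapsto> Df k y (valued in k-linear forms with the operator norm):
  D^{k+1}f(x)(h,h1,..,hk) = (D(D^k f)(x) h)(h1,..,hk).\<close>
definition has_mderiv_at ::
  "(nat \<Rightarrow> 'a::real_normed_vector \<Rightarrow> 'a list \<Rightarrow> real) \<Rightarrow> nat \<Rightarrow> 'a \<Rightarrow> bool" where
  "has_mderiv_at Df k x \<longleftrightarrow>
     ((\<lambda>y. mnorm k (\<lambda>hs. Df k y hs - Df k x hs - Df (Suc k) x ((y - x) # hs)) / norm (y - x))
        \<longlongrightarrow> 0) (at x)"

definition inf_frechet_at0 ::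
  "('a::real_normed_vector \<Rightarrow> real) \<Rightarrow> (nat \<Rightarrow> 'a \<Rightarrow> 'a list \<Rightarrow> real) \<Rightarrow> bool" where
  "inf_frechet_at0 f Df \<longleftrightarrow>
     (\<forall>x. Df 0 x [] = f x) \<and>
     (\<forall>k. \<forall>\<^sub>F x in nhds 0. (\<forall>j\<le>k. bounded_multilinear_form j (Df j x)) \<and>
                           (\<forall>j<k. has_mderiv_at Df j x))"

definition E_omega :: "(nat \<Rightarrow> real) \<Rightarrow> ('a::real_normed_vector \<Rightarrow> real) set" where
  "E_omega \<omega> = {f. \<exists>Df. inf_frechet_at0 f Df \<and>
      (\<forall>x. (\<lambda>\<kappa>. Df \<kappa> 0 (replicate \<kappa> x) / fact \<kappa>) sums f x) \<and>
      (\<exists>C. \<forall>\<kappa>. mnorm \<kappa> (Df \<kappa> 0) * \<omega> \<kappa> ^ \<kappa> \<le> C)}"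

definition Cov :: "'a measure \<Rightarrow> ('a \<Rightarrow> real) \<Rightarrow> ('a \<Rightarrow> real) \<Rightarrow> real" where
  "Cov \<mu> f g = (\<integral>x. f x * g x \<partial>\<mu>) - (\<integral>x. f x \<partial>\<mu>) * (\<integral>x. g x \<partial>\<mu>)"

end

theory Submission
  imports Defs
begin

text \<open>
  Let \<open>x\<^sub>1, x\<^sub>2, \<dots>\<close> be dense in \<open>D\<close>, put \<open>x\<^sub>0 = 0\<close>, and let \<open>v k l\<close> be \<open>S\<^sub>k x\<^sub>l\<close> for \<open>k > 0\<close>
  and \<open>T\<^sup>-\<^sup>k x\<^sub>l\<close> for \<open>k \<le> 0\<close>, so that \<open>T (v k l) = v (k - 1) l\<close> and \<open>norm (v k l) \<le> a k * c l\<close> with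
  \<open>a k\<close> of order \<open>(1 + \<bar>k\<bar>)\<^sup>-\<^sup>\<alpha>\<close>.  For independent indices \<open>z k\<close> with a common law charging every \<open>l\<close>, the
  random series \<open>X z = (\<Sum>k. v k (z k))\<close> intertwines the Bernoulli shift with \<open>T\<close>, and \<open>\<mu>\<close> is the law of
  \<open>X\<close>.  If the law of the indices makes all exponential moments of \<open>c\<close> finite, then so are those of
  \<open>norm X\<close>, and since \<open>\<omega> > 1\<close> every \<open>f\<close> in \<open>E\<^sub>\<omega>\<close> is bounded and locally Lipschitz up to a factor
  \<open>exp (norm x)\<close>.  Hence the influence of the coordinate \<open>k\<close> on \<open>f (T\<^sup>n X)\<close> is of order \<open>a (k - n)\<close>.

  For functions of independent variables the covariance is bounded by the sum over the coordinates of
  the products of the influences; here this is the convolution \<open>\<Sum>k. a (k - n) * a k\<close>, which is of order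
  \<open>n\<^sup>-\<^sup>\<alpha>\<close> because \<open>\<alpha> > 1\<close>.  For the central limit theorem, time is cut into blocks and, in each block, all
  coordinates outside of the block are replaced by \<open>0\<close>: the block sums become independent and identically
  distributed, and the same covariance bound makes the error negligible in \<open>L\<^sup>2\<close>.
\<close>

section \<open>Products of a law on the natural numbers\<close>

text \<open>The series converges only almost surely, and the influence of a coordinate carries an
  unbounded factor \<open>exp (norm X)\<close> that is correlated with that coordinate. So pointwise
  estimates are confined to an almost sure set that is stable under shifts and under replacing
  indices by 0, and in the moment estimates a product of m exponentials is dominated by the sum of
  their m-th powers: the exponential moments of a single index then bound everything, uniformly in
  time. The covariance bound resamples the coordinates of one factor one at a time, which leads from
  E(FG) to E(F)E(G). Resampling G alone would give one influence per coordinate, and the sum of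
  these does not decay in n; exchanging the two copies of the coordinate turns the other factor into
  an increment too, hence the product of influences. The index 0 with its zero vector serves twice:
  it deletes coordinates, which makes blocks independent, and it pins the series near a chosen
  vector, which gives full support. The variance of the limit law is never computed. It is a limit
  point of the normalized block variances, found by compactness.\<close>

definition iid :: "nat pmf \<Rightarrow> ('i \<Rightarrow> nat) measure" where
  "iid p = PiM UNIV (\<lambda>_. measure_pmf p)"

lemma space_iid [simp]: "space (iid p) = UNIV"
  by (simp add: iid_def space_PiM)

lemma prob_space_iid: "prob_space (iid p)"
  unfolding iid_def by (intro prob_space_PiM) (simp add: measure_pmf.prob_space_axioms)

lemma measurable_iid_component [measurable]: "(\<lambda>z. z i) \<in> iid p \<rightarrow>\<^sub>M measure_pmf q"
proof -
  have "(\<lambda>z. z i) \<in> iid p \<rightarrow>\<^sub>M measure_pmf p"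
    unfolding iid_def by (rule measurable_component_singleton) simp
  then show ?thesis
    by (simp cong: measurable_cong_sets)
qed

lemma borel_measurable_iid_component [measurable]:
  fixes g :: "nat \<Rightarrow> 'b::topological_space"
  shows "(\<lambda>z. g (z i)) \<in> iid p \<rightarrow>\<^sub>M borel"
  by (rule measurable_compose[OF measurable_iid_component[where q = p]]) simp

lemma measurable_into_iid:
  assumes "\<And>i. (\<lambda>x. f x i) \<in> M \<rightarrow>\<^sub>M count_space UNIV"
  shows "f \<in> M \<rightarrow>\<^sub>M iid p"
proof -
  have "(\<lambda>x. \<lambda>i\<in>UNIV. f x i) \<in> M \<rightarrow>\<^sub>M PiM UNIV (\<lambda>_. measure_pmf p)"
    using assms by (intro measurable_restrict) (simp cong: measurable_cong_sets)
  then show ?thesis by (simp add: iid_def restrict_def)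
qed

lemma measurable_iid_count [measurable]: "(\<lambda>z. z i) \<in> iid p \<rightarrow>\<^sub>M count_space UNIV"
  using measurable_iid_component[of i p p] by (simp cong: measurable_cong_sets)

lemma measurable_iid_reindex: "(\<lambda>z i. z (\<pi> i)) \<in> iid p \<rightarrow>\<^sub>M iid p"
  by (rule measurable_into_iid) measurable

lemma measurable_iid_mask: "(\<lambda>z i. if i \<in> B then z i else d) \<in> iid p \<rightarrow>\<^sub>M iid p"
proof (rule measurable_into_iid)
  show "(\<lambda>z. if i \<in> B then z i else d) \<in> iid p \<rightarrow>\<^sub>M count_space UNIV" for i
    by (cases "i \<in> B") simp_all
qed

lemma distr_iid_reindex:
  assumes "inj \<pi>"
  shows "distr (iid p) (iid p) (\<lambda>z i. z (\<pi> i)) = iid p"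
  using distr_PiM_reindex[of UNIV "\<lambda>_. measure_pmf p" \<pi> UNIV] assms
  by (simp add: iid_def measure_pmf.prob_space_axioms restrict_def)

lemma integral_iid_reindex:
  fixes F :: "_ \<Rightarrow> 'b::{banach, second_countable_topology}"
  assumes "inj \<pi>" and [measurable]: "F \<in> borel_measurable (iid p)"
  shows "(\<integral>z. F (\<lambda>i. z (\<pi> i)) \<partial>iid p) = (\<integral>z. F z \<partial>iid p)"
  using integral_distr[OF measurable_iid_reindex assms(2), of \<pi>] distr_iid_reindex[OF assms(1), of p]
  by simp

lemma integrable_iid_reindex:
  fixes F :: "_ \<Rightarrow> 'b::{banach, second_countable_topology}"
  assumes "inj \<pi>" and "integrable (iid p) F"
  shows "integrable (iid p) (\<lambda>z. F (\<lambda>i. z (\<pi> i)))"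
proof -
  have "F \<in> borel_measurable (iid p)" using assms(2) by auto
  then show ?thesis
    using assms(2) integrable_distr_eq[OF measurable_iid_reindex, of F p \<pi>]
      distr_iid_reindex[OF assms(1), of p] by simp
qed

lemma AE_iid_reindex:
  assumes "inj \<pi>" and "AE z in iid p. P z"
  shows "AE z in iid p. P (\<lambda>i. z (\<pi> i))"
proof -
  have "AE z in distr (iid p) (iid p) (\<lambda>z i. z (\<pi> i)). P z"
    using assms(2) distr_iid_reindex[OF assms(1), of p] by metis
  then show ?thesis
    by (rule AE_distrD[OF measurable_iid_reindex])
qed

lemma distr_iid_component: "distr (iid p) (measure_pmf p) (\<lambda>z. z i) = measure_pmf p"
  unfolding iid_def by (rule distr_PiM_component) (simp_all add: measure_pmf.prob_space_axioms)

lemma integrable_iid_component: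
  fixes g :: "nat \<Rightarrow> real"
  shows "integrable (iid p) (\<lambda>z. g (z i)) \<longleftrightarrow> integrable (measure_pmf p) g"
  using integrable_distr_eq[OF measurable_iid_component[where i=i and p=p and q=p], of g] by (simp add: distr_iid_component)

lemma integral_iid_component:
  fixes g :: "nat \<Rightarrow> real"
  shows "(\<integral>z. g (z i) \<partial>iid p) = measure_pmf.expectation p g"
  using integral_distr[OF measurable_iid_component[where i=i and p=p and q=p], of g] by (simp add: distr_iid_component)

definition depends_on :: "'i set \<Rightarrow> (('i \<Rightarrow> 's) \<Rightarrow> 'b) \<Rightarrow> bool" where
  "depends_on J F \<longleftrightarrow> (\<forall>z z'. (\<forall>i\<in>J. z i = z' i) \<longrightarrow> F z = F z')"

lemma depends_onD: "depends_on J F \<Longrightarrow> (\<And>i. i \<in> J \<Longrightarrow> z i = z' i) \<Longrightarrow> F z = F z'"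
  unfolding depends_on_def by blast

lemma depends_onI: "(\<And>z z'. (\<And>i. i \<in> J \<Longrightarrow> z i = z' i) \<Longrightarrow> F z = F z') \<Longrightarrow> depends_on J F"
  unfolding depends_on_def by blast

lemma depends_on_indicator:
  assumes "depends_on J (\<lambda>z. z \<in> A)"
  shows "depends_on J (indicator A :: _ \<Rightarrow> real)"
proof (rule depends_onI)
  fix z z' :: "'a \<Rightarrow> 'b" assume "\<And>i. i \<in> J \<Longrightarrow> z i = z' i"
  from depends_onD[OF assms this] show "indicator A z = (indicator A z' :: real)"
    by (simp add: indicator_def)
qed

lemma indep_vars_iid_coordinates:
  "prob_space.indep_vars (iid p) (\<lambda>_. measure_pmf p) (\<lambda>i z. z (i::'i)) UNIV"
proof -
  interpret prob_space "iid p :: ('i \<Rightarrow> nat) measure" by (rule prob_space_iid)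
  have "distr (iid p) (PiM UNIV (\<lambda>_. measure_pmf p)) (\<lambda>z::'i \<Rightarrow> nat. \<lambda>i\<in>UNIV. z i) = iid p"
    using distr_iid_reindex[of "\<lambda>i::'i. i" p] by (simp add: iid_def restrict_def)
  moreover have "PiM UNIV (\<lambda>i::'i. distr (iid p) (measure_pmf p) (\<lambda>z. z i)) = iid p"
    by (simp only: distr_iid_component) (simp add: iid_def)
  ultimately show ?thesis
    by (subst indep_vars_iff_distr_eq_PiM) simp_all
qed

lemma indep_vars_iid_depends_on:
  fixes F :: "'j \<Rightarrow> ('i \<Rightarrow> nat) \<Rightarrow> 'b::topological_space"
  assumes J: "disjoint_family_on J L"
    and dep: "\<And>j. j \<in> L \<Longrightarrow> depends_on (J j) (F j)"
    and meas: "\<And>j. j \<in> L \<Longrightarrow> F j \<in> borel_measurable (iid p)"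
  shows "prob_space.indep_vars (iid p) (\<lambda>_. borel) F L"
proof -
  interpret prob_space "iid p :: ('i \<Rightarrow> nat) measure" by (rule prob_space_iid)
  have ind: "indep_vars (\<lambda>j. PiM (J j) (\<lambda>_. measure_pmf p)) (\<lambda>j z. restrict (\<lambda>i. z i) (J j)) L"
    by (rule indep_vars_restrict[OF indep_vars_iid_coordinates _ J]) simp
  \<comment> \<open>Each \<open>F j\<close> is read off from the restriction to \<open>J j\<close>
    by filling the other coordinates with 0; since \<open>F j\<close> does not see them, the filling
    is harmless.\<close>
  have "indep_vars (\<lambda>_. borel)
      (\<lambda>j z. (\<lambda>r. F j (\<lambda>i. if i \<in> J j then r i else 0)) (restrict (\<lambda>i. z i) (J j))) L"
  proof (rule indep_vars_compose2[OF ind])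
    fix j assume j: "j \<in> L"
    have "(\<lambda>r i. if i \<in> J j then r i else 0) \<in> PiM (J j) (\<lambda>_. measure_pmf p) \<rightarrow>\<^sub>M iid p"
    proof (rule measurable_into_iid)
      fix i
      show "(\<lambda>r. if i \<in> J j then r i else 0) \<in> PiM (J j) (\<lambda>_. measure_pmf p) \<rightarrow>\<^sub>M count_space UNIV"
      proof (cases "i \<in> J j")
        case True
        then have "(\<lambda>r. r i) \<in> PiM (J j) (\<lambda>_. measure_pmf p) \<rightarrow>\<^sub>M measure_pmf p"
          by (rule measurable_component_singleton)
        then have "(\<lambda>r. r i) \<in> PiM (J j) (\<lambda>_. measure_pmf p) \<rightarrow>\<^sub>M count_space UNIV"
          by (simp only: measurable_pmf_measure2)
        with True show ?thesis by (simp only: if_True)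
      qed simp
    qed
    then show "(\<lambda>r. F j (\<lambda>i. if i \<in> J j then r i else 0)) \<in> PiM (J j) (\<lambda>_. measure_pmf p) \<rightarrow>\<^sub>M borel"
      by (rule measurable_compose[OF _ meas[OF j]])
  qed
  moreover have "F j (\<lambda>i. if i \<in> J j then restrict (\<lambda>i. z i) (J j) i else 0) = F j z" if "j \<in> L" for j z
    by (rule depends_onD[OF dep[OF that]]) simp
  ultimately show ?thesis
    by (subst (asm) indep_vars_cong[OF refl _ refl, where Y = F]) auto
qed

lemma integral_iid_mult:
  fixes F G :: "('i \<Rightarrow> nat) \<Rightarrow> real"
  assumes J: "J \<inter> J' = {}" and dep: "depends_on J F" "depends_on J' G"
    and int: "integrable (iid p) F" "integrable (iid p) G"
  shows "(\<integral>z. F z * G z \<partial>iid p) = (\<integral>z. F z \<partial>iid p) * (\<integral>z. G z \<partial>iid p)"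
proof -
  interpret prob_space "iid p :: ('i \<Rightarrow> nat) measure" by (rule prob_space_iid)
  have "indep_vars (\<lambda>_. borel) (\<lambda>b. if b then F else G) UNIV"
    using J dep int by (intro indep_vars_iid_depends_on[where J = "\<lambda>b. if b then J else J'"])
      (auto simp: disjoint_family_on_def)
  then have ind: "indep_var borel F borel G"
    unfolding indep_var_def by (simp add: if_distrib bool.case_distrib case_bool_if cong: if_cong)
  show "(\<integral>z. F z * G z \<partial>iid p) = (\<integral>z. F z \<partial>iid p) * (\<integral>z. G z \<partial>iid p)"
    by (rule indep_var_lebesgue_integral[OF ind int])
qed

lemma measure_iid_Int:
  fixes A B :: "('i \<Rightarrow> nat) set"
  assumes J: "J \<inter> J' = {}" and dep: "depends_on J (\<lambda>z. z \<in> A)" "depends_on J' (\<lambda>z. z \<in> B)"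
    and [measurable]: "A \<in> sets (iid p)" "B \<in> sets (iid p)"
  shows "measure (iid p) (A \<inter> B) = measure (iid p) A * measure (iid p) B"
proof -
  interpret prob_space "iid p :: ('i \<Rightarrow> nat) measure" by (rule prob_space_iid)
  have "(\<integral>z. indicator A z * indicator B z \<partial>iid p) =
      (\<integral>z. indicator A z \<partial>iid p) * (\<integral>z. indicat_real B z \<partial>iid p)"
  proof (rule integral_iid_mult[OF J])
    show "depends_on J (indicat_real A)" "depends_on J' (indicat_real B)"
      using dep by (simp_all add: depends_on_indicator)
  qed (intro integrable_real_indicator; simp add: emeasure_eq_measure)+
  then show ?thesis
    by (simp flip: indicator_inter_arith)
qed

section \<open>Strong mixing of the Bernoulli shift\<close>

abbreviation shift :: "int \<Rightarrow> (int \<Rightarrow> 's) \<Rightarrow> int \<Rightarrow> 's" where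
  "shift n z \<equiv> \<lambda>k. z (k + n)"

lemma inj_add_int: "inj (\<lambda>k::int. k + n)"
  by (rule injI) simp

lemma sets_iid_reindex: "B \<in> sets (iid p) \<Longrightarrow> {z. (\<lambda>i. z (\<pi> i)) \<in> B} \<in> sets (iid p)"
  using measurable_sets[OF measurable_iid_reindex, of B p \<pi>] by (simp add: vimage_def)

lemma measure_iid_reindex:
  assumes "inj \<pi>" and "B \<in> sets (iid p)"
  shows "measure (iid p) {z. (\<lambda>i. z (\<pi> i)) \<in> B} = measure (iid p) B"
  using measure_distr[OF measurable_iid_reindex assms(2), of \<pi>] distr_iid_reindex[OF assms(1), of p]
  by (simp add: vimage_def)

definition cylinders :: "nat pmf \<Rightarrow> ('i \<Rightarrow> nat) set set" where
  "cylinders p = {A \<in> sets (iid p). \<exists>J. finite J \<and> depends_on J (\<lambda>z. z \<in> A)}"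

lemma sets_iid_cylinders: "sets (iid p) = sigma_sets UNIV (cylinders p)"
proof
  have single: "{z. z i \<in> A} \<in> cylinders p" for i :: 'i and A
  proof -
    have "(\<lambda>z. z i) -` A \<inter> space (iid p) \<in> sets (iid p)"
      by (rule measurable_sets[OF measurable_iid_count]) simp
    moreover have "depends_on {i} (\<lambda>z. z \<in> {z. z i \<in> A})"
      by (rule depends_onI) simp
    ultimately show ?thesis
      unfolding cylinders_def by (auto simp: vimage_def intro!: exI[of _ "{i}"])
  qed
  have "sets (iid p :: ('i \<Rightarrow> nat) measure) =
      sigma_sets UNIV {{f. f i \<in> A} |i A. i \<in> (UNIV :: 'i set) \<and> A \<in> sets (measure_pmf p)}"
    unfolding iid_def by (subst sets_PiM_single) (simp add: PiE_UNIV_domain)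
  also have "\<dots> \<subseteq> sigma_sets UNIV (cylinders p)"
    by (rule sigma_sets_mono) (auto intro!: sigma_sets.Basic single)
  finally show "sets (iid p :: ('i \<Rightarrow> nat) measure) \<subseteq> sigma_sets UNIV (cylinders p)" .
  have "sigma_sets (space (iid p)) (cylinders p) \<subseteq> sets (iid p :: ('i \<Rightarrow> nat) measure)"
    by (rule sets.sigma_sets_subset) (auto simp: cylinders_def)
  then show "sigma_sets UNIV (cylinders p) \<subseteq> sets (iid p :: ('i \<Rightarrow> nat) measure)" by simp
qed

lemma Int_stable_cylinders: "Int_stable (cylinders p)"
proof (rule Int_stableI)
  fix A B :: "('i \<Rightarrow> nat) set" assume "A \<in> cylinders p" "B \<in> cylinders p"
  then obtain J J' where "finite J" "finite J'" and
    dep: "depends_on J (\<lambda>z. z \<in> A)" "depends_on J' (\<lambda>z. z \<in> B)"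
    and sets: "A \<in> sets (iid p)" "B \<in> sets (iid p)"
    by (auto simp: cylinders_def)
  have "depends_on (J \<union> J') (\<lambda>z. z \<in> A \<inter> B)"
  proof (rule depends_onI)
    fix z z' :: "'i \<Rightarrow> nat" assume *: "\<And>i. i \<in> J \<union> J' \<Longrightarrow> z i = z' i"
    show "(z \<in> A \<inter> B) = (z' \<in> A \<inter> B)"
      using depends_onD[OF dep(1), of z z'] depends_onD[OF dep(2), of z z'] * by auto
  qed
  then show "A \<inter> B \<in> cylinders p"
    using \<open>finite J\<close> \<open>finite J'\<close> sets unfolding cylinders_def by (auto intro!: exI[of _ "J \<union> J'"])
qed

text \<open>Once n exceeds all differences of coordinates, the two finite sets of coordinates are
  disjoint and the events are independent: the sequence is eventually constant.\<close>

lemma iid_mixing_cylinders: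
  fixes A B :: "(int \<Rightarrow> nat) set"
  assumes "A \<in> cylinders p" "B \<in> cylinders p"
  shows "(\<lambda>n. measure (iid p) (A \<inter> {z. shift (int n) z \<in> B})) \<longlonglongrightarrow> measure (iid p) A * measure (iid p) B"
proof -
  from assms obtain J J' where fin: "finite J" "finite J'" and
    dep: "depends_on J (\<lambda>z. z \<in> A)" "depends_on J' (\<lambda>z. z \<in> B)"
    and [measurable]: "A \<in> sets (iid p)" "B \<in> sets (iid p)"
    by (auto simp: cylinders_def)
  obtain N where N: "\<And>i j. i \<in> J \<Longrightarrow> j \<in> J' \<Longrightarrow> i - j < int N"
  proof -
    have "finite ((\<lambda>(i, j). i - j) ` (J \<times> J'))" using fin by auto
    then obtain M where M: "\<And>x. x \<in> (\<lambda>(i, j). i - j) ` (J \<times> J') \<Longrightarrow> x \<le> M"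
      using Max_ge by blast
    show ?thesis
    proof (rule that[of "nat (M + 1)"])
      fix i j assume "i \<in> J" "j \<in> J'"
      then have "i - j \<le> M" by (intro M) auto
      then show "i - j < int (nat (M + 1))" by simp
    qed
  qed
  have "measure (iid p) (A \<inter> {z. shift (int n) z \<in> B}) = measure (iid p) A * measure (iid p) B"
    if "n \<ge> N" for n
  proof -
    have "measure (iid p) (A \<inter> {z. shift (int n) z \<in> B}) =
        measure (iid p) A * measure (iid p) {z. shift (int n) z \<in> B}"
    proof (rule measure_iid_Int)
      show "J \<inter> (\<lambda>k. k + int n) ` J' = {}"
        using N that by force
      show "depends_on J (\<lambda>z. z \<in> A)" by fact
      show "depends_on ((\<lambda>k. k + int n) ` J') (\<lambda>z. z \<in> {z. shift (int n) z \<in> B})"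
        by (rule depends_onI) (auto intro!: depends_onD[OF dep(2)])
    qed (simp_all add: sets_iid_reindex)
    also have "measure (iid p) {z. shift (int n) z \<in> B} = measure (iid p) B"
      by (rule measure_iid_reindex[OF inj_add_int]) simp
    finally show ?thesis .
  qed
  then show ?thesis
    by (intro tendsto_eventually) (auto simp: eventually_at_top_linorder)
qed

text \<open>Dynkin's principle for the intersection-stable family of cylinders, with the empty set
  absorbed into the cylinder case.\<close>

lemma iid_induct_disjoint [consumes 1, case_names cylinder compl union]:
  assumes "A \<in> sets (iid p)"
    and cyl: "\<And>A. A \<in> cylinders p \<Longrightarrow> Q A"
    and compl: "\<And>A. A \<in> sets (iid p) \<Longrightarrow> Q A \<Longrightarrow> Q (- A)"
    and union: "\<And>A :: nat \<Rightarrow> ('i \<Rightarrow> nat) set. disjoint_family A \<Longrightarrow> range A \<subseteq> sets (iid p) \<Longrightarrow>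
      (\<And>i. Q (A i)) \<Longrightarrow> Q (\<Union>i. A i)"
  shows "Q A"
proof -
  have "cylinders p \<subseteq> Pow UNIV" "A \<in> sigma_sets UNIV (cylinders p)"
    using assms(1) by (simp_all add: sets_iid_cylinders)
  with Int_stable_cylinders show ?thesis
  proof (induct rule: sigma_sets_induct_disjoint)
    case empty
    show ?case by (rule cyl[of "{}"]) (auto simp: cylinders_def depends_on_def intro: exI[of _ "{}"])
  next
    case (compl A)
    with assms(3)[of A] show ?case by (simp add: sets_iid_cylinders Compl_eq_Diff_UNIV)
  next
    case (union A)
    with assms(4)[of A] show ?case by (simp add: sets_iid_cylinders)
  qed (auto intro: cyl)
qed

text \<open>Tannery's theorem in the form that the union steps of the Dynkin inductions use: the
  limit in n passes through the sum over the disjoint pieces.\<close>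

lemma suminf_limit_dominated:
  fixes f :: "nat \<Rightarrow> nat \<Rightarrow> real"
  assumes "\<And>n. (\<lambda>i. f i n) sums F n" and "\<And>i. (\<lambda>n. f i n) \<longlonglongrightarrow> g i" and "g sums G"
    and "\<And>i n. \<bar>f i n\<bar> \<le> b i" and "summable b"
  shows "F \<longlonglongrightarrow> G"
proof -
  have "(\<lambda>n. \<Sum>i. f i n) \<longlonglongrightarrow> suminf g"
    using tannerys_theorem[of f g sequentially b] assms
    by (auto simp: always_eventually)
  then show ?thesis
    using assms(1,3) by (simp add: sums_iff)
qed

text \<open>Two nested Dynkin inductions: over A for a fixed cylinder B, then over B for a fixed
  arbitrary A.\<close>

proposition iid_shift_strong_mixing:
  fixes A B :: "(int \<Rightarrow> nat) set"
  assumes A: "A \<in> sets (iid p)" and B: "B \<in> sets (iid p)"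
  shows "(\<lambda>n. measure (iid p) (A \<inter> {z. shift (int n) z \<in> B})) \<longlonglongrightarrow> measure (iid p) A * measure (iid p) B"
proof -
  interpret prob_space "iid p :: (int \<Rightarrow> nat) measure" by (rule prob_space_iid)
  note [measurable] = sets_iid_reindex
  have sh: "prob {z. shift n z \<in> B} = prob B" if "B \<in> events" for B n
    by (rule measure_iid_reindex[OF inj_add_int that])
  have cyl: "(\<lambda>n. prob (A \<inter> {z. shift (int n) z \<in> B})) \<longlonglongrightarrow> prob A * prob B"
    if "A \<in> events" "B \<in> cylinders p" for A B
    using that(1)
  proof (induction A rule: iid_induct_disjoint)
    case (cylinder A)
    then show ?case using iid_mixing_cylinders that(2) by blast
  next
    case (compl A)
    have [measurable]: "A \<in> events" "B \<in> events" using compl that(2) by (auto simp: cylinders_def)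
    have "prob (- A \<inter> {z. shift (int n) z \<in> B}) = prob B - prob (A \<inter> {z. shift (int n) z \<in> B})" for n
    proof -
      have "- A \<inter> {z. shift (int n) z \<in> B} = {z. shift (int n) z \<in> B} - (A \<inter> {z. shift (int n) z \<in> B})"
        by auto
      then show ?thesis
        by (simp add: finite_measure_Diff sets_iid_reindex sh)
    qed
    moreover have "prob (- A) * prob B = prob B - prob A * prob B"
      using prob_compl[of A] by (simp add: Compl_eq_Diff_UNIV left_diff_distrib)
    ultimately show ?case
      using compl(2) by (auto intro!: tendsto_intros)
  next
    case (union A)
    have Bm: "B \<in> events" using that(2) by (auto simp: cylinders_def)
    have disj: "disjoint_family (\<lambda>i. A i \<inter> {z. shift (int n) z \<in> B})" for n
      using union(1) by (auto simp: disjoint_family_on_def)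
    have Am: "A i \<in> events" for i using union(2) by auto
    have s: "(\<lambda>i. prob (A i)) sums prob (\<Union>i. A i)"
      using union(1,2) by (intro finite_measure_UNION)
    show ?case
    proof (rule suminf_limit_dominated)
      show "(\<lambda>i. prob (A i \<inter> {z. shift (int n) z \<in> B})) sums prob ((\<Union>i. A i) \<inter> {z. shift (int n) z \<in> B})" for n
        using finite_measure_UNION[OF _ disj[of n]] Am sets_iid_reindex[OF Bm, of "\<lambda>k. k + int n"]
        by (auto simp: Int_UN_distrib2 image_subset_iff)
      show "(\<lambda>i. prob (A i) * prob B) sums (prob (\<Union>i. A i) * prob B)"
        using s by (rule sums_mult2)
      show "\<bar>prob (A i \<inter> {z. shift (int n) z \<in> B})\<bar> \<le> prob (A i)" for i n
        using Am by (auto intro: finite_measure_mono)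
      show "summable (\<lambda>i. prob (A i))" using s by (rule sums_summable)
    qed (rule union)
  qed
  show ?thesis
    using B
  proof (induction B rule: iid_induct_disjoint)
    case (cylinder B)
    then show ?case using cyl A by blast
  next
    case (compl B)
    have [measurable]: "A \<in> events" "B \<in> events" using compl A by auto
    have "prob (A \<inter> {z. shift (int n) z \<in> - B}) = prob A - prob (A \<inter> {z. shift (int n) z \<in> B})" for n
    proof -
      have "A \<inter> {z. shift (int n) z \<in> - B} = A - (A \<inter> {z. shift (int n) z \<in> B})"
        by auto
      then show ?thesis
        by (simp add: finite_measure_Diff sets_iid_reindex)
    qed
    moreover have "prob A * prob (- B) = prob A - prob A * prob B"
      using prob_compl[of B] by (simp add: Compl_eq_Diff_UNIV right_diff_distrib)
    ultimately show ?case
      using compl(2) by (auto intro!: tendsto_intros)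
  next
    case (union B)
    have disj: "disjoint_family (\<lambda>i. A \<inter> {z. shift (int n) z \<in> B i})" for n
      using union(1) by (auto simp: disjoint_family_on_def)
    have Bm: "B i \<in> events" for i using union(2) by auto
    have s: "(\<lambda>i. prob (B i)) sums prob (\<Union>i. B i)"
      using union(1,2) by (intro finite_measure_UNION)
    show ?case
    proof (rule suminf_limit_dominated)
      have "A \<inter> {z. shift (int n) z \<in> (\<Union>i. B i)} = (\<Union>i. A \<inter> {z. shift (int n) z \<in> B i})" for n
        by auto
      then show "(\<lambda>i. prob (A \<inter> {z. shift (int n) z \<in> B i})) sums prob (A \<inter> {z. shift (int n) z \<in> (\<Union>i. B i)})" for n
        using finite_measure_UNION[OF _ disj[of n]] A sets_iid_reindex[OF Bm, of "\<lambda>k. k + int n"]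
        by (auto simp: image_subset_iff)
      show "(\<lambda>i. prob A * prob (B i)) sums (prob A * prob (\<Union>i. B i))"
        using s by (rule sums_mult)
      \<comment> \<open>Invariance under the shift makes the dominating terms independent of
        n.\<close>
      show "\<bar>prob (A \<inter> {z. shift (int n) z \<in> B i})\<bar> \<le> prob (B i)" for i n
        using finite_measure_mono[of "A \<inter> {z. shift (int n) z \<in> B i}" "{z. shift (int n) z \<in> B i}"]
          Bm sh[OF Bm] by (simp add: sets_iid_reindex)
      show "summable (\<lambda>i. prob (B i))" using s by (rule sums_summable)
    qed (rule union)
  qed
qed

section \<open>Covariances of functions of independent variables\<close>

text \<open>The index \<open>(k, True)\<close> carries the original \<open>k\<close>-th coordinate, \<open>(k, False)\<close> its independent copy.\<close>

definition mix :: "int set \<Rightarrow> (int \<times> bool \<Rightarrow> 's) \<Rightarrow> int \<Rightarrow> 's" where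
  "mix K z = (\<lambda>k. z (k, k \<notin> K))"

lemma inj_mix: "inj (\<lambda>k::int. (k, k \<notin> K))"
  by (rule injI) simp

lemma measurable_mix [measurable]: "mix K \<in> iid p \<rightarrow>\<^sub>M iid p"
  unfolding mix_def[abs_def] by (rule measurable_iid_reindex)

lemma integral_mix:
  fixes F :: "(int \<Rightarrow> nat) \<Rightarrow> real"
  shows "F \<in> borel_measurable (iid p) \<Longrightarrow> (\<integral>z. F (mix K z) \<partial>iid p) = (\<integral>z. F z \<partial>iid p)"
  unfolding mix_def by (rule integral_iid_reindex[OF inj_mix])

lemma integrable_mix:
  fixes F :: "(int \<Rightarrow> nat) \<Rightarrow> real"
  shows "integrable (iid p) F \<Longrightarrow> integrable (iid p) (\<lambda>z. F (mix K z))"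
  unfolding mix_def by (rule integrable_iid_reindex[OF inj_mix])

lemma AE_mix: "AE z in iid p. P z \<Longrightarrow> AE z in iid p. P (mix K z)"
  unfolding mix_def by (rule AE_iid_reindex[OF inj_mix])

text \<open>Exchanging the two copies of the \<open>k\<close>-th coordinate preserves the law of the doubled
  sequence; averaging the two resulting expressions makes the increment of \<open>F\<close> appear.\<close>

lemma integral_mix_insert:
  fixes F G :: "(int \<Rightarrow> nat) \<Rightarrow> real"
  assumes k: "k \<notin> K"
    and meas: "F \<in> borel_measurable (iid p)" "G \<in> borel_measurable (iid p)"
    and int: "\<And>A B. integrable (iid p) (\<lambda>z. F (mix A z) * G (mix B z))"
  shows "(\<integral>z. F (mix {} z) * (G (mix K z) - G (mix (insert k K) z)) \<partial>iid p) =
    1/2 * (\<integral>z. (F (mix {} z) - F (mix {k} z)) * (G (mix K z) - G (mix (insert k K) z)) \<partial>iid p)"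
proof -
  let ?\<pi> = "\<lambda>(i, b). (i::int, if i = k then \<not> b else b)"
  have inj: "inj ?\<pi>" by (rule injI) (auto split: if_splits)
  have mix: "mix {} (\<lambda>i. z (?\<pi> i)) = mix {k} z" "mix K (\<lambda>i. z (?\<pi> i)) = mix (insert k K) z"
    "mix (insert k K) (\<lambda>i. z (?\<pi> i)) = mix K z" for z :: "int \<times> bool \<Rightarrow> nat"
    using k by (auto simp: mix_def fun_eq_iff)
  have "(\<integral>z. F (mix {} z) * (G (mix K z) - G (mix (insert k K) z)) \<partial>iid p) =
      (\<integral>z. F (mix {} (\<lambda>i. z (?\<pi> i))) * (G (mix K (\<lambda>i. z (?\<pi> i))) -
        G (mix (insert k K) (\<lambda>i. z (?\<pi> i)))) \<partial>iid p)"
    by (rule integral_iid_reindex[OF inj, symmetric])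
      (intro borel_measurable_times borel_measurable_diff measurable_compose[OF measurable_mix] meas)
  also have "\<dots> = (\<integral>z. F (mix {k} z) * (G (mix (insert k K) z) - G (mix K z)) \<partial>iid p)"
    unfolding mix ..
  finally have sym: "(\<integral>z. F (mix {} z) * (G (mix K z) - G (mix (insert k K) z)) \<partial>iid p) =
      (\<integral>z. F (mix {k} z) * (G (mix (insert k K) z) - G (mix K z)) \<partial>iid p)" .
  have diff: "(\<integral>z. F (mix A z) * (G (mix B z) - G (mix C z)) \<partial>iid p) =
      (\<integral>z. F (mix A z) * G (mix B z) \<partial>iid p) - (\<integral>z. F (mix A z) * G (mix C z) \<partial>iid p)"
    and diff_int: "integrable (iid p) (\<lambda>z. F (mix A z) * (G (mix B z) - G (mix C z)))" for A B C
    using int by (simp_all add: right_diff_distrib)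
  show ?thesis
    using sym by (simp add: left_diff_distrib Bochner_Integration.integral_diff[OF diff_int diff_int] diff)
qed

text \<open>The coordinates of K are resampled in G one after the other, and each costs at most half
  of \<open>e k\<close>. The bound \<open>e\<close> is uniform in the set already resampled, so the
  order is immaterial.\<close>

lemma integral_mix_telescope:
  fixes F G :: "(int \<Rightarrow> nat) \<Rightarrow> real"
  assumes [measurable]: "F \<in> borel_measurable (iid p)" "G \<in> borel_measurable (iid p)"
    and int: "\<And>A B. integrable (iid p) (\<lambda>z. F (mix A z) * G (mix B z))"
    and e: "\<And>k K. \<bar>\<integral>z. (F (mix {} z) - F (mix {k} z)) * (G (mix K z) - G (mix (insert k K) z)) \<partial>iid p\<bar> \<le> e k"
    and "finite K"
  shows "\<bar>(\<integral>z. F (mix {} z) * G (mix {} z) \<partial>iid p) - (\<integral>z. F (mix {} z) * G (mix K z) \<partial>iid p)\<bar> \<le> (\<Sum>k\<in>K. e k) / 2"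
  using \<open>finite K\<close>
proof induction
  case (insert k K)
  have "(\<integral>z. F (mix {} z) * G (mix K z) \<partial>iid p) - (\<integral>z. F (mix {} z) * G (mix (insert k K) z) \<partial>iid p) =
      (\<integral>z. F (mix {} z) * (G (mix K z) - G (mix (insert k K) z)) \<partial>iid p)"
    using int by (simp add: algebra_simps)
  also have "\<bar>\<dots>\<bar> \<le> e k / 2"
    using e[of k K] by (subst integral_mix_insert[OF insert(2)]) (auto simp: int)
  finally have "\<bar>(\<integral>z. F (mix {} z) * G (mix {} z) \<partial>iid p) - (\<integral>z. F (mix {} z) * G (mix (insert k K) z) \<partial>iid p)\<bar>
      \<le> (\<Sum>k\<in>K. e k) / 2 + e k / 2"
    using insert.IH by linarith
  then show ?case using insert.hyps by (simp add: add_divide_distrib)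
qed simp

text \<open>The far end of the telescope: with all coordinates resampled, the two factors live on
  disjoint halves of the doubled sequence and are independent.\<close>

lemma integral_mix_UNIV:
  fixes F G :: "(int \<Rightarrow> nat) \<Rightarrow> real"
  assumes int: "integrable (iid p) F" "integrable (iid p) G"
  shows "(\<integral>z. F (mix {} z) * G (mix UNIV z) \<partial>iid p) = (\<integral>z. F z \<partial>iid p) * (\<integral>z. G z \<partial>iid p)"
proof -
  have "(\<integral>z. F (mix {} z) * G (mix UNIV z) \<partial>iid p) =
      (\<integral>z. F (mix {} z) \<partial>iid p) * (\<integral>z. G (mix UNIV z) \<partial>iid p)"
  proof (rule integral_iid_mult)
    show "UNIV \<times> {True} \<inter> UNIV \<times> {False} = {}" by auto
    show "depends_on (UNIV \<times> {True}) (\<lambda>z. F (mix {} z))" "depends_on (UNIV \<times> {False}) (\<lambda>z. G (mix UNIV z))"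
      by (auto intro!: depends_onI arg_cong[of _ _ F] arg_cong[of _ _ G] simp: mix_def)
  qed (intro integrable_mix int)+
  then show ?thesis using int by (simp add: integral_mix)
qed

text \<open>In the manner of Efron and Stein. A finite telescope reaches only finitely many
  coordinates; \<open>lim\<close> bridges the gap between resampling growing windows and resampling
  everything.\<close>

proposition iid_covariance_bound:
  fixes F G :: "(int \<Rightarrow> nat) \<Rightarrow> real"
  assumes int1: "integrable (iid p) F" "integrable (iid p) G"
    and int: "\<And>A B. integrable (iid p) (\<lambda>z. F (mix A z) * G (mix B z))"
    and e: "\<And>k K. \<bar>\<integral>z. (F (mix {} z) - F (mix {k} z)) * (G (mix K z) - G (mix (insert k K) z)) \<partial>iid p\<bar> \<le> e k"
    and e_sum: "e summable_on UNIV"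
    and lim: "(\<lambda>N. \<integral>z. F (mix {} z) * G (mix {- int N..int N} z) \<partial>iid p) \<longlonglongrightarrow>
        (\<integral>z. F (mix {} z) * G (mix UNIV z) \<partial>iid p)"
  shows "\<bar>(\<integral>z. F z * G z \<partial>iid p) - (\<integral>z. F z \<partial>iid p) * (\<integral>z. G z \<partial>iid p)\<bar> \<le> infsum e UNIV"
proof -
  have [measurable]: "F \<in> borel_measurable (iid p)" "G \<in> borel_measurable (iid p)"
    using int1 by auto
  have e0: "0 \<le> e k" for k using e[of k "{}"] by (rule order_trans[OF abs_ge_zero])
  have "(\<integral>z. F (mix {} z) * G (mix {} z) \<partial>iid p) = (\<integral>z. F z * G z \<partial>iid p)"
    by (rule integral_mix[where F = "\<lambda>z. F z * G z"]) measurable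
  moreover have "\<bar>(\<integral>z. F (mix {} z) * G (mix {} z) \<partial>iid p) - (\<integral>z. F (mix {} z) * G (mix {- int N..int N} z) \<partial>iid p)\<bar>
      \<le> infsum e UNIV" for N
  proof -
    have "(\<Sum>k\<in>{- int N..int N}. e k) / 2 \<le> (\<Sum>k\<in>{- int N..int N}. e k)"
      using e0 by (simp add: sum_nonneg)
    also have "\<dots> \<le> infsum e UNIV"
      by (rule finite_sum_le_infsum) (auto simp: e_sum e0)
    finally show ?thesis
      using integral_mix_telescope[where F = F and G = G and p = p and e = e and K = "{- int N..int N}"] int e
      by force
  qed
  ultimately have "\<bar>(\<integral>z. F z * G z \<partial>iid p) - (\<integral>z. F (mix {} z) * G (mix {- int N..int N} z) \<partial>iid p)\<bar>
      \<le> infsum e UNIV" for N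
    by simp
  moreover have "(\<lambda>N. \<bar>(\<integral>z. F z * G z \<partial>iid p) - (\<integral>z. F (mix {} z) * G (mix {- int N..int N} z) \<partial>iid p)\<bar>)
      \<longlonglongrightarrow> \<bar>(\<integral>z. F z * G z \<partial>iid p) - (\<integral>z. F z \<partial>iid p) * (\<integral>z. G z \<partial>iid p)\<bar>"
    using lim integral_mix_UNIV[OF int1] by (auto intro!: tendsto_intros)
  ultimately show ?thesis
    by (intro LIMSEQ_le_const2) auto
qed

section \<open>Weighted sums over the integers\<close>

lemma int_decode_bij: "bij_betw int_decode UNIV UNIV"
  by (simp add: bij_int_decode)

text \<open>Unlike \<open>infsum\<close>, a sum along an enumeration of the integers is a limit of a sequence, hence
  measurable in a parameter.  It is only meaningful for absolutely summable functions.\<close>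

definition rsum :: "(int \<Rightarrow> 'b::banach) \<Rightarrow> 'b" where
  "rsum f = (\<Sum>n. f (int_decode n))"

lemma summable_on_int_decode:
  fixes f :: "int \<Rightarrow> real"
  assumes "\<And>k. 0 \<le> f k"
  shows "f summable_on UNIV \<longleftrightarrow> summable (\<lambda>n. f (int_decode n))"
proof -
  have "f summable_on UNIV \<longleftrightarrow> (\<lambda>n. f (int_decode n)) summable_on UNIV"
    using summable_on_reindex_bij_betw[OF int_decode_bij, of f] by simp
  also have "\<dots> \<longleftrightarrow> summable (\<lambda>n. f (int_decode n))"
    using assms by (intro summable_on_UNIV_nonneg_real_iff) auto
  finally show ?thesis .
qed

lemma has_sum_rsum:
  fixes f :: "int \<Rightarrow> 'b::banach"
  assumes "(\<lambda>k. norm (f k)) summable_on UNIV"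
  shows "(f has_sum rsum f) UNIV"
proof -
  have "summable (\<lambda>n. norm (f (int_decode n)))"
    using assms summable_on_int_decode[of "\<lambda>k. norm (f k)"] by simp
  then have "((\<lambda>n. f (int_decode n)) has_sum (\<Sum>n. f (int_decode n))) UNIV"
    by (intro norm_summable_imp_has_sum summable_sums) (auto intro: summable_norm_cancel)
  then show ?thesis
    unfolding rsum_def using has_sum_reindex_bij_betw[OF int_decode_bij, of f] by simp
qed

lemma has_sum_rsum_nonneg:
  fixes f :: "int \<Rightarrow> real"
  assumes "f summable_on UNIV" "\<And>k. 0 \<le> f k"
  shows "(f has_sum rsum f) UNIV"
  using assms by (intro has_sum_rsum) simp

lemma rsum_eqI:
  fixes f :: "int \<Rightarrow> 'b::banach"
  assumes "(\<lambda>k. norm (f k)) summable_on UNIV" "(f has_sum s) UNIV"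
  shows "rsum f = s"
  using has_sum_unique[OF has_sum_rsum[OF assms(1)] assms(2)] .

lemma summable_on_comparison:
  fixes f g :: "int \<Rightarrow> real"
  assumes "g summable_on UNIV" "\<And>k. 0 \<le> f k" "\<And>k. f k \<le> g k"
  shows "f summable_on UNIV"
  using summable_on_comparison_test[OF assms(1)] assms(2,3) by auto

lemma borel_measurable_rsum [measurable]:
  fixes f :: "int \<Rightarrow> 'a \<Rightarrow> 'b::{banach, second_countable_topology}"
  assumes [measurable]: "\<And>k. f k \<in> borel_measurable M"
  shows "(\<lambda>x. rsum (\<lambda>k. f k x)) \<in> borel_measurable M"
  unfolding rsum_def by measurable

text \<open>Tonelli: the expected value of the sum of the nonnegative terms is finite, which gives
  almost sure convergence and integrability at once.\<close>

lemma
  fixes w :: "int \<Rightarrow> real" and h :: "nat \<Rightarrow> real"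
  assumes w: "w summable_on UNIV" "\<And>k. 0 \<le> w k"
    and h: "integrable (measure_pmf p) h" "\<And>l. 0 \<le> h l"
  shows AE_summable_iid: "AE z in iid p. (\<lambda>k. w k * h (z k)) summable_on UNIV"
    and integrable_rsum_iid: "integrable (iid p) (\<lambda>z. rsum (\<lambda>k. w k * h (z k)))"
    and integral_rsum_iid: "(\<integral>z. rsum (\<lambda>k. w k * h (z k)) \<partial>iid p) = rsum w * measure_pmf.expectation p h"
proof -
  let ?f = "\<lambda>n z. w (int_decode n) * h (z (int_decode n))"
  have int: "integrable (iid p) (?f n)" for n
    using h by (simp add: integrable_iid_component)
  have eq: "(\<integral>z. ?f n z \<partial>iid p) = w (int_decode n) * measure_pmf.expectation p h" for n
    by (simp add: integral_iid_component)
  have nonneg: "0 \<le> ?f n z" for n z using w(2) h(2) by simp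
  have nn: "(\<integral>\<^sup>+z. ennreal (?f n z) \<partial>iid p) = ennreal (w (int_decode n) * measure_pmf.expectation p h)" for n
    using nn_integral_eq_integral[OF int, of n] nonneg by (simp only: eq AE_I2)
  have Eh: "0 \<le> measure_pmf.expectation p h" using h(2) by simp
  have ws: "summable (\<lambda>n. w (int_decode n))"
    using w by (simp add: summable_on_int_decode)
  have sm: "summable (\<lambda>n. w (int_decode n) * measure_pmf.expectation p h)"
    using ws by (rule summable_mult2)
  have "(\<integral>\<^sup>+z. (\<Sum>n. ennreal (?f n z)) \<partial>iid p) = (\<Sum>n. \<integral>\<^sup>+z. ennreal (?f n z) \<partial>iid p)"
    by (intro nn_integral_suminf) measurable
  also have "\<dots> = (\<Sum>n. ennreal (w (int_decode n) * measure_pmf.expectation p h))"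
    by (simp only: nn)
  also have "\<dots> \<noteq> \<infinity>"
    using sm w(2) Eh by (subst suminf_ennreal2) simp_all
  finally have "AE z in iid p. (\<Sum>n. ennreal (?f n z)) \<noteq> \<infinity>"
    by (intro nn_integral_PInf_AE) measurable
  then have ae: "AE z in iid p. summable (\<lambda>n. ?f n z)"
    by eventually_elim (rule summable_suminf_not_top, use nonneg in auto)
  then show "AE z in iid p. (\<lambda>k. w k * h (z k)) summable_on UNIV"
    using summable_on_int_decode[of "\<lambda>k. w k * h (_ k)"] w(2) h(2) by simp
  have ae': "AE z in iid p. summable (\<lambda>n. norm (?f n z))"
    using ae nonneg by simp
  have sm': "summable (\<lambda>n. \<integral>z. norm (?f n z) \<partial>iid p)"
    using sm nonneg by (simp add: integral_iid_component)
  show "integrable (iid p) (\<lambda>z. rsum (\<lambda>k. w k * h (z k)))"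
    unfolding rsum_def by (rule integrable_suminf[OF int ae' sm'])
  have "(\<integral>z. rsum (\<lambda>k. w k * h (z k)) \<partial>iid p) = (\<Sum>n. \<integral>z. ?f n z \<partial>iid p)"
    unfolding rsum_def by (rule integral_suminf[OF int ae' sm'])
  also have "\<dots> = rsum w * measure_pmf.expectation p h"
    unfolding eq rsum_def using ws by (rule suminf_mult2[symmetric])
  finally show "(\<integral>z. rsum (\<lambda>k. w k * h (z k)) \<partial>iid p) = rsum w * measure_pmf.expectation p h" .
qed

section \<open>Exponential moments of weighted sums\<close>

lemma exp_sum_list_le:
  fixes xs :: "real list"
  assumes "xs \<noteq> []"
  shows "exp (sum_list xs) \<le> (\<Sum>x\<leftarrow>xs. exp (real (length xs) * x))"
proof -
  have "\<exists>x\<in>set xs. sum_list xs \<le> real (length xs) * x"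
    using assms
  proof (induction xs)
    case (Cons a xs)
    show ?case
    proof (cases "xs = []")
      case False
      with Cons obtain x where x: "x \<in> set xs" "sum_list xs \<le> real (length xs) * x" by auto
      show ?thesis
      proof (cases "a \<le> x")
        case True
        with x show ?thesis by (intro bexI[of _ x]) (auto simp: algebra_simps)
      next
        case False
        then have "real (length xs) * x \<le> real (length xs) * a"
          by (intro mult_left_mono) auto
        with x show ?thesis by (intro bexI[of _ a]) (auto simp: algebra_simps)
      qed
    qed simp
  qed simp
  then obtain x where x: "x \<in> set xs" "sum_list xs \<le> real (length xs) * x" by auto
  then have "exp (sum_list xs) \<le> exp (real (length xs) * x)" by simp
  also have "\<dots> \<le> (\<Sum>x\<leftarrow>xs. exp (real (length xs) * x))"
    using x(1) by (intro member_le_sum_list) auto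
  finally show ?thesis .
qed

text \<open>Total mass 1 turns the weights into a probability on the integers, as Jensen's
  inequality requires. \<open>a_conv\<close> is the pointwise form of a convolution estimate:
  summing it over k bounds the self-convolution of \<open>a\<close> at n by
  \<open>2 * K * a n\<close>. The index 0 with \<open>c 0 = 0\<close> stands for an absent
  term.\<close>

locale summable_weights =
  fixes p :: "nat pmf" and c :: "nat \<Rightarrow> real" and a :: "int \<Rightarrow> real" and K :: real
  assumes c_nonneg: "0 \<le> c l" and c_0: "c 0 = 0"
    and exp_c: "integrable (measure_pmf p) (\<lambda>l. exp (real m * c l))"
    and a_pos: "0 < a k" and a_sum: "(a has_sum 1) UNIV"
    and a_conv: "a k * a (k - n) \<le> K * a n * (a k + a (k - n))"
begin

definition M :: "nat \<Rightarrow> real" where "M m = measure_pmf.expectation p (\<lambda>l. exp (real m * c l))"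

definition V :: "(int \<Rightarrow> real) \<Rightarrow> nat \<Rightarrow> (int \<Rightarrow> nat) \<Rightarrow> real" where
  "V w m z = rsum (\<lambda>k. w k * exp (real m * c (z k)))"

text \<open>Quantifying over every center i makes the set invariant under shifts, and over every m
  provides all exponential moments; these are countably many almost sure conditions.\<close>

definition good :: "(int \<Rightarrow> nat) \<Rightarrow> bool" where
  "good z \<longleftrightarrow> (\<forall>i m. (\<lambda>k. a (k - i) * exp (real m * c (z k))) summable_on UNIV)"

text \<open>The majorant for the norm of the random series seen from time i.\<close>

definition R :: "int \<Rightarrow> (int \<Rightarrow> nat) \<Rightarrow> real" where
  "R i z = rsum (\<lambda>k. a (k - i) * c (z k))"

lemma K_pos: "0 < K"
proof (rule ccontr)
  assume "\<not> 0 < K"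
  moreover have "0 < a 0 * (a 0 + a 0)" using a_pos by simp
  ultimately have "K * (a 0 * (a 0 + a 0)) \<le> 0" by (simp add: mult_nonpos_nonneg)
  moreover have "0 < a 0 * a 0" using a_pos by simp
  ultimately show False using a_conv[of 0 0] by (simp add: mult.assoc)
qed

lemma a_nonneg: "0 \<le> a k"
  using a_pos[of k] by simp

lemma a_shift_sum: "((\<lambda>k. a (k - i)) has_sum 1) UNIV"
proof -
  have "bij_betw (\<lambda>k::int. k - i) UNIV UNIV"
    by (rule bij_betwI[of _ _ _ "\<lambda>k. k + i"]) auto
  from has_sum_reindex_bij_betw[OF this, of a] show ?thesis using a_sum by simp
qed

lemma a_summable: "(\<lambda>k. a (k - i)) summable_on UNIV"
  using a_shift_sum by (auto simp: summable_on_def)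

lemma a_le_1: "a k \<le> 1"
proof -
  have "sum a {k} \<le> infsum a UNIV"
    using a_summable[of 0] a_nonneg by (intro finite_sum_le_infsum) auto
  then show ?thesis using infsumI[OF a_sum] by simp
qed

lemma M_ge_1: "1 \<le> M m"
proof -
  have "measure_pmf.expectation p (\<lambda>l. 1::real) \<le> M m"
    unfolding M_def using exp_c c_nonneg by (intro integral_mono) auto
  then show ?thesis by simp
qed

lemma
  assumes "w summable_on UNIV" "\<And>k. 0 \<le> w k"
  shows integrable_V: "integrable (iid p) (V w m)"
    and integral_V: "(\<integral>z. V w m z \<partial>iid p) = rsum w * M m"
  using integrable_rsum_iid[OF assms exp_c] integral_rsum_iid[OF assms exp_c]
  by (simp_all add: V_def[abs_def] M_def)

lemma AE_good: "AE z in iid p. good z"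
  unfolding good_def AE_all_countable
  by (intro allI AE_summable_iid exp_c a_summable) (simp_all add: a_nonneg)

lemma good_summable:
  assumes "good z" "\<And>k. 0 \<le> w k" "\<And>k. w k \<le> a (k - i)"
  shows "(\<lambda>k. w k * exp (real m * c (z k))) summable_on UNIV"
proof (rule summable_on_comparison)
  show "(\<lambda>k. a (k - i) * exp (real m * c (z k))) summable_on UNIV"
    using assms(1) by (simp add: good_def)
qed (use assms in \<open>auto intro: mult_right_mono\<close>)

lemma good_c_summable:
  assumes "good z"
  shows "(\<lambda>k. a (k - i) * c (z k)) summable_on UNIV"
proof (rule summable_on_comparison)
  show "(\<lambda>k. a (k - i) * exp (real 1 * c (z k))) summable_on UNIV"
    using assms by (simp only: good_def)
  have "c l \<le> exp (c l)" for l using exp_ge_add_one_self[of "c l"] by linarith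
  then show "a (k - i) * c (z k) \<le> a (k - i) * exp (real 1 * c (z k))" for k
    by (simp add: a_nonneg mult_left_mono)
qed (simp add: a_nonneg c_nonneg)

lemma R_has_sum: "good z \<Longrightarrow> ((\<lambda>k. a (k - i) * c (z k)) has_sum R i z) UNIV"
  unfolding R_def by (intro has_sum_rsum_nonneg good_c_summable) (simp_all add: a_nonneg c_nonneg)

lemma R_nonneg: "good z \<Longrightarrow> 0 \<le> R i z"
  by (rule has_sum_nonneg[OF R_has_sum]) (simp_all add: a_nonneg c_nonneg)

lemma borel_measurable_R [measurable]: "R i \<in> borel_measurable (iid p)"
  unfolding R_def[abs_def] by measurable

text \<open>Jensen's inequality, from the tangent line of \<open>exp\<close> at \<open>m * R i z\<close>.\<close>

lemma exp_R_le:
  assumes "good z"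
  shows "exp (real m * R i z) \<le> V (\<lambda>k. a (k - i)) m z"
proof (rule has_sum_mono)
  let ?e = "exp (real m * R i z)"
  show "((\<lambda>k. a (k - i) * exp (real m * c (z k))) has_sum V (\<lambda>k. a (k - i)) m z) UNIV"
    unfolding V_def using good_summable[OF assms, of "\<lambda>k. a (k - i)" i m]
    by (intro has_sum_rsum_nonneg) (auto simp: a_nonneg)
  have "((\<lambda>k. ?e * ((1 - real m * R i z) * a (k - i) + real m * (a (k - i) * c (z k)))) has_sum
      ?e * ((1 - real m * R i z) * 1 + real m * R i z)) UNIV"
    by (intro has_sum_cmult_right has_sum_add a_shift_sum R_has_sum assms)
  then show "((\<lambda>k. ?e * ((1 - real m * R i z) * a (k - i) + real m * (a (k - i) * c (z k)))) has_sum ?e) UNIV"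
    by simp
  fix k
  have "?e * (1 + (real m * c (z k) - real m * R i z)) \<le> ?e * exp (real m * c (z k) - real m * R i z)"
    by (intro mult_left_mono exp_ge_add_one_self) simp
  also have "\<dots> = exp (real m * c (z k))" by (simp add: exp_diff)
  finally have "a (k - i) * (?e * (1 + (real m * c (z k) - real m * R i z))) \<le> a (k - i) * exp (real m * c (z k))"
    by (intro mult_left_mono a_nonneg)
  then show "?e * ((1 - real m * R i z) * a (k - i) + real m * (a (k - i) * c (z k)))
      \<le> a (k - i) * exp (real m * c (z k))"
    by (simp add: algebra_simps)
qed

lemma
  shows integrable_exp_R: "integrable (iid p) (\<lambda>z. exp (real m * R i z))"
    and integral_exp_R: "(\<integral>z. exp (real m * R i z) \<partial>iid p) \<le> M m"
proof -
  have rs: "rsum (\<lambda>k. a (k - i)) = 1"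
    by (rule rsum_eqI) (auto simp: a_nonneg a_summable a_shift_sum)
  have V: "integrable (iid p) (V (\<lambda>k. a (k - i)) m)" "(\<integral>z. V (\<lambda>k. a (k - i)) m z \<partial>iid p) = M m"
    using integrable_V[OF a_summable[of i], of m] integral_V[OF a_summable[of i], of m] by (auto simp: a_nonneg rs)
  have le: "AE z in iid p. exp (real m * R i z) \<le> V (\<lambda>k. a (k - i)) m z"
    using AE_good by eventually_elim (rule exp_R_le)
  show 1: "integrable (iid p) (\<lambda>z. exp (real m * R i z))"
    by (rule Bochner_Integration.integrable_bound[OF V(1)]) (use le in auto)
  show "(\<integral>z. exp (real m * R i z) \<partial>iid p) \<le> M m"
    using integral_mono_AE[OF 1 V(1) le] V(2) by simp
qed

end

text \<open>A substitute for Hoelder's inequality: a product of n exponentials is at most the sum of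
  their n-th powers, because a sum of n numbers is at most n times the largest of them. No
  independence among the functions is involved.\<close>

lemma
  fixes fs :: "('x \<Rightarrow> real) list"
  assumes "fs \<noteq> []"
    and f: "\<And>f. f \<in> set fs \<Longrightarrow> f \<in> borel_measurable N"
      "\<And>f. f \<in> set fs \<Longrightarrow> integrable N (\<lambda>x. exp (real (length fs) * f x))"
      "\<And>f. f \<in> set fs \<Longrightarrow> (\<integral>x. exp (real (length fs) * f x) \<partial>N) \<le> B"
  shows integrable_exp_sum_list: "integrable N (\<lambda>x. exp (\<Sum>f\<leftarrow>fs. f x))"
    and integral_exp_sum_list: "(\<integral>x. exp (\<Sum>f\<leftarrow>fs. f x) \<partial>N) \<le> real (length fs) * B"
proof -
  \<comment> \<open>The induction runs over sublists \<open>gs\<close>, while the exponent keeps the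
    full length of \<open>fs\<close>.\<close>
  have *: "integrable N (\<lambda>x. \<Sum>f\<leftarrow>gs. exp (real (length fs) * f x)) \<and>
      (\<integral>x. (\<Sum>f\<leftarrow>gs. exp (real (length fs) * f x)) \<partial>N) \<le> real (length gs) * B"
    if "set gs \<subseteq> set fs" for gs
    using that
  proof (induction gs)
    case (Cons g gs)
    then show ?case using f(2,3)[of g] by (simp add: algebra_simps)
  qed simp
  have le: "exp (\<Sum>f\<leftarrow>fs. f x) \<le> (\<Sum>f\<leftarrow>fs. exp (real (length fs) * f x))" for x
    using exp_sum_list_le[of "map (\<lambda>f. f x) fs"] assms(1) by (simp add: comp_def)
  have meas: "(\<lambda>x. \<Sum>f\<leftarrow>gs. f x) \<in> borel_measurable N" if "set gs \<subseteq> set fs" for gs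
    using that f(1) by (induction gs) auto
  have nn: "0 \<le> (\<Sum>f\<leftarrow>fs. exp (real (length fs) * f x))" for x
    by (rule order_trans[OF _ le]) simp
  show 1: "integrable N (\<lambda>x. exp (\<Sum>f\<leftarrow>fs. f x))"
  proof (rule Bochner_Integration.integrable_bound)
    show "integrable N (\<lambda>x. \<Sum>f\<leftarrow>fs. exp (real (length fs) * f x))" using *[OF order_refl] by blast
    show "(\<lambda>x. exp (\<Sum>f\<leftarrow>fs. f x)) \<in> borel_measurable N"
      using meas[OF order_refl] by simp
    show "AE x in N. norm (exp (\<Sum>f\<leftarrow>fs. f x)) \<le> norm (\<Sum>f\<leftarrow>fs. exp (real (length fs) * f x))"
      using le nn by simp
  qed
  have "(\<integral>x. exp (\<Sum>f\<leftarrow>fs. f x) \<partial>N) \<le> (\<integral>x. (\<Sum>f\<leftarrow>fs. exp (real (length fs) * f x)) \<partial>N)"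
    using *[OF order_refl] by (intro integral_mono 1 le) blast
  then show "(\<integral>x. exp (\<Sum>f\<leftarrow>fs. f x) \<partial>N) \<le> real (length fs) * B"
    using *[OF order_refl] by linarith
qed

section \<open>Influences of coordinates and localized functions\<close>

context summable_weights
begin

definition wt :: "int \<Rightarrow> int set \<Rightarrow> int \<Rightarrow> real" where
  "wt i J k = (if k \<in> J then a (k - i) else 0)"

definition tail :: "int \<Rightarrow> int set \<Rightarrow> real" where "tail i J = rsum (wt i J)"

text \<open>The majorant for the distance between two series, seen from time i, whose indices agree
  off J: each term in J is bounded by the sum of the two norms.\<close>

definition Z :: "int \<Rightarrow> int set \<Rightarrow> (int \<Rightarrow> nat) \<Rightarrow> (int \<Rightarrow> nat) \<Rightarrow> real" where
  "Z i J z z' = rsum (\<lambda>k. wt i J k * (c (z k) + c (z' k)))"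

lemma wt_bounds: "0 \<le> wt i J k" "wt i J k \<le> a (k - i)"
  by (simp_all add: wt_def a_nonneg)

lemma wt_summable: "wt i J summable_on UNIV"
  by (rule summable_on_comparison[OF a_summable[of i]]) (rule wt_bounds)+

lemma tail_has_sum: "(wt i J has_sum tail i J) UNIV"
  unfolding tail_def by (rule has_sum_rsum_nonneg[OF wt_summable wt_bounds(1)])

lemma tail_nonneg: "0 \<le> tail i J"
  by (rule has_sum_nonneg[OF tail_has_sum]) (rule wt_bounds)

lemma Z_singleton: "Z i {k} z z' = a (k - i) * (c (z k) + c (z' k))"
  unfolding Z_def
proof (rule rsum_eqI)
  show s: "((\<lambda>j. wt i {k} j * (c (z j) + c (z' j))) has_sum a (k - i) * (c (z k) + c (z' k))) UNIV"
    by (rule has_sum_finite_neutralI[of "{k}"]) (auto simp: wt_def)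
  then show "(\<lambda>j. norm (wt i {k} j * (c (z j) + c (z' j)))) summable_on UNIV"
    by (auto simp: wt_bounds c_nonneg summable_on_def)
qed

lemma Z_has_sum:
  assumes "good z" "good z'"
  shows "((\<lambda>k. wt i J k * (c (z k) + c (z' k))) has_sum Z i J z z') UNIV"
  unfolding Z_def
proof (rule has_sum_rsum_nonneg)
  have "(\<lambda>k. a (k - i) * c (z k) + a (k - i) * c (z' k)) summable_on UNIV"
    by (intro summable_on_add good_c_summable assms)
  then show "(\<lambda>k. wt i J k * (c (z k) + c (z' k))) summable_on UNIV"
    by (rule summable_on_comparison)
      (auto simp: wt_bounds c_nonneg distrib_left intro!: add_mono mult_right_mono)
qed (simp add: wt_bounds c_nonneg)

lemma Z_nonneg: "good z \<Longrightarrow> good z' \<Longrightarrow> 0 \<le> Z i J z z'"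
  by (rule has_sum_nonneg[OF Z_has_sum]) (simp_all add: wt_bounds c_nonneg)

lemma V_wt_has_sum:
  "good z \<Longrightarrow> ((\<lambda>k. wt i J k * exp (real m * c (z k))) has_sum V (wt i J) m z) UNIV"
  unfolding V_def
  by (intro has_sum_rsum_nonneg good_summable[where i = i]) (auto simp: wt_bounds)

lemma
  shows integrable_V_wt: "integrable (iid p) (V (wt i J) m)"
    and integral_V_wt: "(\<integral>z. V (wt i J) m z \<partial>iid p) = tail i J * M m"
  by (simp_all add: integrable_V integral_V wt_summable wt_bounds tail_def)

text \<open>A difference over many coordinates is multiplied by an exponential correlated with it.
  The inequality \<open>x * exp Q \<le> exp (2 * x) + exp (2 * Q)\<close>, applied under the sum
  with weights \<open>wt\<close>, decouples the two; every term on the right then carries the weight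
  of J, so its expectation is of order \<open>tail i J\<close>.\<close>

lemma Z_exp_le:
  assumes good: "good z" "good z'"
  shows "Z i J z z' * exp Q \<le> V (wt i J) 2 z + V (wt i J) 2 z' + 2 * tail i J * exp (2 * Q)"
proof (rule has_sum_mono)
  show "((\<lambda>k. wt i J k * (c (z k) + c (z' k)) * exp Q) has_sum Z i J z z' * exp Q) UNIV"
    by (intro has_sum_cmult_left Z_has_sum good)
  have "((\<lambda>k. wt i J k * exp (real 2 * c (z k)) + wt i J k * exp (real 2 * c (z' k)) + 2 * wt i J k * exp (2 * Q))
    has_sum V (wt i J) 2 z + V (wt i J) 2 z' + 2 * tail i J * exp (2 * Q)) UNIV"
    by (intro has_sum_add has_sum_cmult_left has_sum_cmult_right V_wt_has_sum tail_has_sum good)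
  then show "((\<lambda>k. wt i J k * (exp (2 * c (z k)) + exp (2 * c (z' k)) + 2 * exp (2 * Q)))
    has_sum V (wt i J) 2 z + V (wt i J) 2 z' + 2 * tail i J * exp (2 * Q)) UNIV"
    by (simp add: algebra_simps)
  have le: "x * exp Q \<le> exp (2 * x) + exp (2 * Q)" for x :: real
  proof -
    have "x \<le> exp x" using exp_ge_add_one_self[of x] by linarith
    then have "x * exp Q \<le> exp x * exp Q" by (intro mult_right_mono) auto
    also have "\<dots> \<le> (exp x)\<^sup>2 + (exp Q)\<^sup>2"
      using sum_squares_bound[of "exp x" "exp Q"] zero_le_power2[of "exp x"] zero_le_power2[of "exp Q"]
      by linarith
    finally show ?thesis by (simp add: power2_eq_square flip: exp_add)
  qed
  fix k
  have "(c (z k) + c (z' k)) * exp Q \<le> exp (2 * c (z k)) + exp (2 * c (z' k)) + 2 * exp (2 * Q)"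
    using le[of "c (z k)"] le[of "c (z' k)"] by (simp add: distrib_right)
  then show "wt i J k * (c (z k) + c (z' k)) * exp Q \<le>
      wt i J k * (exp (2 * c (z k)) + exp (2 * c (z' k)) + 2 * exp (2 * Q))"
    by (simp add: mult.assoc mult_left_mono wt_bounds)
qed

text \<open>\<open>F\<close> is localized at time \<open>i\<close>: the influence of the coordinate \<open>k\<close> is of order \<open>a (k - i)\<close>,
  up to factors all of whose moments are finite.\<close>

definition Loc :: "real \<Rightarrow> int \<Rightarrow> ((int \<Rightarrow> nat) \<Rightarrow> real) \<Rightarrow> bool" where
  "Loc C i F \<longleftrightarrow> 0 \<le> C \<and> F \<in> borel_measurable (iid p) \<and>
    (\<forall>z. good z \<longrightarrow> \<bar>F z\<bar> \<le> C * exp (R i z)) \<and>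
    (\<forall>z z' J. good z \<longrightarrow> good z' \<longrightarrow> (\<forall>k. k \<notin> J \<longrightarrow> z k = z' k) \<longrightarrow>
       \<bar>F z - F z'\<bar> \<le> C * (Z i J z z' * exp (R i z + R i z')))"

lemma LocD:
  assumes "Loc C i F"
  shows "0 \<le> C" "F \<in> borel_measurable (iid p)" "good z \<Longrightarrow> \<bar>F z\<bar> \<le> C * exp (R i z)"
    "good z \<Longrightarrow> good z' \<Longrightarrow> (\<And>k. k \<notin> J \<Longrightarrow> z k = z' k) \<Longrightarrow>
       \<bar>F z - F z'\<bar> \<le> C * (Z i J z z' * exp (R i z + R i z'))"
  using assms unfolding Loc_def by auto

lemma AE_good_mix: "AE z in iid p. good (mix A z)"
  by (rule AE_mix[OF AE_good])

lemma
  shows integrable_exp_R_mix: "integrable (iid p) (\<lambda>z. exp (real m * R i (mix A z)))"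
    and integral_exp_R_mix: "(\<integral>z. exp (real m * R i (mix A z)) \<partial>iid p) \<le> M m"
  using integrable_mix[OF integrable_exp_R, of m i A] integral_mix[of "\<lambda>z. exp (real m * R i z)" p A]
    integral_exp_R[of m i] by simp_all

lemma
  shows integrable_exp_c_mix: "integrable (iid p) (\<lambda>z. exp (real m * c (mix A z k)))"
    and integral_exp_c_mix: "(\<integral>z. exp (real m * c (mix A z k)) \<partial>iid p) \<le> M m"
  unfolding mix_def M_def
  using exp_c[of m] integral_iid_component[where g = "\<lambda>l. exp (real m * c l)" and i = "(k, k \<notin> A)" and p = p]
    integrable_iid_component[where g = "\<lambda>l. exp (real m * c l)" and i = "(k, k \<notin> A)" and p = p]
  by simp_all

lemma Loc_mult_integrable_mix:
  assumes F: "Loc C i F" and G: "Loc C' j G"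
  shows "integrable (iid p) (\<lambda>z. F (mix A z) * G (mix B z))"
proof (rule Bochner_Integration.integrable_bound)
  let ?fs = "[\<lambda>z. R i (mix A z), \<lambda>z. R j (mix B z)]"
  have "integrable (iid p) (\<lambda>z. exp (\<Sum>f\<leftarrow>?fs. f z))"
  proof (rule integrable_exp_sum_list[where B = "M 2"])
    fix f assume "f \<in> set ?fs"
    then consider "f = (\<lambda>z. R i (mix A z))" | "f = (\<lambda>z. R j (mix B z))" by auto
    then have "f \<in> borel_measurable (iid p) \<and> integrable (iid p) (\<lambda>z. exp (real 2 * f z)) \<and>
      (\<integral>z. exp (real 2 * f z) \<partial>iid p) \<le> M 2"
    proof cases
      case 1 show ?thesis unfolding 1 by (intro conjI integrable_exp_R_mix integral_exp_R_mix measurable_compose[OF measurable_mix borel_measurable_R])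
    next
      case 2 show ?thesis unfolding 2 by (intro conjI integrable_exp_R_mix integral_exp_R_mix measurable_compose[OF measurable_mix borel_measurable_R])
    qed
    then show "f \<in> borel_measurable (iid p)" "integrable (iid p) (\<lambda>z. exp (real (length ?fs) * f z))"
      "(\<integral>z. exp (real (length ?fs) * f z) \<partial>iid p) \<le> M 2" by simp_all
  qed simp
  then show "integrable (iid p) (\<lambda>z. (C * C') * exp (R i (mix A z) + R j (mix B z)))"
    by simp
  have [measurable]: "F \<in> borel_measurable (iid p)" "G \<in> borel_measurable (iid p)"
    using LocD(2)[OF F] LocD(2)[OF G] .
  show "(\<lambda>z. F (mix A z) * G (mix B z)) \<in> borel_measurable (iid p)" by measurable
  show "AE z in iid p. norm (F (mix A z) * G (mix B z)) \<le> norm (C * C' * exp (R i (mix A z) + R j (mix B z)))"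
    using AE_good_mix[of A] AE_good_mix[of B]
  proof eventually_elim
    case (elim z)
    have "\<bar>F (mix A z)\<bar> * \<bar>G (mix B z)\<bar> \<le> (C * exp (R i (mix A z))) * (C' * exp (R j (mix B z)))"
      using elim F G by (intro mult_mono LocD(3)) (auto simp: LocD(1))
    then show ?case using LocD(1)[OF F] LocD(1)[OF G] by (simp add: abs_mult exp_add mult_ac)
  qed
qed

end

lemma has_sum_int_symmetric_LIMSEQ:
  fixes f :: "int \<Rightarrow> real"
  assumes "(f has_sum s) UNIV"
  shows "(\<lambda>N. sum f {- int N..int N}) \<longlonglongrightarrow> s"
proof -
  have "filterlim (\<lambda>N. {- int N..int N}) (finite_subsets_at_top UNIV) sequentially"
    unfolding filterlim_finite_subsets_at_top
  proof (intro allI impI)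
    fix X :: "int set" assume "finite X \<and> X \<subseteq> UNIV"
    then have fin: "finite (abs ` X)" by simp
    have "X \<subseteq> {- int N..int N}" if "N \<ge> nat (Max (insert 0 (abs ` X)))" for N
    proof
      fix x assume "x \<in> X"
      then have "\<bar>x\<bar> \<le> Max (insert 0 (abs ` X))" using fin by (intro Max_ge) auto
      then show "x \<in> {- int N..int N}" using that by auto
    qed
    then show "\<forall>\<^sub>F N in sequentially. finite {- int N..int N} \<and> X \<subseteq> {- int N..int N} \<and> {- int N..int N} \<subseteq> UNIV"
      by (auto simp: eventually_at_top_linorder)
  qed
  with assms show ?thesis
    unfolding has_sum_def by (rule filterlim_compose)
qed

lemma integrable_mix_iff:
  fixes F :: "(int \<Rightarrow> nat) \<Rightarrow> real"
  assumes "F \<in> borel_measurable (iid p)"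
  shows "integrable (iid p) (\<lambda>z. F (mix K z)) \<longleftrightarrow> integrable (iid p) F"
  using integrable_distr_eq[OF measurable_mix assms, of K] distr_iid_reindex[OF inj_mix, of p K]
  by (simp add: mix_def[abs_def])

text \<open>A function that is not integrable has integral 0 by convention, and g is nonnegative
  almost everywhere; so integrability has to be established only for the majorant.\<close>

lemma abs_integral_le:
  fixes f g :: "'x \<Rightarrow> real"
  assumes "AE x in N. \<bar>f x\<bar> \<le> g x" "integrable N g"
  shows "\<bar>\<integral>x. f x \<partial>N\<bar> \<le> (\<integral>x. g x \<partial>N)"
proof (cases "integrable N f")
  case True
  have "\<bar>\<integral>x. f x \<partial>N\<bar> \<le> (\<integral>x. \<bar>f x\<bar> \<partial>N)" by (rule integral_abs_bound)
  also have "\<dots> \<le> (\<integral>x. g x \<partial>N)" using assms True by (intro integral_mono_AE) auto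
  finally show ?thesis .
next
  case False
  have "0 \<le> (\<integral>x. g x \<partial>N)"
    by (rule integral_nonneg_AE) (use assms(1) in eventually_elim, auto intro: order_trans[OF abs_ge_zero])
  with False show ?thesis by (simp add: not_integrable_integral_eq)
qed

section \<open>Covariances of localized functions\<close>

context summable_weights
begin

lemma
  assumes n: "length fs = n" "0 < n"
    and fs: "\<And>f. f \<in> set fs \<Longrightarrow> (\<exists>A k. f = (\<lambda>z. c (mix A z k))) \<or> (\<exists>A i. f = (\<lambda>z. R i (mix A z)))"
  shows integrable_exp_list_mix: "integrable (iid p) (\<lambda>z. exp (\<Sum>f\<leftarrow>fs. f z))"
    and integral_exp_list_mix: "(\<integral>z. exp (\<Sum>f\<leftarrow>fs. f z) \<partial>iid p) \<le> real n * M n"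
proof -
  have "fs \<noteq> []" using n by auto
  have *: "f \<in> borel_measurable (iid p) \<and> integrable (iid p) (\<lambda>z. exp (real (length fs) * f z)) \<and>
    (\<integral>z. exp (real (length fs) * f z) \<partial>iid p) \<le> M (length fs)" if "f \<in> set fs" for f
    using fs[OF that]
  proof (elim disjE exE)
    fix A k assume f: "f = (\<lambda>z. c (mix A z k))"
    show ?thesis unfolding f
      by (intro conjI integrable_exp_c_mix integral_exp_c_mix) (simp add: mix_def)
  next
    fix A i assume f: "f = (\<lambda>z. R i (mix A z))"
    show ?thesis unfolding f
      by (intro conjI integrable_exp_R_mix integral_exp_R_mix measurable_compose[OF measurable_mix borel_measurable_R])
  qed
  show "integrable (iid p) (\<lambda>z. exp (\<Sum>f\<leftarrow>fs. f z))"
    by (rule integrable_exp_sum_list[OF \<open>fs \<noteq> []\<close>, where B = "M (length fs)"]) (use * in blast)+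
  show "(\<integral>z. exp (\<Sum>f\<leftarrow>fs. f z) \<partial>iid p) \<le> real n * M n"
    unfolding n(1)[symmetric] by (rule integral_exp_sum_list[OF \<open>fs \<noteq> []\<close>]) (use * in blast)+
qed

lemma Loc_integrable: "Loc C i F \<Longrightarrow> integrable (iid p) F"
proof -
  assume F: "Loc C i F"
  have "integrable (iid p) (\<lambda>z. C * exp (real 1 * R i z))"
    by (intro integrable_mult_right integrable_exp_R)
  then show ?thesis
  proof (rule Bochner_Integration.integrable_bound)
    show "AE z in iid p. norm (F z) \<le> norm (C * exp (real 1 * R i z))"
      using AE_good by eventually_elim (use LocD(1,3)[OF F] in simp)
  qed (rule LocD(2)[OF F])
qed

lemma Loc_mult_integrable:
  assumes F: "Loc C i F" and G: "Loc C' j G"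
  shows "integrable (iid p) (\<lambda>z. F z * G z)"
  using Loc_mult_integrable_mix[OF F G, of "{}" "{}"] LocD(2)[OF F] LocD(2)[OF G]
  by (subst (asm) integrable_mix_iff[of "\<lambda>z. F z * G z"]) auto

text \<open>Both increments change only coordinate k, so \<open>Z\<close> reduces to a single term
  and the weights \<open>a (k - i)\<close> and \<open>a (k - j)\<close> come out. What remains is a
  product of eight exponentials, four of values of \<open>c\<close> at k and four of values of
  \<open>R\<close>; this is the source of \<open>8 * M 8\<close>.\<close>

lemma Loc_increment_integral:
  assumes F: "Loc C i F" and G: "Loc C' j G"
  shows "\<bar>\<integral>z. (F (mix {} z) - F (mix {k} z)) * (G (mix L z) - G (mix (insert k L) z)) \<partial>iid p\<bar>
    \<le> C * C' * (8 * M 8) * (a (k - i) * a (k - j))"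
proof -
  let ?fs = "[\<lambda>z. c (mix {} z k), \<lambda>z. c (mix {k} z k), \<lambda>z. c (mix L z k), \<lambda>z. c (mix (insert k L) z k),
    \<lambda>z. R i (mix {} z), \<lambda>z. R i (mix {k} z), \<lambda>z. R j (mix L z), \<lambda>z. R j (mix (insert k L) z)]"
  let ?E = "\<lambda>z. exp (\<Sum>f\<leftarrow>?fs. f z)"
  let ?D = "\<lambda>z. (F (mix {} z) - F (mix {k} z)) * (G (mix L z) - G (mix (insert k L) z))"
  let ?B = "C * C' * (a (k - i) * a (k - j))"
  have fs: "(\<exists>A k. f = (\<lambda>z. c (mix A z k))) \<or> (\<exists>A i. f = (\<lambda>z. R i (mix A z)))" if "f \<in> set ?fs" for f
    using that by auto
  have len: "length ?fs = 8" by simp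
  have E: "integrable (iid p) ?E" "(\<integral>z. ?E z \<partial>iid p) \<le> real 8 * M 8"
    using integrable_exp_list_mix[OF len _ fs] integral_exp_list_mix[OF len _ fs]
      by (simp_all only: zero_less_numeral simp_thms)
  have B: "0 \<le> ?B" using LocD(1)[OF F] LocD(1)[OF G] a_nonneg by simp
  have le: "x \<le> exp x" for x :: real
    using exp_ge_add_one_self[of x] by linarith
  have "AE z in iid p. \<bar>?D z\<bar> \<le> ?B * ?E z"
    using AE_good_mix[of "{}"] AE_good_mix[of "{k}"] AE_good_mix[of L] AE_good_mix[of "insert k L"]
  proof eventually_elim
    case (elim z)
    have "\<bar>F (mix {} z) - F (mix {k} z)\<bar> \<le>
        C * (Z i {k} (mix {} z) (mix {k} z) * exp (R i (mix {} z) + R i (mix {k} z)))"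
      using elim by (intro LocD(4)[OF F]) (auto simp: mix_def)
    also have "\<dots> \<le> C * ((a (k - i) * exp (c (mix {} z k) + c (mix {k} z k))) * exp (R i (mix {} z) + R i (mix {k} z)))"
      unfolding Z_singleton by (intro mult_left_mono mult_right_mono le LocD(1)[OF F] a_nonneg) simp
    finally have 1: "\<bar>F (mix {} z) - F (mix {k} z)\<bar> \<le>
      C * ((a (k - i) * exp (c (mix {} z k) + c (mix {k} z k))) * exp (R i (mix {} z) + R i (mix {k} z)))" .
    have "\<bar>G (mix L z) - G (mix (insert k L) z)\<bar> \<le>
        C' * (Z j {k} (mix L z) (mix (insert k L) z) * exp (R j (mix L z) + R j (mix (insert k L) z)))"
      using elim by (intro LocD(4)[OF G]) (auto simp: mix_def)
    also have "\<dots> \<le> C' * ((a (k - j) * exp (c (mix L z k) + c (mix (insert k L) z k))) *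
        exp (R j (mix L z) + R j (mix (insert k L) z)))"
      unfolding Z_singleton by (intro mult_left_mono mult_right_mono le LocD(1)[OF G] a_nonneg) simp
    finally have 2: "\<bar>G (mix L z) - G (mix (insert k L) z)\<bar> \<le>
      C' * ((a (k - j) * exp (c (mix L z k) + c (mix (insert k L) z k))) *
        exp (R j (mix L z) + R j (mix (insert k L) z)))" .
    have "\<bar>?D z\<bar> \<le> (C * ((a (k - i) * exp (c (mix {} z k) + c (mix {k} z k))) * exp (R i (mix {} z) + R i (mix {k} z)))) *
      (C' * ((a (k - j) * exp (c (mix L z k) + c (mix (insert k L) z k))) *
        exp (R j (mix L z) + R j (mix (insert k L) z))))"
      unfolding abs_mult by (intro mult_mono 1 2) (use LocD(1)[OF F] a_nonneg in auto)
    also have "\<dots> = ?B * ?E z"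
      by (simp add: exp_add mult_ac)
    finally show ?case .
  qed
  moreover have int: "integrable (iid p) (\<lambda>z. ?B * ?E z)"
    by (intro integrable_mult_right E)
  ultimately have "\<bar>\<integral>z. ?D z \<partial>iid p\<bar> \<le> (\<integral>z. ?B * ?E z \<partial>iid p)"
    by (intro abs_integral_le)
  also have "\<dots> = ?B * (\<integral>z. ?E z \<partial>iid p)" by simp
  also have "\<dots> \<le> ?B * (8 * M 8)" using E(2) by (intro mult_left_mono B) simp
  finally show ?thesis by (simp add: mult_ac)
qed

lemma tail_compl_LIMSEQ: "(\<lambda>N. tail j (- {- int N..int N})) \<longlonglongrightarrow> 0"
proof -
  have "tail j (- {- int N..int N}) = 1 - (\<Sum>k\<in>{- int N..int N}. a (k - j))" for N
  proof (rule has_sum_unique[OF tail_has_sum])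
    have "((\<lambda>k. if k \<in> {- int N..int N} then a (k - j) else 0) has_sum (\<Sum>k\<in>{- int N..int N}. a (k - j))) UNIV"
      by (rule has_sum_finite_neutralI[of "{- int N..int N}"]) auto
    then have "((\<lambda>k. a (k - j) + - (if k \<in> {- int N..int N} then a (k - j) else 0)) has_sum
        1 + - (\<Sum>k\<in>{- int N..int N}. a (k - j))) UNIV"
      by (intro has_sum_add a_shift_sum has_sum_uminusI)
    moreover have "(\<lambda>k. a (k - j) + - (if k \<in> {- int N..int N} then a (k - j) else 0)) = wt j (- {- int N..int N})"
      by (auto simp: wt_def fun_eq_iff)
    ultimately show "(wt j (- {- int N..int N}) has_sum 1 - (\<Sum>k\<in>{- int N..int N}. a (k - j))) UNIV"
      by simp
  qed
  moreover have "(\<lambda>N. 1 - (\<Sum>k\<in>{- int N..int N}. a (k - j))) \<longlonglongrightarrow> 1 - 1"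
    by (intro tendsto_intros has_sum_int_symmetric_LIMSEQ a_shift_sum)
  ultimately show ?thesis by simp
qed

text \<open>Supplies the limit that \<open>iid_covariance_bound\<close> asks for: resampling a
  window instead of everything changes G only through coordinates off the window, whose total weight
  tends to 0.\<close>

lemma Loc_mix_LIMSEQ:
  assumes F: "Loc C i F" and G: "Loc C' j G"
  shows "(\<lambda>N. \<integral>z. F (mix {} z) * G (mix {- int N..int N} z) \<partial>iid p) \<longlonglongrightarrow>
        (\<integral>z. F (mix {} z) * G (mix UNIV z) \<partial>iid p)"
proof -
  have C: "0 \<le> C * C'" using LocD(1)[OF F] LocD(1)[OF G] by simp
  have bound: "\<bar>(\<integral>z. F (mix {} z) * G (mix L z) \<partial>iid p) - (\<integral>z. F (mix {} z) * G (mix UNIV z) \<partial>iid p)\<bar>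
    \<le> C * C' * (tail j (- L) * (2 * M 2 + 12 * M 6))" (is "?l \<le> _") for L
  proof -
    \<comment> \<open>Every \<open>R\<close> is listed twice because \<open>Z_exp_le\<close> doubles
      the exponent Q.\<close>
    let ?fs = "[\<lambda>z. R i (mix {} z), \<lambda>z. R i (mix {} z), \<lambda>z. R j (mix L z), \<lambda>z. R j (mix L z),
      \<lambda>z. R j (mix UNIV z), \<lambda>z. R j (mix UNIV z)]"
    let ?E = "\<lambda>z. exp (\<Sum>f\<leftarrow>?fs. f z)"
    let ?D = "\<lambda>z. F (mix {} z) * (G (mix L z) - G (mix UNIV z))"
    let ?V = "\<lambda>A z. V (wt j (- L)) 2 (mix A z)"
    let ?B = "\<lambda>z. C * C' * (?V L z + ?V UNIV z + 2 * tail j (- L) * ?E z)"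
    have fs: "(\<exists>A k. f = (\<lambda>z. c (mix A z k))) \<or> (\<exists>A i. f = (\<lambda>z. R i (mix A z)))" if "f \<in> set ?fs" for f
      using that by auto
    have len: "length ?fs = 6" by simp
    have E: "integrable (iid p) ?E" "(\<integral>z. ?E z \<partial>iid p) \<le> real 6 * M 6"
      using integrable_exp_list_mix[OF len _ fs] integral_exp_list_mix[OF len _ fs]
      by (simp_all only: zero_less_numeral simp_thms)
    have V: "integrable (iid p) (?V A)" "(\<integral>z. ?V A z \<partial>iid p) = tail j (- L) * M 2" for A
      using integrable_mix[OF integrable_V_wt] integral_mix[OF borel_measurable_integrable[OF integrable_V_wt]]
      by (simp_all add: integral_V_wt)
    have "AE z in iid p. \<bar>?D z\<bar> \<le> ?B z"
      using AE_good_mix[of "{}"] AE_good_mix[of L] AE_good_mix[of UNIV]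
    proof eventually_elim
      case (elim z)
      have 1: "\<bar>G (mix L z) - G (mix UNIV z)\<bar> \<le> C' * (Z j (- L) (mix L z) (mix UNIV z) * exp (R j (mix L z) + R j (mix UNIV z)))"
        using elim by (intro LocD(4)[OF G]) (auto simp: mix_def)
      have "\<bar>?D z\<bar> \<le> (C * exp (R i (mix {} z))) * (C' * (Z j (- L) (mix L z) (mix UNIV z) * exp (R j (mix L z) + R j (mix UNIV z))))"
        unfolding abs_mult by (intro mult_mono 1 LocD(3)[OF F] elim) (use LocD(1)[OF F] in auto)
      also have "\<dots> = C * C' * (Z j (- L) (mix L z) (mix UNIV z) * exp (R i (mix {} z) + R j (mix L z) + R j (mix UNIV z)))"
        by (simp add: exp_add mult_ac)
      also have "\<dots> \<le> C * C' * (?V L z + ?V UNIV z + 2 * tail j (- L) * exp (2 * (R i (mix {} z) + R j (mix L z) + R j (mix UNIV z))))"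
        by (intro mult_left_mono Z_exp_le elim C)
      also have "\<dots> = ?B z" by (simp add: algebra_simps)
      finally show ?case .
    qed
    moreover have int: "integrable (iid p) ?B"
      by (intro integrable_mult_right Bochner_Integration.integrable_add E V)
    ultimately have "\<bar>\<integral>z. ?D z \<partial>iid p\<bar> \<le> (\<integral>z. ?B z \<partial>iid p)"
      by (intro abs_integral_le)
    also have "(\<integral>z. ?B z \<partial>iid p) = C * C' * (tail j (- L) * M 2 + tail j (- L) * M 2 + 2 * tail j (- L) * (\<integral>z. ?E z \<partial>iid p))"
      using E(1) V by (simp only: integral_mult_right_zero Bochner_Integration.integral_add Bochner_Integration.integrable_add integrable_mult_right simp_thms)
    also have "\<dots> \<le> C * C' * (tail j (- L) * M 2 + tail j (- L) * M 2 + 2 * tail j (- L) * (6 * M 6))"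
      using E(2) by (intro mult_left_mono add_left_mono C mult_nonneg_nonneg tail_nonneg) simp_all
    also have "(\<integral>z. ?D z \<partial>iid p) = (\<integral>z. F (mix {} z) * G (mix L z) \<partial>iid p) - (\<integral>z. F (mix {} z) * G (mix UNIV z) \<partial>iid p)"
      by (simp add: right_diff_distrib Loc_mult_integrable_mix[OF F G])
    finally show ?thesis by (simp add: algebra_simps)
  qed
  have "(\<lambda>N. (\<integral>z. F (mix {} z) * G (mix {- int N..int N} z) \<partial>iid p) - (\<integral>z. F (mix {} z) * G (mix UNIV z) \<partial>iid p)) \<longlonglongrightarrow> 0"
  proof (rule Lim_null_comparison)
    show "(\<lambda>N. C * C' * (tail j (- {- int N..int N}) * (2 * M 2 + 12 * M 6))) \<longlonglongrightarrow> 0"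
      using tail_compl_LIMSEQ[of j] by (auto intro!: tendsto_eq_intros)
  qed (use bound in simp)
  then show ?thesis by (rule LIM_zero_cancel)
qed

text \<open>The moments of the eight exponential factors times the constant \<open>2 * K\<close> of
  the convolution estimate.\<close>

definition Kc :: real where "Kc = 8 * M 8 * (2 * K)"

lemma Kc_pos: "0 < Kc"
  using K_pos M_ge_1[of 8] by (simp add: Kc_def)

text \<open>The influences multiply to \<open>a (k - i) * a (k - j)\<close>, and their sum over k is
  a convolution of the weights at \<open>i - j\<close>.\<close>

theorem Loc_covariance:
  assumes F: "Loc C i F" and G: "Loc C' j G"
  shows "\<bar>(\<integral>z. F z * G z \<partial>iid p) - (\<integral>z. F z \<partial>iid p) * (\<integral>z. G z \<partial>iid p)\<bar> \<le> C * C' * Kc * a (i - j)"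
proof -
  let ?e = "\<lambda>k. C * C' * (8 * M 8) * (a (k - i) * a (k - j))"
  let ?g = "\<lambda>k. C * C' * (8 * M 8) * (K * a (i - j) * (a (k - j) + a (k - i)))"
  have C: "0 \<le> C * C' * (8 * M 8)" using LocD(1)[OF F] LocD(1)[OF G] M_ge_1[of 8] by simp
  have g: "(?g has_sum C * C' * (8 * M 8) * (K * a (i - j) * (1 + 1))) UNIV"
    by (intro has_sum_cmult_right has_sum_add a_shift_sum)
  have le: "?e k \<le> ?g k" for k
  proof -
    \<comment> \<open>The convolution hypothesis at \<open>k - j\<close> with shift
      \<open>i - j\<close>, since \<open>(k - j) - (i - j) = k - i\<close>.\<close>
    have "a (k - j) * a (k - j - (i - j)) \<le> K * a (i - j) * (a (k - j) + a (k - j - (i - j)))" by (rule a_conv)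
    then show ?thesis by (intro mult_left_mono C) (simp add: mult.commute)
  qed
  have e: "?e summable_on UNIV"
  proof (rule summable_on_comparison[OF has_sum_imp_summable[OF g] _ le])
    show "0 \<le> ?e k" for k by (intro mult_nonneg_nonneg[OF C] mult_nonneg_nonneg a_nonneg)
  qed
  have "\<bar>(\<integral>z. F z * G z \<partial>iid p) - (\<integral>z. F z \<partial>iid p) * (\<integral>z. G z \<partial>iid p)\<bar> \<le> infsum ?e UNIV"
    by (rule iid_covariance_bound[OF Loc_integrable[OF F] Loc_integrable[OF G] Loc_mult_integrable_mix[OF F G]
        Loc_increment_integral[OF F G] e Loc_mix_LIMSEQ[OF F G]])
  also have "\<dots> \<le> C * C' * (8 * M 8) * (K * a (i - j) * (1 + 1))"
    by (rule has_sum_mono[OF has_sum_infsum[OF e] g le])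
  finally show ?thesis by (simp add: Kc_def mult_ac)
qed

end

section \<open>A central limit theorem by blocks\<close>

lemma iexp_lipschitz: "cmod (iexp x - iexp y) \<le> \<bar>x - y\<bar>"
proof -
  have "iexp x - iexp y = iexp y * (iexp (x - y) - 1)"
    by (simp add: algebra_simps flip: exp_add)
  then have "cmod (iexp x - iexp y) = cmod (iexp (x - y) - 1)"
    by (simp add: norm_mult)
  also have "\<dots> \<le> \<bar>x - y\<bar>"
    using iexp_approx1[of "x - y" 0] by simp
  finally show ?thesis .
qed

lemma char_distr:
  assumes "X \<in> borel_measurable M"
  shows "char (distr M borel X) t = (CLINT x|M. iexp (t * X x))"
  unfolding char_def by (subst integral_distr) (use assms in measurable)

lemma (in prob_space) expectation_abs_le:
  fixes X :: "'a \<Rightarrow> real"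
  assumes [measurable]: "random_variable borel X" and sq: "integrable M (\<lambda>x. (X x)\<^sup>2)"
  shows "expectation (\<lambda>x. \<bar>X x\<bar>) \<le> sqrt (expectation (\<lambda>x. (X x)\<^sup>2))"
proof -
  have "integrable M X" by (rule square_integrable_imp_integrable) (use sq in auto)
  then have "variance (\<lambda>x. \<bar>X x\<bar>) = expectation (\<lambda>x. (X x)\<^sup>2) - (expectation (\<lambda>x. \<bar>X x\<bar>))\<^sup>2"
    using sq by (subst variance_eq) auto
  then show ?thesis
    using variance_positive[of "\<lambda>x. \<bar>X x\<bar>"] by (intro real_le_rsqrt) simp
qed

text \<open>Closeness in L^2 implies closeness of characteristic functions: the function
  \<open>iexp\<close> is 1-Lipschitz and the L^1 norm is at most the L^2 norm.\<close>

lemma (in prob_space) char_diff_le: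
  fixes X Y :: "'a \<Rightarrow> real"
  assumes [measurable]: "random_variable borel X" "random_variable borel Y"
    and sq: "integrable M (\<lambda>x. (X x - Y x)\<^sup>2)" and B: "expectation (\<lambda>x. (X x - Y x)\<^sup>2) \<le> B"
  shows "cmod (char (distr M borel X) t - char (distr M borel Y) t) \<le> \<bar>t\<bar> * sqrt B"
proof -
  have int: "integrable M (\<lambda>x. iexp (t * Z x))" if [measurable]: "random_variable borel Z" for Z :: "'a \<Rightarrow> real"
    using integrable_iexp[of "\<lambda>x. complex_of_real (t * Z x)"] by simp
  have "integrable M (\<lambda>x. X x - Y x)"
    by (rule square_integrable_imp_integrable) (use sq in auto)
  then have abs: "integrable M (\<lambda>x. \<bar>t\<bar> * \<bar>X x - Y x\<bar>)" by auto
  have "char (distr M borel X) t - char (distr M borel Y) t = (CLINT x|M. iexp (t * X x) - iexp (t * Y x))"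
    by (simp add: char_def integral_distr int Bochner_Integration.integral_diff[OF int int] del: of_real_mult)
  also have "cmod \<dots> \<le> (\<integral>x. cmod (iexp (t * X x) - iexp (t * Y x)) \<partial>M)"
    by (rule integral_norm_bound)
  also have "\<dots> \<le> (\<integral>x. \<bar>t\<bar> * \<bar>X x - Y x\<bar> \<partial>M)"
  proof (rule integral_mono[OF _ abs])
    show "integrable M (\<lambda>x. cmod (iexp (t * X x) - iexp (t * Y x)))"
      by (intro integrable_norm Bochner_Integration.integrable_diff int) auto
    show "cmod (iexp (t * X x) - iexp (t * Y x)) \<le> \<bar>t\<bar> * \<bar>X x - Y x\<bar>" for x
      using iexp_lipschitz[of "t * X x" "t * Y x"] by (simp only: abs_mult flip: right_diff_distrib)
  qed
  also have "\<dots> = \<bar>t\<bar> * expectation (\<lambda>x. \<bar>X x - Y x\<bar>)" by simp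
  also have "\<dots> \<le> \<bar>t\<bar> * sqrt B"
    using expectation_abs_le[OF _ sq] B
    by (intro mult_left_mono) (auto intro: order_trans)
  finally show ?thesis .
qed

text \<open>The formula for the density degenerates at zero variance, where the law is the point
  mass at 0. Both cases are the image of the standard normal law under scaling, which gives one
  formula for the characteristic function.\<close>

definition centered_normal :: "real \<Rightarrow> real measure" where
  "centered_normal \<sigma> = (if \<sigma> = 0 then return borel 0 else density lborel (normal_density 0 \<sigma>))"

lemma centered_normal_eq_distr:
  assumes "0 \<le> \<sigma>"
  shows "centered_normal \<sigma> = distr std_normal_distribution borel (\<lambda>x. \<sigma> * x)"
proof (cases "\<sigma> = 0")
  case True
  interpret prob_space std_normal_distribution by (rule prob_space_normal_density) simp
  have "distr std_normal_distribution borel (\<lambda>x. 0::real) = return borel 0"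
    by (rule distr_const) simp
  then show ?thesis by (simp add: centered_normal_def True)
next
  case False
  interpret prob_space std_normal_distribution by (rule prob_space_normal_density) simp
  have "distr std_normal_distribution lborel (\<lambda>x. x) = distr std_normal_distribution std_normal_distribution (\<lambda>x. x)"
    by (rule distr_cong) auto
  then have "distributed std_normal_distribution lborel (\<lambda>x. x) std_normal_density"
    unfolding distributed_def by (auto simp: distr_id)
  from normal_density_affine[OF this, of \<sigma> 0] have
    "distributed std_normal_distribution lborel (\<lambda>x. \<sigma> * x) (normal_density 0 \<sigma>)"
    using assms False by simp
  then have "distr std_normal_distribution lborel (\<lambda>x. \<sigma> * x) = density lborel (normal_density 0 \<sigma>)"
    by (simp add: distributed_def)
  moreover have "distr std_normal_distribution lborel (\<lambda>x. \<sigma> * x) = distr std_normal_distribution borel (\<lambda>x. \<sigma> * x)"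
    by (rule distr_cong) auto
  ultimately show ?thesis by (simp add: centered_normal_def False)
qed

lemma
  assumes "0 \<le> \<sigma>"
  shows real_distribution_centered_normal: "real_distribution (centered_normal \<sigma>)"
    and char_centered_normal: "char (centered_normal \<sigma>) t = complex_of_real (exp (- (\<sigma>\<^sup>2 * t\<^sup>2 / 2)))"
proof -
  interpret real_distribution std_normal_distribution by (rule real_dist_normal_dist)
  show "real_distribution (centered_normal \<sigma>)"
    unfolding centered_normal_eq_distr[OF assms] by (rule real_distribution_distr) measurable
  have "char (centered_normal \<sigma>) t = char std_normal_distribution (t * \<sigma>)"
    unfolding centered_normal_eq_distr[OF assms] char_def
    by (subst integral_distr) (simp_all add: mult.assoc)
  then show "char (centered_normal \<sigma>) t = complex_of_real (exp (- (\<sigma>\<^sup>2 * t\<^sup>2 / 2)))"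
    by (simp add: char_std_normal_distribution power_mult_distrib mult.commute)
qed

text \<open>The classical theorem with a normalization independent of the variance: s will be the
  block length, so that q blocks are divided by the square root of the elapsed time. Zero variance
  is treated apart, since the classical statement asks for a positive one.\<close>

lemma (in prob_space) char_iid_sum_LIMSEQ:
  fixes Y :: "nat \<Rightarrow> 'a \<Rightarrow> real"
  assumes indep: "indep_vars (\<lambda>_. borel) Y UNIV"
    and distr: "\<And>j. distr M borel (Y j) = distr M borel (Y 0)"
    and sq: "\<And>j. integrable M (\<lambda>x. (Y j x)\<^sup>2)" and mean: "\<And>j. expectation (Y j) = 0"
    and s: "0 < s"
  shows "(\<lambda>q. char (distr M borel (\<lambda>x. (\<Sum>j<q. Y j x) / sqrt (real q * s))) t)
    \<longlonglongrightarrow> complex_of_real (exp (- (expectation (\<lambda>x. (Y 0 x)\<^sup>2) / s * t\<^sup>2 / 2)))"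
proof -
  let ?v = "expectation (\<lambda>x. (Y 0 x)\<^sup>2)"
  have [measurable]: "random_variable borel (Y j)" for j
    using indep unfolding indep_vars_def2 by simp
  have Ysq: "expectation (\<lambda>x. (Y j x)\<^sup>2) = ?v" for j
  proof -
    have "expectation (\<lambda>x. (Y j x)\<^sup>2) = (\<integral>y. y\<^sup>2 \<partial>distr M borel (Y j))"
      by (subst integral_distr) simp_all
    also have "\<dots> = (\<integral>y. y\<^sup>2 \<partial>distr M borel (Y 0))" by (simp only: distr[of j])
    also have "\<dots> = ?v" by (subst integral_distr) simp_all
    finally show ?thesis .
  qed
  show ?thesis
  proof (cases "?v = 0")
    case True
    have "AE x in M. (Y j x)\<^sup>2 = 0" for j
      using integral_nonneg_eq_0_iff_AE[OF sq, of j] Ysq[of j] True by auto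
    then have ae: "AE x in M. \<forall>j. Y j x = 0"
      by (simp add: AE_all_countable)
    have "char (distr M borel (\<lambda>x. (\<Sum>j<q. Y j x) / sqrt (real q * s))) t = 1" for q
    proof -
      have "distr M borel (\<lambda>x. (\<Sum>j<q. Y j x) / sqrt (real q * s)) = distr M borel (\<lambda>x. 0)"
        by (rule distr_cong_AE) (use ae in \<open>auto elim!: eventually_mono\<close>)
      then show ?thesis by (simp add: char_def integral_return)
    qed
    then show ?thesis using True by simp
  next
    case False
    moreover have "0 \<le> ?v" by simp
    ultimately have v: "0 < ?v" by linarith
    define \<sigma> where "\<sigma> = sqrt ?v"
    have \<sigma>: "0 < \<sigma>" "\<sigma>\<^sup>2 = ?v" using v by (auto simp: \<sigma>_def)
    have var: "variance (Y j) = \<sigma>\<^sup>2" for j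
      by (simp only: mean diff_zero Ysq[of j] \<sigma>(2))
    have weak: "weak_conv_m (\<lambda>n. distr M borel (\<lambda>x. (\<Sum>i<n. Y i x) / sqrt (real n * \<sigma>\<^sup>2))) std_normal_distribution"
      by (rule central_limit_theorem_zero_mean[OF indep mean \<sigma>(1) sq var distr])
    \<comment> \<open>Evaluating at \<open>t * \<sigma> / sqrt s\<close> converts the standard
      normalization into the one by s.\<close>
    have "(\<lambda>q. char (distr M borel (\<lambda>x. (\<Sum>i<q. Y i x) / sqrt (real q * \<sigma>\<^sup>2))) (t * \<sigma> / sqrt s))
        \<longlonglongrightarrow> char std_normal_distribution (t * \<sigma> / sqrt s)"
      by (rule levy_continuity1[OF _ real_dist_normal_dist weak]) simp
    moreover have "char (distr M borel (\<lambda>x. (\<Sum>i<q. Y i x) / sqrt (real q * \<sigma>\<^sup>2))) (t * \<sigma> / sqrt s) =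
        char (distr M borel (\<lambda>x. (\<Sum>j<q. Y j x) / sqrt (real q * s))) t" for q
    proof -
      have "t * \<sigma> / sqrt s * (w / sqrt (real q * \<sigma>\<^sup>2)) = t * (w / sqrt (real q * s))" for w
        using \<sigma>(1) s by (simp add: real_sqrt_mult)
      moreover have "(\<lambda>x. (\<Sum>i<q. Y i x) / d) \<in> borel_measurable M" for d :: real by measurable
      ultimately show ?thesis by (simp only: char_distr)
    qed
    moreover have "char std_normal_distribution (t * \<sigma> / sqrt s) = complex_of_real (exp (- (?v / s * t\<^sup>2 / 2)))"
      using s by (simp add: char_std_normal_distribution power_mult_distrib power_divide \<sigma>(2) mult_ac)
    ultimately show ?thesis by simp
  qed
qed

lemma div_mult_over_LIMSEQ:
  assumes "0 < p"
  shows "(\<lambda>n. real (n div p) * real p / real n) \<longlonglongrightarrow> 1"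
proof (rule tendsto_sandwich)
  show "\<forall>\<^sub>F n in sequentially. 1 - real p / real n \<le> real (n div p) * real p / real n"
    using eventually_gt_at_top[of 0]
  proof eventually_elim
    case (elim n)
    have "n \<le> (n div p) * p + p"
      using div_mult_mod_eq[of n p] mod_less_divisor[OF assms, of n] by linarith
    then have "real n \<le> real (n div p) * real p + real p"
      by (metis of_nat_add of_nat_le_iff of_nat_mult)
    then have "real n - real p \<le> real (n div p) * real p" by simp
    then have "(real n - real p) / real n \<le> real (n div p) * real p / real n"
      by (rule divide_right_mono) simp
    then show ?case using elim by (simp add: diff_divide_distrib)
  qed
  show "\<forall>\<^sub>F n in sequentially. real (n div p) * real p / real n \<le> 1"
    using eventually_gt_at_top[of 0]
  proof eventually_elim
    case (elim n)
    have "real (n div p) * real p \<le> real n"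
      by (metis div_times_less_eq_dividend of_nat_le_iff of_nat_mult)
    then show ?case using elim by simp
  qed
  show "(\<lambda>n. 1 - real p / real n) \<longlonglongrightarrow> 1"
    using tendsto_diff[OF tendsto_const lim_const_over_n[of "real p"], of 1] by simp
qed simp


text \<open>Two limits in succession: n tends to infinity for a fixed block length p, where the
  classical theorem applies to the blocks, and then p tends to infinity. The error
  \<open>\<delta> p\<close> of the incomplete last block disappears on division by n, whereas
  \<open>\<epsilon> p\<close> survives the first limit and disappears in the second.\<close>

proposition (in prob_space) central_limit_by_blocks:
  fixes S :: "nat \<Rightarrow> 'a \<Rightarrow> real" and Y :: "nat \<Rightarrow> nat \<Rightarrow> 'a \<Rightarrow> real" and \<epsilon> \<delta> :: "nat \<Rightarrow> real"
  assumes S_meas: "\<And>n. random_variable borel (S n)" and S_sq: "\<And>n. integrable M (\<lambda>x. (S n x)\<^sup>2)"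
    and indep: "\<And>p. indep_vars (\<lambda>_. borel) (Y p) UNIV"
    and distr: "\<And>p j. distr M borel (Y p j) = distr M borel (Y p 0)"
    and sq: "\<And>p j. integrable M (\<lambda>x. (Y p j x)\<^sup>2)" and mean: "\<And>p j. expectation (Y p j) = 0"
    and Y_bound: "\<And>p q. expectation (\<lambda>x. (\<Sum>j<q. Y p j x)\<^sup>2) \<le> real q * real p * B"
    and approx: "\<And>p n. 0 < p \<Longrightarrow>
      expectation (\<lambda>x. (S n x - (\<Sum>j<n div p. Y p j x))\<^sup>2) \<le> real n * \<epsilon> p + \<delta> p"
    and \<epsilon>: "\<epsilon> \<longlonglongrightarrow> 0"
  obtains \<sigma> where "0 \<le> \<sigma>" "weak_conv_m (\<lambda>n. distr M borel (\<lambda>x. S n x / sqrt (real n))) (centered_normal \<sigma>)"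
proof -
  note [measurable] = S_meas
  have [measurable]: "random_variable borel (Y p j)" for p j
    using indep[of p] unfolding indep_vars_def2 by simp
  define W where "W p q x = (\<Sum>j<q. Y p j x)" for p q x
  have [measurable]: "random_variable borel (W p q)" for p q
    unfolding W_def[abs_def] by measurable
  have sq_add: "integrable M (\<lambda>x. (f x + g x)\<^sup>2)"
    if f: "integrable M (\<lambda>x. (f x)\<^sup>2)" and g: "integrable M (\<lambda>x. (g x)\<^sup>2)"
      and [measurable]: "random_variable borel f" "random_variable borel g" for f g :: "'a \<Rightarrow> real"
  proof (rule Bochner_Integration.integrable_bound)
    show "integrable M (\<lambda>x. 2 * (f x)\<^sup>2 + 2 * (g x)\<^sup>2)" using f g by auto
    have "(a + b)\<^sup>2 \<le> 2 * a\<^sup>2 + 2 * b\<^sup>2" for a b :: real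
      using zero_le_power2[of "a - b"] by (simp add: power2_sum power2_diff)
    then show "AE x in M. norm ((f x + g x)\<^sup>2) \<le> norm (2 * (f x)\<^sup>2 + 2 * (g x)\<^sup>2)" by simp
  qed measurable
  have W_sq: "integrable M (\<lambda>x. (W p q x)\<^sup>2)" for p q
  proof (induction q)
    case (Suc q)
    have "integrable M (\<lambda>x. (W p q x + Y p q x)\<^sup>2)"
      by (rule sq_add[OF Suc sq]) measurable
    then show ?case by (simp add: W_def)
  qed (simp add: W_def)
  have SW_sq: "integrable M (\<lambda>x. (S n x - W p q x)\<^sup>2)" for n p q
    using sq_add[of "S n" "\<lambda>x. - W p q x"] S_sq W_sq by simp
  have B: "0 \<le> B"
  proof -
    have "0 \<le> expectation (\<lambda>x. (\<Sum>j<1. Y 1 j x)\<^sup>2)" by simp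
    also have "\<dots> \<le> B" using Y_bound[of 1 1] by simp
    finally show ?thesis .
  qed
  \<comment> \<open>The block variance per unit of time; \<open>Y_bound\<close> with a single block
    keeps it in a compact interval.\<close>
  define v where "v p = expectation (\<lambda>x. (Y p 0 x)\<^sup>2) / real p" for p
  have v_nonneg: "0 \<le> v p" for p by (simp add: v_def)
  have v_le: "v p \<le> B" if "0 < p" for p
    using Y_bound[of p 1] that by (simp add: v_def divide_le_eq mult.commute)
  define \<phi> where "\<phi> n t = char (distr M borel (\<lambda>x. S n x / sqrt (real n))) t" for n t
  \<comment> \<open>Three comparisons: S with the block sum under the same normalization, the
    normalization by n with the one by the time \<open>?q n * p\<close> covered by full blocks, and
    the block sum with its Gaussian limit. The second costs nothing in the limit because the ratio
    of the two times tends to 1.\<close>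
  have block: "\<forall>\<^sub>F n in sequentially. cmod (\<phi> n t - complex_of_real (exp (- (v p * t\<^sup>2 / 2)))) < \<bar>t\<bar> * sqrt (\<epsilon> p) + \<eta>"
    if p: "0 < p" and \<eta>: "0 < \<eta>" for p t \<eta>
  proof -
    let ?q = "\<lambda>n. n div p"
    let ?\<psi> = "\<lambda>q. char (distr M borel (\<lambda>x. W p q x / sqrt (real q * real p))) t"
    let ?\<chi> = "\<lambda>n. char (distr M borel (\<lambda>x. W p (?q n) x / sqrt (real n))) t"
    let ?e = "complex_of_real (exp (- (v p * t\<^sup>2 / 2)))"
    let ?r = "\<lambda>n. \<bar>t\<bar> * sqrt (\<epsilon> p + \<delta> p / real n)
        + \<bar>t\<bar> * sqrt ((sqrt (real (?q n) * real p / real n) - 1)\<^sup>2 * B) + cmod (?\<psi> (?q n) - ?e)"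
    have "?\<psi> \<longlonglongrightarrow> ?e"
      using char_iid_sum_LIMSEQ[OF indep distr sq mean, of "real p" p t] p unfolding v_def W_def by simp
    moreover have "filterlim ?q at_top sequentially"
      using p by (intro filterlim_at_top_div_const_nat)
    ultimately have \<psi>: "(\<lambda>n. ?\<psi> (?q n)) \<longlonglongrightarrow> ?e" by (rule filterlim_compose)
    have "?r \<longlonglongrightarrow> \<bar>t\<bar> * sqrt (\<epsilon> p + 0) + \<bar>t\<bar> * sqrt ((sqrt 1 - 1)\<^sup>2 * B) + cmod (?e - ?e)"
      by (intro tendsto_intros lim_const_over_n div_mult_over_LIMSEQ p \<psi>)
    then have "?r \<longlonglongrightarrow> \<bar>t\<bar> * sqrt (\<epsilon> p)" by simp
    then have "\<forall>\<^sub>F n in sequentially. ?r n < \<bar>t\<bar> * sqrt (\<epsilon> p) + \<eta>"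
      using \<eta> by (intro order_tendstoD) auto
    moreover have "\<forall>\<^sub>F n in sequentially. cmod (\<phi> n t - ?e) \<le> ?r n"
      using eventually_ge_at_top[of p]
    proof eventually_elim
      case (elim n)
      have n: "0 < n" and q: "0 < ?q n" using elim p by (auto simp: div_greater_zero_iff)
      have "cmod (\<phi> n t - ?\<chi> n) \<le> \<bar>t\<bar> * sqrt (\<epsilon> p + \<delta> p / real n)"
        unfolding \<phi>_def
      proof (rule char_diff_le)
        have eq: "(\<lambda>x. (S n x / sqrt (real n) - W p (?q n) x / sqrt (real n))\<^sup>2) =
            (\<lambda>x. (S n x - W p (?q n) x)\<^sup>2 / real n)"
          by (simp add: power_divide flip: diff_divide_distrib)
        show "integrable M (\<lambda>x. (S n x / sqrt (real n) - W p (?q n) x / sqrt (real n))\<^sup>2)"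
          unfolding eq using SW_sq by simp
        have "expectation (\<lambda>x. (S n x - W p (?q n) x)\<^sup>2) / real n \<le> (real n * \<epsilon> p + \<delta> p) / real n"
          using approx[OF p, of n] by (intro divide_right_mono) (auto simp: W_def)
        then show "expectation (\<lambda>x. (S n x / sqrt (real n) - W p (?q n) x / sqrt (real n))\<^sup>2) \<le> \<epsilon> p + \<delta> p / real n"
          unfolding eq using n by (simp add: add_divide_distrib)
      qed measurable
      moreover have "cmod (?\<chi> n - ?\<psi> (?q n)) \<le> \<bar>t\<bar> * sqrt ((sqrt (real (?q n) * real p / real n) - 1)\<^sup>2 * B)"
      proof (rule char_diff_le)
        let ?d = "(1 / sqrt (real n) - 1 / sqrt (real (?q n) * real p))\<^sup>2"
        have eq: "(\<lambda>x. (W p (?q n) x / sqrt (real n) - W p (?q n) x / sqrt (real (?q n) * real p))\<^sup>2) =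
            (\<lambda>x. ?d * (W p (?q n) x)\<^sup>2)"
          unfolding power_mult_distrib[symmetric] by (simp add: algebra_simps)
        show "integrable M (\<lambda>x. (W p (?q n) x / sqrt (real n) - W p (?q n) x / sqrt (real (?q n) * real p))\<^sup>2)"
          unfolding eq using W_sq by simp
        have "?d * expectation (\<lambda>x. (W p (?q n) x)\<^sup>2) \<le> ?d * (real (?q n) * real p * B)"
          using Y_bound[of p "?q n"] by (intro mult_left_mono) (auto simp: W_def)
        also have "\<dots> = ((1 / sqrt (real n) - 1 / sqrt (real (?q n) * real p)) * sqrt (real (?q n) * real p))\<^sup>2 * B"
          by (simp add: power_mult_distrib)
        also have "(1 / sqrt (real n) - 1 / sqrt (real (?q n) * real p)) * sqrt (real (?q n) * real p) =
            sqrt (real (?q n) * real p / real n) - 1"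
          using p q by (simp add: left_diff_distrib real_sqrt_divide)
        finally show "expectation (\<lambda>x. (W p (?q n) x / sqrt (real n) - W p (?q n) x / sqrt (real (?q n) * real p))\<^sup>2)
            \<le> (sqrt (real (?q n) * real p / real n) - 1)\<^sup>2 * B"
          unfolding eq by simp
      qed measurable
      moreover have "cmod (\<phi> n t - ?e) \<le> cmod (\<phi> n t - ?\<chi> n) + cmod (?\<chi> n - ?\<psi> (?q n)) + cmod (?\<psi> (?q n) - ?e)"
        using norm_triangle_ineq[of "\<phi> n t - ?\<chi> n" "?\<chi> n - ?\<psi> (?q n)"]
          norm_triangle_ineq[of "\<phi> n t - ?\<psi> (?q n)" "?\<psi> (?q n) - ?e"] by simp
      ultimately show ?case by linarith
    qed
    ultimately show ?thesis by eventually_elim linarith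
  qed
  \<comment> \<open>\<open>Suc\<close> keeps block lengths positive. One convergent subsequence of
    variances is enough: for a given accuracy a single good block length controls
    \<open>\<phi> n t\<close> for all large n, so the full sequence converges.\<close>
  have "bounded (range (\<lambda>l. v (Suc l)))"
    using v_nonneg v_le by (intro boundedI[of _ B]) auto
  then obtain u r where r: "strict_mono r" and u: "((\<lambda>l. v (Suc l)) \<circ> r) \<longlonglongrightarrow> u"
    using bounded_imp_convergent_subsequence by blast
  have u0: "0 \<le> u" by (rule LIMSEQ_le_const[OF u]) (use v_nonneg in auto)
  define \<sigma> where "\<sigma> = sqrt u"
  have \<sigma>: "0 \<le> \<sigma>" "\<sigma>\<^sup>2 = u" using u0 by (auto simp: \<sigma>_def)
  have "weak_conv_m (\<lambda>n. distr M borel (\<lambda>x. S n x / sqrt (real n))) (centered_normal \<sigma>)"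
  proof (rule levy_continuity[OF _ real_distribution_centered_normal[OF \<sigma>(1)]])
    fix t :: real
    let ?e = "\<lambda>w. exp (- (w * t\<^sup>2 / 2))"
    have "(\<lambda>n. \<phi> n t) \<longlonglongrightarrow> complex_of_real (?e u)"
    proof (rule tendstoI)
      fix \<eta> :: real assume \<eta>: "0 < \<eta>"
      have "(\<lambda>l. ?e (v (Suc (r l)))) \<longlonglongrightarrow> ?e u"
        using u unfolding comp_def by (intro tendsto_intros) auto
      then have 1: "\<forall>\<^sub>F l in sequentially. dist (?e (v (Suc (r l)))) (?e u) < \<eta> / 3"
        using \<eta> by (intro tendstoD) auto
      have "(\<lambda>l. \<epsilon> (Suc (r l))) \<longlonglongrightarrow> 0"
        using LIMSEQ_subseq_LIMSEQ[OF LIMSEQ_Suc[OF \<epsilon>] r] by (simp add: comp_def)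
      then have "(\<lambda>l. \<bar>t\<bar> * sqrt (\<epsilon> (Suc (r l)))) \<longlonglongrightarrow> \<bar>t\<bar> * sqrt 0"
        by (intro tendsto_intros)
      then have 2: "\<forall>\<^sub>F l in sequentially. \<bar>t\<bar> * sqrt (\<epsilon> (Suc (r l))) < \<eta> / 3"
        using \<eta> by (intro order_tendstoD) auto
      from eventually_conj[OF 1 2] obtain l where
        l: "dist (?e (v (Suc (r l)))) (?e u) < \<eta> / 3" "\<bar>t\<bar> * sqrt (\<epsilon> (Suc (r l))) < \<eta> / 3"
        by (auto simp: eventually_sequentially)
      have "0 < \<eta> / 3" using \<eta> by simp
      from block[OF _ this, of "Suc (r l)" t]
      have "\<forall>\<^sub>F n in sequentially. cmod (\<phi> n t - complex_of_real (?e (v (Suc (r l))))) < \<bar>t\<bar> * sqrt (\<epsilon> (Suc (r l))) + \<eta> / 3"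
        by simp
      then show "\<forall>\<^sub>F n in sequentially. dist (\<phi> n t) (complex_of_real (?e u)) < \<eta>"
      proof eventually_elim
        case (elim n)
        have "dist (\<phi> n t) (complex_of_real (?e u)) \<le> dist (\<phi> n t) (complex_of_real (?e (v (Suc (r l))))) +
            dist (complex_of_real (?e (v (Suc (r l))))) (complex_of_real (?e u))"
          by (rule dist_triangle)
        also have "dist (complex_of_real (?e (v (Suc (r l))))) (complex_of_real (?e u)) = dist (?e (v (Suc (r l)))) (?e u)"
          by (rule dist_of_real)
        finally show ?case using elim l unfolding dist_norm[of "\<phi> n t"] by linarith
      qed
    qed
    then show "(\<lambda>n. char (distr M borel (\<lambda>x. S n x / sqrt (real n))) t) \<longlonglongrightarrow> char (centered_normal \<sigma>) t"
      unfolding \<phi>_def char_centered_normal[OF \<sigma>(1)] \<sigma>(2) .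
  qed simp
  with \<sigma>(1) show ?thesis by (rule that)
qed

section \<open>Shifted sequences, masks and centered sums\<close>

lemma has_sum_int_shift:
  assumes "(f has_sum s) (UNIV :: int set)"
  shows "((\<lambda>k. f (k + n)) has_sum s) UNIV"
proof -
  have "bij_betw (\<lambda>k::int. k + n) UNIV UNIV"
    by (rule bij_betwI[of _ _ _ "\<lambda>k. k - n"]) auto
  from has_sum_reindex_bij_betw[OF this, of f] show ?thesis using assms by simp
qed

text \<open>The index 0 has \<open>c 0 = 0\<close>, so a mask deletes terms rather than resampling
  them: the masked function depends on B only and no second copy of the sequence is needed.\<close>

definition mask :: "int set \<Rightarrow> (int \<Rightarrow> nat) \<Rightarrow> int \<Rightarrow> nat" where
  "mask B z = (\<lambda>k. if k \<in> B then z k else 0)"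

lemma measurable_mask: "mask B \<in> iid p \<rightarrow>\<^sub>M iid p"
  unfolding mask_def[abs_def] by (rule measurable_iid_mask)

lemma cesaro_mean_LIMSEQ_0:
  fixes x :: "nat \<Rightarrow> real"
  assumes "x \<longlonglongrightarrow> 0"
  shows "(\<lambda>n. (\<Sum>r<n. x r) / real n) \<longlonglongrightarrow> 0"
proof (rule LIMSEQ_I)
  fix e :: real assume e: "0 < e"
  obtain N where N: "\<And>r. r \<ge> N \<Longrightarrow> \<bar>x r\<bar> < e / 2"
    using LIMSEQ_D[OF assms, of "e / 2"] e by auto
  define A where "A = (\<Sum>r<N. \<bar>x r\<bar>)"
  have "(\<lambda>n. A / real n) \<longlonglongrightarrow> 0" by (rule lim_const_over_n)
  then obtain N' where N': "\<And>n. n \<ge> N' \<Longrightarrow> \<bar>A / real n\<bar> < e / 2"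
    using LIMSEQ_D[of "\<lambda>n. A / real n" 0 "e / 2"] e by auto
  have "norm ((\<Sum>r<n. x r) / real n - 0) < e" if n: "n \<ge> Suc (max N N')" for n
  proof -
    have "\<bar>\<Sum>r<n. x r\<bar> \<le> (\<Sum>r<n. \<bar>x r\<bar>)" by (rule sum_abs)
    also have "\<dots> = A + (\<Sum>r=N..<n. \<bar>x r\<bar>)"
      using n unfolding A_def by (simp add: lessThan_atLeast0 sum.atLeastLessThan_concat)
    also have "(\<Sum>r=N..<n. \<bar>x r\<bar>) \<le> (\<Sum>r=N..<n. e / 2)"
      using N by (intro sum_mono less_imp_le) auto
    also have "\<dots> \<le> real n * (e / 2)" using e by (simp add: mult_right_mono)
    finally have "\<bar>\<Sum>r<n. x r\<bar> / real n \<le> (A + real n * (e / 2)) / real n"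
      by (intro divide_right_mono) auto
    also have "\<dots> = A / real n + e / 2" using n by (simp add: add_divide_distrib)
    also have "\<dots> < e" using N'[of n] n by (simp only: abs_less_iff) linarith
    finally show ?thesis by simp
  qed
  then show "\<exists>no. \<forall>n\<ge>no. norm ((\<Sum>r<n. x r) / real n - 0) < e" by blast
qed

lemma (in prob_space) expectation_centered_sum_squared:
  fixes X :: "'i \<Rightarrow> 'a \<Rightarrow> real"
  assumes "\<And>i. i \<in> I \<Longrightarrow> integrable M (X i)"
    and "\<And>i j. i \<in> I \<Longrightarrow> j \<in> I \<Longrightarrow> integrable M (\<lambda>x. X i x * X j x)"
  shows "integrable M (\<lambda>x. (\<Sum>i\<in>I. X i x - expectation (X i))\<^sup>2)"
    and "expectation (\<lambda>x. (\<Sum>i\<in>I. X i x - expectation (X i))\<^sup>2) =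
      (\<Sum>i\<in>I. \<Sum>j\<in>I. expectation (\<lambda>x. X i x * X j x) - expectation (X i) * expectation (X j))"
proof -
  have sq: "(\<Sum>i\<in>I. X i x - expectation (X i))\<^sup>2 =
      (\<Sum>i\<in>I. \<Sum>j\<in>I. (X i x - expectation (X i)) * (X j x - expectation (X j)))" for x
    by (simp add: power2_eq_square sum_product)
  have eq: "(X i x - expectation (X i)) * (X j x - expectation (X j)) =
      X i x * X j x - expectation (X j) * X i x - expectation (X i) * X j x + expectation (X i) * expectation (X j)" for i j x
    by (simp add: algebra_simps)
  have int: "integrable M (\<lambda>x. (X i x - expectation (X i)) * (X j x - expectation (X j)))" if "i \<in> I" "j \<in> I" for i j
    unfolding eq using assms that by (intro Bochner_Integration.integrable_add Bochner_Integration.integrable_diff) auto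
  have "expectation (\<lambda>x. (X i x - expectation (X i)) * (X j x - expectation (X j))) =
      expectation (\<lambda>x. X i x * X j x) - expectation (X i) * expectation (X j)" if "i \<in> I" "j \<in> I" for i j
    unfolding eq using assms that by (simp add: prob_space)
  then show "expectation (\<lambda>x. (\<Sum>i\<in>I. X i x - expectation (X i))\<^sup>2) =
      (\<Sum>i\<in>I. \<Sum>j\<in>I. expectation (\<lambda>x. X i x * X j x) - expectation (X i) * expectation (X j))"
    unfolding sq using int by (simp add: Bochner_Integration.integral_sum)
  show "integrable M (\<lambda>x. (\<Sum>i\<in>I. X i x - expectation (X i))\<^sup>2)"
    unfolding sq using int by (intro Bochner_Integration.integrable_sum)
qed

context summable_weights
begin

lemma good_shift:
  assumes "good z"
  shows "good (shift n z)"
  unfolding good_def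
proof (intro allI)
  fix i m
  have "(\<lambda>k. a (k - (i + n)) * exp (real m * c (z k))) summable_on UNIV"
    using assms by (simp add: good_def)
  then obtain s where "((\<lambda>k. a (k - (i + n)) * exp (real m * c (z k))) has_sum s) UNIV"
    by (auto simp: summable_on_def)
  from has_sum_int_shift[OF this, of n]
  show "(\<lambda>k. a (k - i) * exp (real m * c (z (k + n)))) summable_on UNIV"
    by (auto simp: summable_on_def)
qed

lemma R_shift:
  assumes "good z"
  shows "R i (shift n z) = R (i + n) z"
proof (rule has_sum_unique)
  show "((\<lambda>k. a (k - i) * c (z (k + n))) has_sum R i (shift n z)) UNIV"
    by (rule R_has_sum[OF good_shift[OF assms]])
  show "((\<lambda>k. a (k - i) * c (z (k + n))) has_sum R (i + n) z) UNIV"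
    using has_sum_int_shift[OF R_has_sum[OF assms, of "i + n"], of n] by simp
qed

lemma wt_shift: "wt (i + n) J (k + n) = wt i ((\<lambda>k. k - n) ` J) k"
  by (auto simp: wt_def image_iff)

lemma tail_shift: "tail i ((\<lambda>k. k - n) ` J) = tail (i + n) J"
  using has_sum_unique[OF tail_has_sum has_sum_int_shift[OF tail_has_sum[of "i + n" J], of n, unfolded wt_shift]] .

lemma Z_shift:
  assumes "good z" "good z'"
  shows "Z i ((\<lambda>k. k - n) ` J) (shift n z) (shift n z') = Z (i + n) J z z'"
  using has_sum_unique[OF Z_has_sum[OF good_shift[OF assms(1)] good_shift[OF assms(2)]]
      has_sum_int_shift[OF Z_has_sum[OF assms, of "i + n" J], of n, unfolded wt_shift]] .

lemma Loc_shift: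
  assumes F: "Loc C i F"
  shows "Loc C (i + n) (\<lambda>z. F (shift n z))"
  unfolding Loc_def
proof (intro conjI allI impI)
  show "0 \<le> C" by (rule LocD(1)[OF F])
  show "(\<lambda>z. F (shift n z)) \<in> borel_measurable (iid p)"
    by (rule measurable_compose[OF measurable_iid_reindex LocD(2)[OF F]])
  show "\<bar>F (shift n z)\<bar> \<le> C * exp (R (i + n) z)" if "good z" for z
    using LocD(3)[OF F good_shift[OF that, of n]] R_shift[OF that] by simp
  fix z z' J assume *: "good z" "good z'" "\<forall>k. k \<notin> J \<longrightarrow> z k = z' k"
  have "\<bar>F (shift n z) - F (shift n z')\<bar> \<le> C * (Z i ((\<lambda>k. k - n) ` J) (shift n z) (shift n z') *
      exp (R i (shift n z) + R i (shift n z')))"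
  proof (intro LocD(4)[OF F] good_shift *)
    fix k assume "k \<notin> (\<lambda>k. k - n) ` J"
    then have "k + n \<notin> J" by (metis add_diff_cancel_right' imageI)
    then show "z (k + n) = z' (k + n)" using *(3) by blast
  qed
  then show "\<bar>F (shift n z) - F (shift n z')\<bar> \<le> C * (Z (i + n) J z z' * exp (R (i + n) z + R (i + n) z'))"
    using * by (simp add: Z_shift R_shift)
qed

section \<open>Effect of deleting coordinates\<close>

lemma c_mask_le: "c (mask B z k) \<le> c (z k)"
  by (simp add: mask_def c_0 c_nonneg)

lemma exp_c_mask_le: "exp (real m * c (mask B z k)) \<le> exp (real m * c (z k))"
  by (simp add: c_mask_le mult_left_mono)

lemma good_mask:
  assumes "good z"
  shows "good (mask B z)"
  unfolding good_def
proof (intro allI)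
  fix i m
  have "(\<lambda>k. a (k - i) * exp (real m * c (z k))) summable_on UNIV"
    using assms by (simp add: good_def)
  then show "(\<lambda>k. a (k - i) * exp (real m * c (mask B z k))) summable_on UNIV"
    by (rule summable_on_comparison) (auto intro!: mult_left_mono exp_c_mask_le simp: a_nonneg)
qed

lemma R_mask_le: "good z \<Longrightarrow> R i (mask B z) \<le> R i z"
  by (rule has_sum_mono[OF R_has_sum[OF good_mask] R_has_sum])
    (auto intro!: mult_left_mono c_mask_le simp: a_nonneg)

lemma Z_mask_le: "good z \<Longrightarrow> good z' \<Longrightarrow> Z i J (mask B z) (mask B z') \<le> Z i J z z'"
  by (rule has_sum_mono[OF Z_has_sum[OF good_mask good_mask] Z_has_sum])
    (auto intro!: mult_left_mono add_mono c_mask_le simp: wt_bounds)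

lemma V_mask_le: "good z \<Longrightarrow> V (wt i J) m (mask B z) \<le> V (wt i J) m z"
  by (rule has_sum_mono[OF V_wt_has_sum[OF good_mask] V_wt_has_sum])
    (auto intro!: mult_left_mono exp_c_mask_le simp: wt_bounds)

text \<open>Deleting terms can only lower the majorants \<open>R\<close> and \<open>Z\<close>, hence
  the same constant C.\<close>

lemma Loc_mask:
  assumes F: "Loc C i F"
  shows "Loc C i (\<lambda>z. F (mask B z))"
  unfolding Loc_def
proof (intro conjI allI impI)
  show C: "0 \<le> C" by (rule LocD(1)[OF F])
  show "(\<lambda>z. F (mask B z)) \<in> borel_measurable (iid p)"
    by (rule measurable_compose[OF measurable_mask LocD(2)[OF F]])
  show "\<bar>F (mask B z)\<bar> \<le> C * exp (R i z)" if "good z" for z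
  proof -
    have "\<bar>F (mask B z)\<bar> \<le> C * exp (R i (mask B z))" by (rule LocD(3)[OF F good_mask[OF that]])
    also have "\<dots> \<le> C * exp (R i z)" using R_mask_le[OF that] C by (intro mult_left_mono) auto
    finally show ?thesis .
  qed
  fix z z' J assume *: "good z" "good z'" "\<forall>k. k \<notin> J \<longrightarrow> z k = z' k"
  have "\<bar>F (mask B z) - F (mask B z')\<bar> \<le> C * (Z i J (mask B z) (mask B z') *
      exp (R i (mask B z) + R i (mask B z')))"
    using * by (intro LocD(4)[OF F] good_mask) (auto simp: mask_def)
  also have "\<dots> \<le> C * (Z i J z z' * exp (R i z + R i z'))"
    using * by (intro mult_left_mono mult_mono C Z_mask_le Z_nonneg) (auto intro!: add_mono R_mask_le)
  finally show "\<bar>F (mask B z) - F (mask B z')\<bar> \<le> C * (Z i J z z' * exp (R i z + R i z'))" .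
qed

lemma Loc_diff:
  assumes F: "Loc C i F" and G: "Loc C' i G"
  shows "Loc (C + C') i (\<lambda>z. F z - G z)"
  unfolding Loc_def
proof (intro conjI allI impI)
  show "0 \<le> C + C'" using LocD(1)[OF F] LocD(1)[OF G] by simp
  show "(\<lambda>z. F z - G z) \<in> borel_measurable (iid p)"
    using LocD(2)[OF F] LocD(2)[OF G] by simp
  show "\<bar>F z - G z\<bar> \<le> (C + C') * exp (R i z)" if "good z" for z
    using LocD(3)[OF F that] LocD(3)[OF G that] by (simp add: distrib_right)
  fix z z' J assume *: "good z" "good z'" "\<forall>k. k \<notin> J \<longrightarrow> z k = z' k"
  then have "\<bar>F z - F z'\<bar> \<le> C * (Z i J z z' * exp (R i z + R i z'))"
    "\<bar>G z - G z'\<bar> \<le> C' * (Z i J z z' * exp (R i z + R i z'))"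
    by (auto intro!: LocD(4)[OF F] LocD(4)[OF G])
  then show "\<bar>F z - G z - (F z' - G z')\<bar> \<le> (C + C') * (Z i J z z' * exp (R i z + R i z'))"
    unfolding distrib_right by linarith
qed

lemma Loc_1: "Loc 1 i (\<lambda>_. 1)"
  unfolding Loc_def by (auto simp: R_nonneg Z_nonneg)

lemma Loc_mean_bound:
  assumes F: "Loc C i F"
  shows "\<bar>\<integral>z. F z \<partial>iid p\<bar> \<le> C * M 1"
proof -
  have "\<bar>\<integral>z. F z \<partial>iid p\<bar> \<le> (\<integral>z. C * exp (real 1 * R i z) \<partial>iid p)"
    by (intro abs_integral_le integrable_mult_right integrable_exp_R)
      (use AE_good in eventually_elim, use LocD(3)[OF F] in simp)
  also have "\<dots> \<le> C * M 1"
    using integral_exp_R[of 1 i] LocD(1)[OF F] by (simp add: mult_left_mono)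
  finally show ?thesis .
qed

text \<open>From \<open>Z_exp_le\<close> with \<open>Q = 2 * R i z + R j z\<close>: the two
  \<open>V\<close> terms give \<open>2 * M 2\<close>. The exponent
  \<open>4 * R i z + 2 * R j z\<close> is at most 6 times the larger of the two, so its exponential
  is below a sum of two; with the factor 2 in front this gives \<open>4 * M 6\<close>.\<close>

definition \<kappa> :: real where "\<kappa> = 2 * M 2 + 4 * M 6"

lemma \<kappa>_nonneg: "0 \<le> \<kappa>"
  using M_ge_1[of 2] M_ge_1[of 6] by (simp add: \<kappa>_def)

lemma Loc_mask_error:
  assumes F: "Loc C i F" and G: "Loc C' j G"
  shows "\<bar>\<integral>z. (F z - F (mask B z)) * G z \<partial>iid p\<bar> \<le> C * C' * (tail i (- B) * \<kappa>)"
proof -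
  let ?t = "tail i (- B)"
  let ?V = "V (wt i (- B)) 2"
  let ?E = "\<lambda>i z. exp (real 6 * R i z)"
  let ?B = "\<lambda>z. C * C' * (2 * ?V z + 2 * ?t * (?E i z + ?E j z))"
  have C: "0 \<le> C * C'" using LocD(1)[OF F] LocD(1)[OF G] by simp
  have "AE z in iid p. \<bar>(F z - F (mask B z)) * G z\<bar> \<le> ?B z"
    using AE_good
  proof eventually_elim
    case (elim z)
    have "\<bar>F z - F (mask B z)\<bar> \<le> C * (Z i (- B) z (mask B z) * exp (R i z + R i (mask B z)))"
      using elim by (intro LocD(4)[OF F] good_mask) (auto simp: mask_def)
    also have "\<dots> \<le> C * (Z i (- B) z (mask B z) * exp (R i z + R i z))"
      using elim R_mask_le[OF elim, of i B]
      by (intro mult_left_mono LocD(1)[OF F] Z_nonneg good_mask) auto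
    finally have "\<bar>(F z - F (mask B z)) * G z\<bar> \<le>
        (C * (Z i (- B) z (mask B z) * exp (R i z + R i z))) * (C' * exp (R j z))"
      unfolding abs_mult by (intro mult_mono LocD(3)[OF G] elim)
        (use elim in \<open>auto intro!: mult_nonneg_nonneg LocD(1)[OF F] Z_nonneg good_mask\<close>)
    also have "\<dots> = C * C' * (Z i (- B) z (mask B z) * exp (R i z + R i z + R j z))"
      by (simp add: exp_add mult_ac)
    also have "\<dots> \<le> C * C' * (?V z + ?V (mask B z) + 2 * ?t * exp (2 * (R i z + R i z + R j z)))"
      by (intro mult_left_mono Z_exp_le good_mask elim C)
    also have "\<dots> \<le> ?B z"
    proof (rule mult_left_mono[OF _ C])
      have "exp (2 * (R i z + R i z + R j z)) \<le> ?E i z + ?E j z"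
      proof (cases "R i z \<le> R j z")
        case True
        then have "exp (2 * (R i z + R i z + R j z)) \<le> ?E j z" by simp
        then show ?thesis by (simp add: add_increasing)
      next
        case False
        then have "exp (2 * (R i z + R i z + R j z)) \<le> ?E i z" by simp
        then show ?thesis by (simp add: add_increasing2)
      qed
      then have "2 * ?t * exp (2 * (R i z + R i z + R j z)) \<le> 2 * ?t * (?E i z + ?E j z)"
        by (intro mult_left_mono) (auto simp: tail_nonneg)
      then show "?V z + ?V (mask B z) + 2 * ?t * exp (2 * (R i z + R i z + R j z)) \<le>
          2 * ?V z + 2 * ?t * (?E i z + ?E j z)"
        using V_mask_le[OF elim, of i "- B" 2 B] by linarith
    qed
    finally show ?case .
  qed
  moreover have int: "integrable (iid p) ?B"
    by (intro integrable_mult_right Bochner_Integration.integrable_add integrable_V_wt integrable_exp_R)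
  ultimately have "\<bar>\<integral>z. (F z - F (mask B z)) * G z \<partial>iid p\<bar> \<le> (\<integral>z. ?B z \<partial>iid p)"
    by (rule abs_integral_le)
  also have "(\<integral>z. ?B z \<partial>iid p) = C * C' * (2 * (?t * M 2) + 2 * ?t * ((\<integral>z. ?E i z \<partial>iid p) + (\<integral>z. ?E j z \<partial>iid p)))"
    by (simp only: integral_mult_right_zero Bochner_Integration.integral_add Bochner_Integration.integrable_add
        integrable_mult_right integrable_V_wt integrable_exp_R integral_V_wt simp_thms)
  also have "\<dots> \<le> C * C' * (2 * (?t * M 2) + 2 * ?t * (M 6 + M 6))"
    by (intro mult_left_mono add_left_mono add_mono integral_exp_R C) (simp add: tail_nonneg)
  finally show ?thesis by (simp add: \<kappa>_def algebra_simps)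
qed

text \<open>A bound that does not decay in \<open>i - j\<close> but is small when i lies deep inside
  B. It complements \<open>Loc_covariance\<close>, which decays but does not see that the masking
  error is small.\<close>

lemma Loc_mask_covariance:
  assumes F: "Loc C i F" and G: "Loc C' j G"
    and H: "H = (\<lambda>z. F z - F (mask B z))"
  shows "\<bar>(\<integral>z. H z * G z \<partial>iid p) - (\<integral>z. H z \<partial>iid p) * (\<integral>z. G z \<partial>iid p)\<bar>
    \<le> C * C' * (\<kappa> * (1 + M 1)) * tail i (- B)"
proof -
  have "\<bar>\<integral>z. H z * G z \<partial>iid p\<bar> \<le> C * C' * (tail i (- B) * \<kappa>)"
    unfolding H by (rule Loc_mask_error[OF F G])
  moreover have "\<bar>(\<integral>z. H z \<partial>iid p) * (\<integral>z. G z \<partial>iid p)\<bar> \<le> (C * (tail i (- B) * \<kappa>)) * (C' * M 1)"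
    unfolding abs_mult
  proof (rule mult_mono)
    show "\<bar>\<integral>z. H z \<partial>iid p\<bar> \<le> C * (tail i (- B) * \<kappa>)"
      \<comment> \<open>The mean of H is the masking error tested against the constant function
        1.\<close>
      using Loc_mask_error[OF F Loc_1[of j], of B] by (simp add: H)
    show "0 \<le> C * (tail i (- B) * \<kappa>)" by (simp add: LocD(1)[OF F] tail_nonneg \<kappa>_nonneg)
  qed (use Loc_mean_bound[OF G] in simp_all)
  ultimately show ?thesis by (simp add: algebra_simps)
qed

text \<open>Sums the better of two covariance bounds over all time differences: t alone is not
  summable, and \<open>a\<close> alone does not become small. With the minimum, the sum tends to 0
  together with t.\<close>

definition \<psi> :: "real \<Rightarrow> real" where "\<psi> t = rsum (\<lambda>k. min t (a k))"

lemma a_summable0: "a summable_on UNIV"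
  using a_summable[of 0] by simp

lemma \<psi>_has_sum:
  assumes "0 \<le> t"
  shows "((\<lambda>k. min t (a k)) has_sum \<psi> t) UNIV"
  unfolding \<psi>_def
proof (rule has_sum_rsum_nonneg)
  show "(\<lambda>k. min t (a k)) summable_on UNIV"
    by (rule summable_on_comparison[OF a_summable0]) (use assms a_nonneg in auto)
qed (use assms a_nonneg in auto)

lemma \<psi>_nonneg: "0 \<le> t \<Longrightarrow> 0 \<le> \<psi> t"
  by (rule has_sum_nonneg[OF \<psi>_has_sum]) (auto simp: a_nonneg)

lemma \<psi>_mono: "0 \<le> s \<Longrightarrow> s \<le> t \<Longrightarrow> \<psi> s \<le> \<psi> t"
  by (rule has_sum_mono[OF \<psi>_has_sum \<psi>_has_sum]) auto

lemma \<psi>_le_1: "0 \<le> t \<Longrightarrow> \<psi> t \<le> 1"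
  by (rule has_sum_mono[OF \<psi>_has_sum a_sum]) auto

lemma sum_min_le_\<psi>:
  assumes "0 \<le> t"
  shows "(\<Sum>j<n. min t (a (i - int j))) \<le> \<psi> t"
proof -
  have "inj_on (\<lambda>j. i - int j) {..<n}" by (rule inj_onI) simp
  then have "(\<Sum>j<n. min t (a (i - int j))) = (\<Sum>k\<in>(\<lambda>j. i - int j) ` {..<n}. min t (a k))"
    by (simp add: sum.reindex)
  also have "\<dots> \<le> infsum (\<lambda>k. min t (a k)) UNIV"
    using \<psi>_has_sum[OF assms] assms a_nonneg
    by (intro finite_sum_le_infsum) (auto simp: summable_on_def)
  finally show ?thesis using infsumI[OF \<psi>_has_sum[OF assms]] by simp
qed

text \<open>On a fixed window the minimum is at most \<open>s r\<close> at each of its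
  \<open>2 * N + 1\<close> points; off the window it is at most the weight \<open>a\<close>, whose
  tail is small.\<close>

lemma \<psi>_LIMSEQ_0:
  assumes s: "\<And>r. 0 \<le> s r" "s \<longlonglongrightarrow> 0"
  shows "(\<lambda>r. \<psi> (s r)) \<longlonglongrightarrow> 0"
proof (rule LIMSEQ_I)
  fix e :: real assume e: "0 < e"
  obtain N where N: "\<bar>tail 0 (- {- int N..int N})\<bar> < e / 2"
    using LIMSEQ_D[OF tail_compl_LIMSEQ[of 0], of "e / 2"] e by auto
  have bound: "\<psi> (s r) \<le> (2 * real N + 1) * s r + tail 0 (- {- int N..int N})" for r
  proof (rule has_sum_mono[OF \<psi>_has_sum[OF s(1)]])
    have "((\<lambda>k. if k \<in> {- int N..int N} then s r else 0) has_sum (2 * real N + 1) * s r) UNIV"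
      by (rule has_sum_finite_neutralI[of "{- int N..int N}"]) auto
    then show "((\<lambda>k. (if k \<in> {- int N..int N} then s r else 0) + wt 0 (- {- int N..int N}) k) has_sum
        (2 * real N + 1) * s r + tail 0 (- {- int N..int N})) UNIV"
      by (intro has_sum_add tail_has_sum)
  qed (auto simp: wt_def)
  have "(\<lambda>r. (2 * real N + 1) * s r) \<longlonglongrightarrow> (2 * real N + 1) * 0"
    by (intro tendsto_intros s)
  then obtain r0 where r0: "\<And>r. r \<ge> r0 \<Longrightarrow> \<bar>(2 * real N + 1) * s r\<bar> < e / 2"
    using LIMSEQ_D[of "\<lambda>r. (2 * real N + 1) * s r" 0 "e / 2"] e by auto
  have "norm (\<psi> (s r) - 0) < e" if "r \<ge> r0" for r
    using bound[of r] r0[OF that] N \<psi>_nonneg[OF s(1)[of r]] by simp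
  then show "\<exists>no. \<forall>r\<ge>no. norm (\<psi> (s r) - 0) < e" by blast
qed

lemma tail_mono: "J \<subseteq> J' \<Longrightarrow> tail i J \<le> tail i J'"
  by (rule has_sum_mono[OF tail_has_sum tail_has_sum]) (auto simp: wt_def a_nonneg)

definition \<Psi> :: "nat \<Rightarrow> real" where "\<Psi> q = (\<Sum>r<q. \<psi> (tail (int r) (- {0..<int q})))"

text \<open>The outside of a block is far from most points inside it, so the average of \<open>\<psi>\<close> over the block is small.\<close>

lemma \<Psi>_LIMSEQ: "(\<lambda>q. \<Psi> q / real q) \<longlonglongrightarrow> 0"
proof -
  define \<tau> where "\<tau> m = tail 0 (- {- int m..int m})" for m
  define x where "x m = \<psi> (\<tau> m)" for m
  have x0: "0 \<le> x m" for m by (simp add: x_def \<psi>_nonneg \<tau>_def tail_nonneg)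
  have "x \<longlonglongrightarrow> 0"
    unfolding x_def \<tau>_def by (intro \<psi>_LIMSEQ_0 tail_nonneg tail_compl_LIMSEQ)
  then have lim: "(\<lambda>q. 2 * ((\<Sum>r<q. x r) / real q)) \<longlonglongrightarrow> 2 * 0"
    by (intro tendsto_intros cesaro_mean_LIMSEQ_0)
  have le: "\<Psi> q \<le> 2 * (\<Sum>r<q. x r)" for q
  proof -
    have "\<psi> (tail (int r) (- {0..<int q})) \<le> x r + x (q - Suc r)" if "r < q" for r
    proof -
      \<comment> \<open>The distance from r to the nearer end of the block: seen from r, the outside
        of the block avoids the window of radius \<open>?m\<close>. The minimum is then replaced by
        the sum of both possibilities, and reversing the order of summation makes the two sums
        equal.\<close>
      let ?m = "min r (q - Suc r)"
      have "tail (int r) (- {0..<int q}) = tail 0 ((\<lambda>k. k - int r) ` (- {0..<int q}))"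
        using tail_shift[of 0 "int r" "- {0..<int q}"] by simp
      also have "\<dots> \<le> \<tau> ?m"
        unfolding \<tau>_def using that by (intro tail_mono) auto
      finally have "\<psi> (tail (int r) (- {0..<int q})) \<le> x ?m"
        unfolding x_def by (intro \<psi>_mono tail_nonneg)
      then show ?thesis using x0[of r] x0[of "q - Suc r"] by (auto simp: min_def split: if_splits)
    qed
    then have "\<Psi> q \<le> (\<Sum>r<q. x r + x (q - Suc r))"
      unfolding \<Psi>_def by (intro sum_mono) auto
    also have "\<dots> = 2 * (\<Sum>r<q. x r)"
      by (simp add: sum.distrib sum.nat_diff_reindex)
    finally show ?thesis .
  qed
  show ?thesis
  proof (rule tendsto_sandwich[OF _ _ tendsto_const])
    show "\<forall>\<^sub>F q in sequentially. 0 \<le> \<Psi> q / real q"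
      by (simp add: \<Psi>_def sum_nonneg \<psi>_nonneg tail_nonneg)
    show "\<forall>\<^sub>F q in sequentially. \<Psi> q / real q \<le> 2 * ((\<Sum>r<q. x r) / real q)"
    proof (rule always_eventually, rule allI)
      fix q
      have "\<Psi> q / real q \<le> 2 * (\<Sum>r<q. x r) / real q" by (intro divide_right_mono le) simp
      then show "\<Psi> q / real q \<le> 2 * ((\<Sum>r<q. x r) / real q)" by simp
    qed
    show "(\<lambda>q. 2 * ((\<Sum>r<q. x r) / real q)) \<longlonglongrightarrow> 0" using lim by simp
  qed
qed

text \<open>Blocks of length q, with every term stripped of the coordinates outside its own block.
  There are no gaps between the blocks: terms near an end are badly approximated, but their
  proportion vanishes as q grows.\<close>

theorem Loc_central_limit:
  assumes F: "Loc C 0 F" and mean: "(\<integral>z. F z \<partial>iid p) = 0"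
  obtains \<sigma> where "0 \<le> \<sigma>"
    "weak_conv_m (\<lambda>n. distr (iid p) borel (\<lambda>z. (\<Sum>i<n. F (shift (int i) z)) / sqrt (real n))) (centered_normal \<sigma>)"
proof -
  interpret P: prob_space "iid p :: (int \<Rightarrow> nat) measure" by (rule prob_space_iid)
  have P1: "P.prob UNIV = 1" using P.prob_space by simp
  define f where "f i z = F (shift (int i) z)" for i z
  define bl where "bl q j = {int (j * q)..<int (j * q + q)}" for q j :: nat
  define g where "g q i z = f i (mask (bl q (i div q)) z)" for q i z
  \<comment> \<open>The terms are centered anew because masking changes their means.\<close>
  define Y where "Y q j z = (\<Sum>i = j * q..<j * q + q. g q i z - P.expectation (g q i))" for q j z
  define S where "S n z = (\<Sum>i<n. f i z)" for n z
  have C: "0 \<le> C" by (rule LocD(1)[OF F])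
  have f: "Loc C (int i) (f i)" for i
    using Loc_shift[OF F, of "int i"] by (simp add: f_def[abs_def])
  have g: "Loc C (int i) (g q i)" for q i
    unfolding g_def[abs_def] by (rule Loc_mask[OF f])
  have [measurable]: "f i \<in> borel_measurable (iid p)" "g q i \<in> borel_measurable (iid p)" for q i
    by (rule LocD(2)[OF f] LocD(2)[OF g])+
  have f_mean: "P.expectation (f i) = 0" for i
    unfolding f_def using integral_iid_reindex[OF inj_add_int LocD(2)[OF F], of "int i"] mean by simp
  have cov_a: "P.expectation (\<lambda>z. H i z * H j z) - P.expectation (H i) * P.expectation (H j) \<le> B * B * Kc * a (int i - int j)"
    if "\<And>i. Loc B (int i) (H i)" for B i j and H :: "nat \<Rightarrow> _"
    using Loc_covariance[OF that that, of i j] by linarith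
  \<comment> \<open>Since \<open>a\<close> is at most 1, the minimum in \<open>\<psi> 1\<close> is
    \<open>a\<close> itself.\<close>
  have a_sum_le: "(\<Sum>j<n. a (i - int j)) \<le> 1" for n i
    using sum_min_le_\<psi>[of 1 i n] \<psi>_le_1[of 1] a_le_1 by (simp add: min_absorb2)
  have Y_sum: "(\<Sum>j<m. Y q j z) = (\<Sum>i<m * q. g q i z - P.expectation (g q i))" for m q z
    unfolding Y_def by (rule sum.nat_group)
  have Y_mean: "P.expectation (Y q j) = 0" for q j
    unfolding Y_def using Loc_integrable[OF g] by (simp add: P1)
  have Y_sq: "integrable (iid p) (\<lambda>z. (Y q j z)\<^sup>2)" for q j
    unfolding Y_def by (intro P.expectation_centered_sum_squared Loc_integrable[OF g] Loc_mult_integrable[OF g g])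
  have Y_bound: "P.expectation (\<lambda>z. (\<Sum>j<m. Y q j z)\<^sup>2) \<le> real m * real q * (C * C * Kc)" for q m
  proof -
    have "P.expectation (\<lambda>z. (\<Sum>j<m. Y q j z)\<^sup>2) = (\<Sum>i<m * q. \<Sum>j<m * q.
        P.expectation (\<lambda>z. g q i z * g q j z) - P.expectation (g q i) * P.expectation (g q j))"
      unfolding Y_sum by (intro P.expectation_centered_sum_squared Loc_integrable[OF g] Loc_mult_integrable[OF g g])
    also have "\<dots> \<le> (\<Sum>i<m * q. \<Sum>j<m * q. C * C * Kc * a (int i - int j))"
      by (intro sum_mono cov_a g)
    also have "\<dots> = (\<Sum>i<m * q. C * C * Kc * (\<Sum>j<m * q. a (int i - int j)))"
      by (simp add: sum_distrib_left)
    also have "\<dots> \<le> (\<Sum>i<m * q. C * C * Kc * 1)"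
      using Kc_pos C by (intro sum_mono mult_left_mono a_sum_le) auto
    finally show ?thesis by simp
  qed
  have bl_disj: "disjoint_family (bl q)" for q
  proof -
    have "k div int q = int j" if "k \<in> bl q j" for k j
    proof -
      have "0 < q" "int q * int j \<le> k" "k < int q * int j + int q" using that by (auto simp: bl_def mult.commute)
      then have "0 \<le> k - int q * int j" "k - int q * int j < int q" by auto
      then have "(k - int q * int j) div int q = 0" by (rule div_pos_pos_trivial)
      moreover have "(k - int q * int j + int q * int j) div int q = int j + (k - int q * int j) div int q"
        using \<open>0 < q\<close> by (intro div_mult_self2) simp
      ultimately show ?thesis by simp
    qed
    then show ?thesis unfolding disjoint_family_on_def by (metis disjoint_iff of_nat_eq_iff)
  qed
  have idiv: "i div q = j" if "i \<in> {j * q..<j * q + q}" for i j q :: nat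
    using that by (intro div_nat_eqI) (auto simp: mult.commute)
  have Y_indep: "P.indep_vars (\<lambda>_. borel) (Y q) UNIV" for q
  proof (rule indep_vars_iid_depends_on[where J = "bl q"])
    show "disjoint_family_on (bl q) UNIV" by (rule bl_disj)
    show "Y q j \<in> borel_measurable (iid p)" for j unfolding Y_def[abs_def] by measurable
    show "depends_on (bl q j) (Y q j)" for j
    proof (rule depends_onI)
      fix z z' :: "int \<Rightarrow> nat" assume "\<And>k. k \<in> bl q j \<Longrightarrow> z k = z' k"
      then have "mask (bl q j) z = mask (bl q j) z'" by (auto simp: mask_def)
      then show "Y q j z = Y q j z'"
        unfolding Y_def g_def by (intro sum.cong refl) (simp add: idiv)
    qed
  qed
  have Y_distr: "distr (iid p) borel (Y q j) = distr (iid p) borel (Y q 0)" for q j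
  proof -
    let ?s = "int (j * q)"
    have gs: "g q (i + j * q) z = g q i (shift ?s z)" if "i \<in> {0..<q}" for i z
    proof -
      have "(i + j * q) div q = j" by (rule idiv) (use that in auto)
      moreover have "i div q = 0" by (rule idiv) (use that in auto)
      ultimately show ?thesis
        \<comment> \<open>The shift by \<open>j * q\<close> carries the mask of block j to the mask
          of block 0.\<close>
        unfolding g_def f_def by (auto intro!: arg_cong[of _ _ F] simp: mask_def bl_def fun_eq_iff algebra_simps)
    qed
    have ge: "P.expectation (g q (i + j * q)) = P.expectation (g q i)" if "i \<in> {0..<q}" for i
    proof -
      have "g q (i + j * q) = (\<lambda>z. g q i (shift ?s z))"
        by (rule ext) (rule gs[OF that])
      then have "P.expectation (g q (i + j * q)) = (\<integral>z. g q i (shift ?s z) \<partial>iid p)"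
        by (rule arg_cong)
      also have "\<dots> = P.expectation (g q i)" by (rule integral_iid_reindex[OF inj_add_int]) measurable
      finally show ?thesis .
    qed
    have "Y q j z = Y q 0 (shift ?s z)" for z
    proof -
      have "Y q j z = (\<Sum>i = 0 + j * q..<q + j * q. g q i z - P.expectation (g q i))"
        by (simp add: Y_def add.commute)
      also have "\<dots> = (\<Sum>i = 0..<q. g q (i + j * q) z - P.expectation (g q (i + j * q)))"
        by (rule sum.shift_bounds_nat_ivl)
      also have "\<dots> = Y q 0 (shift ?s z)"
        unfolding Y_def by (simp only: mult_0 add_0) (intro sum.cong refl, simp only: gs ge)
      finally show ?thesis .
    qed
    then have "distr (iid p) borel (Y q j) = distr (iid p) borel (Y q 0 \<circ> shift ?s)"
      by (intro distr_cong) auto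
    also have "\<dots> = distr (distr (iid p) (iid p) (shift ?s)) borel (Y q 0)"
      by (rule distr_distr[symmetric]) (simp_all add: Y_def[abs_def] measurable_iid_reindex)
    also have "\<dots> = distr (iid p) borel (Y q 0)"
      by (simp only: distr_iid_reindex[OF inj_add_int])
    finally show ?thesis .
  qed
  \<comment> \<open>Dominates both covariance constants of the errors \<open>d i\<close>, which are
    localized with constant \<open>C + C\<close>: the decaying bound and the masking bound.\<close>
  define C1 where "C1 = (C + C) * (C + C) * Kc + C * (C + C) * (\<kappa> * (1 + M 1))"
  have C1: "(C + C) * (C + C) * Kc \<le> C1" "C * (C + C) * (\<kappa> * (1 + M 1)) \<le> C1" "0 \<le> C1"
    using C Kc_pos \<kappa>_nonneg M_ge_1[of 1] by (auto simp: C1_def intro!: add_nonneg_nonneg mult_nonneg_nonneg)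
  have approx: "P.expectation (\<lambda>z. (S n z - (\<Sum>j<n div q. Y q j z))\<^sup>2) \<le> real n * (C1 * (\<Psi> q / real q)) + C1 * real q"
    if q: "0 < q" for q n
  proof -
    define m where "m = n div q"
    \<comment> \<open>Terms beyond the last full block have no partner in any Y. The empty mask
      makes their approximation constant, so after centering \<open>d i\<close> is
      \<open>f i\<close> itself and the leftover needs no separate estimate.\<close>
    define B where "B i = (if i < m * q then bl q (i div q) else {})" for i
    define d where "d i z = f i z - f i (mask (B i) z)" for i z
    define t where "t i = tail (int i) (- B i)" for i
    have d: "Loc (C + C) (int i) (d i)" for i
      unfolding d_def[abs_def] by (rule Loc_diff[OF f Loc_mask[OF f]])
    have t0: "0 \<le> t i" for i by (simp add: t_def tail_nonneg)
    have mn: "m * q \<le> n" unfolding m_def by simp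
    have nm: "n \<le> m * q + q" unfolding m_def
      using div_mult_mod_eq[of n q] mod_less_divisor[OF q, of n] by linarith
    have d_mean: "d i z - P.expectation (d i) = f i z - (if i < m * q then g q i z - P.expectation (g q i) else 0)" for i z
    proof (cases "i < m * q")
      case True
      then have "d i = (\<lambda>z. f i z - g q i z)" by (simp add: d_def g_def B_def fun_eq_iff)
      then show ?thesis
        using True Loc_integrable[OF f] Loc_integrable[OF g] f_mean by simp
    next
      case False
      then have "d i = (\<lambda>z. f i z - f i (\<lambda>_. 0))" by (simp add: d_def B_def mask_def fun_eq_iff)
      then show ?thesis
        using False Loc_integrable[OF f] f_mean by (simp add: P1)
    qed
    have "S n z - (\<Sum>j<m. Y q j z) = (\<Sum>i<n. d i z - P.expectation (d i))" for z
    proof -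
      have "{..<n} \<inter> {i. i < m * q} = {..<m * q}" using mn by auto
      then show ?thesis
        unfolding d_mean S_def Y_sum by (simp add: sum_subtractf sum.If_cases)
    qed
    then have "P.expectation (\<lambda>z. (S n z - (\<Sum>j<m. Y q j z))\<^sup>2) = (\<Sum>i<n. \<Sum>j<n.
        P.expectation (\<lambda>z. d i z * d j z) - P.expectation (d i) * P.expectation (d j))"
      by (simp only:) (intro P.expectation_centered_sum_squared Loc_integrable[OF d] Loc_mult_integrable[OF d d])
    \<comment> \<open>Each covariance obeys both bounds; only their minimum is small and summable in
      j.\<close>
    also have "\<dots> \<le> (\<Sum>i<n. \<Sum>j<n. C1 * min (t i) (a (int i - int j)))"
    proof (intro sum_mono)
      fix i j
      have "P.expectation (\<lambda>z. d i z * d j z) - P.expectation (d i) * P.expectation (d j) \<le> C1 * a (int i - int j)"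
        by (rule order_trans[OF cov_a[OF d] mult_right_mono[OF C1(1) a_nonneg]])
      moreover have "P.expectation (\<lambda>z. d i z * d j z) - P.expectation (d i) * P.expectation (d j) \<le> C1 * t i"
      proof -
        have "d i = (\<lambda>z. f i z - f i (mask (B i) z))" by (simp add: d_def fun_eq_iff)
        from Loc_mask_covariance[OF f d this, of j]
        have "P.expectation (\<lambda>z. d i z * d j z) - P.expectation (d i) * P.expectation (d j)
            \<le> C * (C + C) * (\<kappa> * (1 + M 1)) * t i"
          unfolding t_def by linarith
        also have "\<dots> \<le> C1 * t i" by (intro mult_right_mono C1 t0)
        finally show ?thesis .
      qed
      ultimately show "P.expectation (\<lambda>z. d i z * d j z) - P.expectation (d i) * P.expectation (d j)
          \<le> C1 * min (t i) (a (int i - int j))"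
        by (simp add: min_def)
    qed
    also have "\<dots> = (\<Sum>i<n. C1 * (\<Sum>j<n. min (t i) (a (int i - int j))))"
      by (simp add: sum_distrib_left)
    also have "\<dots> \<le> (\<Sum>i<n. C1 * \<psi> (t i))"
      by (intro sum_mono mult_left_mono sum_min_le_\<psi> t0 C1)
    also have "\<dots> = C1 * ((\<Sum>i<m * q. \<psi> (t i)) + (\<Sum>i = m * q..<n. \<psi> (t i)))"
      using mn by (simp add: lessThan_atLeast0 sum.atLeastLessThan_concat flip: sum_distrib_left)
    \<comment> \<open>By translation every full block contributes \<open>\<Psi> q\<close>, and there
      are at most \<open>n / q\<close> of them; the at most q leftover terms contribute at most 1
      each.\<close>
    also have "\<dots> \<le> C1 * (real n * (\<Psi> q / real q) + real q)"
    proof (intro mult_left_mono add_mono C1)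
      have "(\<Sum>i<m * q. \<psi> (t i)) = (\<Sum>j<m. \<Sum>i = j * q..<j * q + q. \<psi> (t i))"
        by (rule sum.nat_group[symmetric])
      also have "\<dots> = (\<Sum>j<m. \<Psi> q)"
      proof (intro sum.cong refl)
        fix j assume j: "j \<in> {..<m}"
        have "(\<Sum>i = j * q..<j * q + q. \<psi> (t i)) = (\<Sum>i = 0 + j * q..<q + j * q. \<psi> (t i))"
          by (simp add: add.commute)
        also have "\<dots> = (\<Sum>r = 0..<q. \<psi> (t (r + j * q)))" by (rule sum.shift_bounds_nat_ivl)
        also have "\<dots> = \<Psi> q"
          unfolding \<Psi>_def lessThan_atLeast0
        proof (intro sum.cong refl arg_cong[of _ _ \<psi>])
          fix r assume r: "r \<in> {0..<q}"
          have "r + j * q \<in> {j * q..<j * q + q}" using r by auto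
          then have div: "(r + j * q) div q = j" by (rule idiv)
          have "Suc j * q \<le> m * q" using j by (intro mult_le_mono1) auto
          then have "r + j * q < m * q" using r by auto
          then have "t (r + j * q) = tail (int r + int (j * q)) (- bl q j)"
            unfolding t_def B_def by (simp add: div)
          also have "\<dots> = tail (int r) ((\<lambda>k. k - int (j * q)) ` (- bl q j))" by (rule tail_shift[symmetric])
          also have "(\<lambda>k. k - int (j * q)) ` (- bl q j) = - {0..<int q}"
          proof (intro set_eqI iffI)
            fix k assume "k \<in> - {0..<int q}"
            then have "k + int (j * q) \<in> - bl q j" by (auto simp: bl_def)
            then show "k \<in> (\<lambda>k. k - int (j * q)) ` (- bl q j)" by (rule image_eqI[rotated]) simp
          qed (auto simp: bl_def)
          finally show "t (r + j * q) = tail (int r) (- {0..<int q})" .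
        qed
        finally show "(\<Sum>i = j * q..<j * q + q. \<psi> (t i)) = \<Psi> q" .
      qed
      also have "\<dots> = real m * real q * (\<Psi> q / real q)" using q by simp
      also have "\<dots> \<le> real n * (\<Psi> q / real q)"
      proof (rule mult_right_mono)
        show "real m * real q \<le> real n" using mn by (metis of_nat_le_iff of_nat_mult)
        show "0 \<le> \<Psi> q / real q" by (simp add: \<Psi>_def sum_nonneg \<psi>_nonneg tail_nonneg)
      qed
      finally show "(\<Sum>i<m * q. \<psi> (t i)) \<le> real n * (\<Psi> q / real q)" .
      have "(\<Sum>i = m * q..<n. \<psi> (t i)) \<le> (\<Sum>i = m * q..<n. 1)"
        by (intro sum_mono \<psi>_le_1 t0)
      also have "\<dots> \<le> real q" using nm by simp
      finally show "(\<Sum>i = m * q..<n. \<psi> (t i)) \<le> real q" .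
    qed
    finally show ?thesis by (simp add: m_def algebra_simps)
  qed
  have S_sq: "integrable (iid p) (\<lambda>z. (S n z)\<^sup>2)" for n
    using P.expectation_centered_sum_squared(1)[OF Loc_integrable[OF f] Loc_mult_integrable[OF f f], of "\<lambda>i. i" "{..<n}"]
    by (simp add: f_mean S_def)
  have lim: "(\<lambda>q. C1 * (\<Psi> q / real q)) \<longlonglongrightarrow> 0"
    using tendsto_mult_left[OF \<Psi>_LIMSEQ, of C1] by simp
  have S_meas: "S n \<in> borel_measurable (iid p)" for n unfolding S_def[abs_def] by measurable
  obtain \<sigma> where "0 \<le> \<sigma>" "weak_conv_m (\<lambda>n. distr (iid p) borel (\<lambda>z. S n z / sqrt (real n))) (centered_normal \<sigma>)"
    by (rule P.central_limit_by_blocks[OF S_meas S_sq Y_indep Y_distr Y_sq Y_mean Y_bound approx lim])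
  then show ?thesis using that by (simp add: S_def f_def)
qed

end

section \<open>Growth of functions with a converging Taylor series\<close>

lemma multilinear_zero:
  assumes "multilinear_form k L" "length hs1 + length hs2 + 1 = k"
  shows "L (hs1 @ 0 # hs2) = 0"
  using assms(1)[unfolded multilinear_form_def, rule_format, OF assms(2), of 1 0 0] by simp

lemma multilinear_scaleR:
  assumes "multilinear_form k L" "length hs1 + length hs2 + 1 = k"
  shows "L (hs1 @ (r *\<^sub>R x) # hs2) = r * L (hs1 @ x # hs2)"
  using assms(1)[unfolded multilinear_form_def, rule_format, OF assms(2), of r x 0]
    multilinear_zero[OF assms] by simp

lemma multilinear_diff:
  assumes "multilinear_form k L" "length hs1 + length hs2 + 1 = k"
  shows "L (hs1 @ x # hs2) - L (hs1 @ y # hs2) = L (hs1 @ (x - y) # hs2)"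
  using assms(1)[unfolded multilinear_form_def, rule_format, OF assms(2), of 1 "x - y" y] by simp

text \<open>The prefix \<open>hs1\<close> collects the arguments whose scalars have already been
  taken out. With g the norm and q the function \<open>sgn\<close>, this normalizes all arguments at
  once.\<close>

lemma multilinear_scale_all:
  assumes "multilinear_form k L"
  shows "length hs1 + length hs2 = k \<Longrightarrow>
    L (hs1 @ map (\<lambda>h. g h *\<^sub>R q h) hs2) = (\<Prod>h\<leftarrow>hs2. g h) * L (hs1 @ map q hs2)"
proof (induction hs2 arbitrary: hs1)
  case (Cons h hs2)
  have "L (hs1 @ map (\<lambda>h. g h *\<^sub>R q h) (h # hs2)) = g h * L ((hs1 @ [q h]) @ map (\<lambda>h. g h *\<^sub>R q h) hs2)"
    using multilinear_scaleR[OF assms, of hs1 "map (\<lambda>h. g h *\<^sub>R q h) hs2" "g h" "q h"] Cons.prems by simp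
  also have "\<dots> = g h * ((\<Prod>h\<leftarrow>hs2. g h) * L ((hs1 @ [q h]) @ map q hs2))"
    using Cons.prems by (subst Cons.IH) simp_all
  finally show ?case by simp
qed simp

lemma
  assumes "bounded_multilinear_form k L"
  shows mnorm_nonneg: "0 \<le> mnorm k L"
    and multilinear_le_mnorm: "length hs = k \<Longrightarrow> \<bar>L hs\<bar> \<le> mnorm k L * (\<Prod>h\<leftarrow>hs. norm h)"
proof -
  let ?A = "{\<bar>L hs\<bar> | hs. length hs = k \<and> (\<forall>h\<in>set hs. norm h \<le> 1)}"
  obtain C where ml: "multilinear_form k L" and C: "\<And>hs. length hs = k \<Longrightarrow> \<bar>L hs\<bar> \<le> C * (\<Prod>h\<leftarrow>hs. norm h)"
    using assms unfolding bounded_multilinear_form_def by blast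
  have prod_le: "0 \<le> (\<Prod>h\<leftarrow>hs. norm h) \<and> (\<Prod>h\<leftarrow>hs. norm h) \<le> 1" if "\<forall>h\<in>set hs. norm h \<le> 1" for hs :: "'a list"
    using that by (induction hs) (auto intro: mult_le_one)
  have "bdd_above ?A"
  proof (rule bdd_aboveI[of _ "\<bar>C\<bar>"])
    fix x assume "x \<in> ?A"
    then obtain hs where hs: "x = \<bar>L hs\<bar>" "length hs = k" "\<forall>h\<in>set hs. norm h \<le> 1" by blast
    have "x \<le> C * (\<Prod>h\<leftarrow>hs. norm h)" using C hs by simp
    also have "\<dots> \<le> \<bar>C\<bar> * 1" using prod_le[OF hs(3)] by (intro mult_mono) auto
    finally show "x \<le> \<bar>C\<bar>" by simp
  qed
  then have le: "\<bar>L hs\<bar> \<le> mnorm k L" if "length hs = k" "\<forall>h\<in>set hs. norm h \<le> 1" for hs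
    unfolding mnorm_def using that by (intro cSup_upper) auto
  have "\<bar>L (replicate k 0)\<bar> \<le> mnorm k L" by (intro le) auto
  then show "0 \<le> mnorm k L" by (rule order_trans[OF abs_ge_zero])
  \<comment> \<open>True also at 0, where \<open>sgn\<close> is 0; thus vanishing arguments need no
    separate case.\<close>
  have nsgn: "norm h *\<^sub>R sgn h = h" for h :: 'a by (cases "h = 0") (simp_all add: sgn_div_norm)
  assume len: "length hs = k"
  have "L hs = L ([] @ map (\<lambda>h. norm h *\<^sub>R sgn h) hs)" by (simp add: nsgn)
  also have "\<dots> = (\<Prod>h\<leftarrow>hs. norm h) * L (map sgn hs)"
    using len by (subst multilinear_scale_all[OF ml]) simp_all
  finally have "\<bar>L hs\<bar> = \<bar>\<Prod>h\<leftarrow>hs. norm h\<bar> * \<bar>L (map sgn hs)\<bar>" by (simp add: abs_mult)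
  also have "\<bar>\<Prod>h\<leftarrow>hs. norm h\<bar> = (\<Prod>h\<leftarrow>hs. norm h)" by (induction hs) (auto simp: abs_mult)
  also have "(\<Prod>h\<leftarrow>hs. norm h) * \<bar>L (map sgn hs)\<bar> \<le> (\<Prod>h\<leftarrow>hs. norm h) * mnorm k L"
  proof (rule mult_left_mono)
    show "\<bar>L (map sgn hs)\<bar> \<le> mnorm k L" using len by (intro le) (auto simp: norm_sgn)
    show "0 \<le> (\<Prod>h\<leftarrow>hs. norm h)" by (induction hs) auto
  qed
  finally show "\<bar>L hs\<bar> \<le> mnorm k L * (\<Prod>h\<leftarrow>hs. norm h)" by (simp add: mult.commute)
qed

text \<open>Exchanging y for x one position at a time gives k steps, and in each of them the form
  takes \<open>x - y\<close> in one slot.\<close>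

lemma multilinear_replicate_diff:
  fixes x y :: "'a::real_normed_vector"
  assumes L: "multilinear_form k L" and B: "\<And>hs. length hs = k \<Longrightarrow> \<bar>L hs\<bar> \<le> B * (\<Prod>h\<leftarrow>hs. norm h)"
    and B0: "0 \<le> B" and m: "norm x \<le> m" "norm y \<le> m"
  shows "\<bar>L (replicate k x) - L (replicate k y)\<bar> \<le> real k * (B * norm (x - y) * m ^ (k - 1))"
proof -
  have "\<bar>L (replicate j x @ replicate (k - j) y) - L (replicate k y)\<bar> \<le> real j * (B * norm (x - y) * m ^ (k - 1))"
    if "j \<le> k" for j
    using that
  proof (induction j)
    case (Suc j)
    let ?r = "replicate (k - Suc j) y"
    have len: "length (replicate j x) + length ?r + 1 = k" using Suc.prems by simp
    have "replicate (k - j) y = y # ?r" using Suc.prems by (metis Suc_diff_Suc Suc_le_lessD replicate_Suc)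
    then have "L (replicate (Suc j) x @ ?r) - L (replicate j x @ replicate (k - j) y) = L (replicate j x @ (x - y) # ?r)"
      using multilinear_diff[OF L len, of x y] by (simp add: replicate_app_Cons_same)
    moreover have "\<bar>L (replicate j x @ (x - y) # ?r)\<bar> \<le> B * norm (x - y) * m ^ (k - 1)"
    proof -
      have "\<bar>L (replicate j x @ (x - y) # ?r)\<bar> \<le> B * (norm x ^ j * (norm (x - y) * norm y ^ (k - Suc j)))"
        using B[of "replicate j x @ (x - y) # ?r"] len by (simp add: prod_list_replicate)
      also have "\<dots> \<le> B * (m ^ j * (norm (x - y) * m ^ (k - Suc j)))"
        using m order_trans[OF norm_ge_zero m(1)]
        by (intro mult_left_mono mult_mono power_mono B0) auto
      also have "\<dots> = B * norm (x - y) * m ^ (j + (k - Suc j))" by (simp add: power_add mult_ac)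
      also have "j + (k - Suc j) = k - 1" using Suc.prems by simp
      finally show ?thesis .
    qed
    moreover have "\<bar>L (replicate j x @ replicate (k - j) y) - L (replicate k y)\<bar> \<le> real j * (B * norm (x - y) * m ^ (k - 1))"
      using Suc by simp
    moreover have "real (Suc j) * (B * norm (x - y) * m ^ (k - 1)) =
        B * norm (x - y) * m ^ (k - 1) + real j * (B * norm (x - y) * m ^ (k - 1))"
      by (simp add: distrib_right)
    ultimately show ?case by linarith
  qed simp
  from this[of k] show ?thesis by simp
qed

text \<open>As \<open>\<omega> k ^ k\<close> is at least 1, one constant bounds the norms of all
  derivatives at 0, and the Taylor series is dominated by that of the exponential. For increments,
  the factor k of \<open>multilinear_replicate_diff\<close> turns \<open>1 / fact k\<close> into
  \<open>1 / fact (k - 1)\<close>, again an exponential series.\<close>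

lemma E_omega_bounds:
  fixes f :: "'a::real_normed_vector \<Rightarrow> real"
  assumes \<omega>: "\<forall>k. 1 < \<omega> k" and f: "f \<in> E_omega \<omega>"
  obtains C where "0 \<le> C" "\<And>x. \<bar>f x\<bar> \<le> C * exp (norm x)"
    "\<And>x y. \<bar>f x - f y\<bar> \<le> C * (norm (x - y) * exp (norm x + norm y))"
proof -
  obtain Df C where Df: "inf_frechet_at0 f Df"
    and sums: "\<And>x. (\<lambda>k. Df k 0 (replicate k x) / fact k) sums f x"
    and C: "\<And>k. mnorm k (Df k 0) * \<omega> k ^ k \<le> C"
    using f unfolding E_omega_def by blast
  have bml: "bounded_multilinear_form k (Df k 0)" for k
  proof -
    have "\<forall>\<^sub>F x in nhds 0. (\<forall>j\<le>k. bounded_multilinear_form j (Df j x)) \<and> (\<forall>j<k. has_mderiv_at Df j x)"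
      using Df unfolding inf_frechet_at0_def by blast
    from eventually_nhds_x_imp_x[OF this] show ?thesis by blast
  qed
  then have ml: "multilinear_form k (Df k 0)" for k unfolding bounded_multilinear_form_def by blast
  have mnorm_le: "mnorm k (Df k 0) \<le> C" for k
  proof -
    have "1 \<le> \<omega> k ^ k" using \<omega> by (intro one_le_power less_imp_le) blast
    then have "mnorm k (Df k 0) * 1 \<le> mnorm k (Df k 0) * \<omega> k ^ k"
      by (rule mult_left_mono) (rule mnorm_nonneg[OF bml])
    with C[of k] show ?thesis by simp
  qed
  have C0: "0 \<le> C" using mnorm_nonneg[OF bml[of 0]] mnorm_le[of 0] by linarith
  have bound: "\<bar>Df k 0 hs\<bar> \<le> C * (\<Prod>h\<leftarrow>hs. norm h)" if "length hs = k" for k hs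
  proof -
    have "0 \<le> (\<Prod>h\<leftarrow>hs. norm h)" by (induction hs) auto
    then show ?thesis
      using multilinear_le_mnorm[OF bml that] mult_right_mono[OF mnorm_le, of "\<Prod>h\<leftarrow>hs. norm h" k] by linarith
  qed
  have exp_sums: "(\<lambda>k. m ^ k / fact k) sums exp m" for m :: real
    using exp_converges[of m] by (simp add: divide_inverse mult.commute)
  have 1: "\<bar>f x\<bar> \<le> C * exp (norm x)" for x
  proof -
    have g: "(\<lambda>k. C * (norm x ^ k / fact k)) sums (C * exp (norm x))"
      by (intro sums_mult exp_sums)
    have "norm (\<Sum>k. Df k 0 (replicate k x) / fact k) \<le> (\<Sum>k. C * (norm x ^ k / fact k))"
    proof (rule norm_suminf_le)
      show "norm (Df k 0 (replicate k x) / fact k) \<le> C * (norm x ^ k / fact k)" for k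
        using divide_right_mono[OF bound[of "replicate k x" k], of "fact k"] by (simp add: prod_list_replicate)
      show "summable (\<lambda>k. C * (norm x ^ k / fact k))" by (rule sums_summable[OF g])
    qed
    then show ?thesis using sums_unique[OF sums[of x]] sums_unique[OF g] by simp
  qed
  have 2: "\<bar>f x - f y\<bar> \<le> C * (norm (x - y) * exp (norm x + norm y))" for x y
  proof -
    define m where "m = norm x + norm y"
    \<comment> \<open>The constant terms cancel, so k = 0 contributes 0; without the case
      distinction, truncated subtraction would give 1 there.\<close>
    let ?g = "\<lambda>k. C * norm (x - y) * (if k = 0 then 0 else m ^ (k - 1) / fact (k - 1))"
    have "(\<lambda>k. if k = 0 then 0 else m ^ (k - 1) / fact (k - 1)) sums (exp m + 0)"
      using exp_sums[of m] sums_Suc[of "\<lambda>k. if k = 0 then 0 else m ^ (k - 1) / fact (k - 1)"] by simp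
    then have g: "?g sums (C * norm (x - y) * exp m)"
      by (intro sums_mult) simp
    have d: "(\<lambda>k. Df k 0 (replicate k x) / fact k - Df k 0 (replicate k y) / fact k) sums (f x - f y)"
      by (intro sums_diff sums)
    have "norm (\<Sum>k. Df k 0 (replicate k x) / fact k - Df k 0 (replicate k y) / fact k) \<le> (\<Sum>k. ?g k)"
    proof (rule norm_suminf_le)
      fix k
      show "norm (Df k 0 (replicate k x) / fact k - Df k 0 (replicate k y) / fact k) \<le> ?g k"
      proof (cases k)
        case (Suc n)
        have "\<bar>Df k 0 (replicate k x) - Df k 0 (replicate k y)\<bar> \<le> real k * (C * norm (x - y) * m ^ (k - 1))"
          by (intro multilinear_replicate_diff[OF ml bound C0]) (auto simp: m_def)
        then have "\<bar>Df k 0 (replicate k x) - Df k 0 (replicate k y)\<bar> / fact k \<le> real k * (C * norm (x - y) * m ^ (k - 1)) / fact k"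
          by (rule divide_right_mono) simp
        also have "\<dots> = ?g k" unfolding Suc by (simp add: field_simps del: of_nat_Suc)
        finally show ?thesis by (simp add: abs_divide flip: diff_divide_distrib)
      qed simp
      show "summable ?g" by (rule sums_summable[OF g])
    qed
    then show ?thesis using sums_unique[OF d] sums_unique[OF g] by (simp add: m_def mult.assoc)
  qed
  show ?thesis by (rule that[OF C0 1 2])
qed

section \<open>Random series\<close>

lemma has_sum_norm_le:
  fixes f :: "int \<Rightarrow> 'b::banach"
  assumes f: "(f has_sum s) UNIV" and g: "(g has_sum t) UNIV" and le: "\<And>k. norm (f k) \<le> g k"
  shows "norm s \<le> t"
proof (rule tendsto_le[OF finite_subsets_at_top_neq_bot])
  show "(sum g \<longlongrightarrow> t) (finite_subsets_at_top UNIV)" using g by (simp add: has_sum_def)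
  show "((\<lambda>A. norm (sum f A)) \<longlongrightarrow> norm s) (finite_subsets_at_top UNIV)"
    using f by (intro tendsto_norm) (simp add: has_sum_def)
  show "\<forall>\<^sub>F A in finite_subsets_at_top UNIV. norm (sum f A) \<le> sum g A"
    using le by (intro always_eventually allI sum_norm_le) auto
qed

lemma measure_iid_coordinates_pos:
  fixes e :: "'i \<Rightarrow> nat"
  assumes p: "\<And>l. 0 < pmf p l" and J: "finite J"
  shows "0 < measure (iid p) {z. \<forall>k\<in>J. z k = e k}"
    and "{z. \<forall>k\<in>J. z k = e k} \<in> sets (iid p)"
proof -
  interpret prob_space "iid p :: ('i \<Rightarrow> nat) measure" by (rule prob_space_iid)
  have single: "{z. z k = e k} \<in> events" "prob {z. z k = e k} = pmf p (e k)" for k :: 'i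
  proof -
    have eq: "{z. z k = e k} = (\<lambda>z. z k) -` {e k} \<inter> space (iid p)" by auto
    show "{z. z k = e k} \<in> events"
      unfolding eq by (rule measurable_sets[OF measurable_iid_component[of k p p]]) simp
    have "measure (measure_pmf p) {e k} = prob ((\<lambda>z. z k) -` {e k} \<inter> space (iid p))"
      by (subst distr_iid_component[of p k, symmetric]) (rule measure_distr, simp_all)
    then show "prob {z. z k = e k} = pmf p (e k)"
      unfolding eq by (simp add: pmf.rep_eq)
  qed
  have "{z. \<forall>k\<in>J. z k = e k} \<in> events \<and> 0 < prob {z. \<forall>k\<in>J. z k = e k}"
    using J
  proof (induction J)
    case empty
    show ?case using prob_space sets.top[of "iid p"] by simp
  next
    case (insert k J)
    have eq: "{z. \<forall>j\<in>insert k J. z j = e j} = {z. z k = e k} \<inter> {z. \<forall>j\<in>J. z j = e j}" by auto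
    have "prob ({z. z k = e k} \<inter> {z. \<forall>j\<in>J. z j = e j}) = prob {z. z k = e k} * prob {z. \<forall>j\<in>J. z j = e j}"
    proof (rule measure_iid_Int)
      show "{k} \<inter> J = {}" using insert by simp
      show "depends_on {k} (\<lambda>z. z \<in> {z. z k = e k})" by (rule depends_onI) simp
      show "depends_on J (\<lambda>z. z \<in> {z. \<forall>j\<in>J. z j = e j})" by (rule depends_onI) simp
    qed (use insert single in auto)
    then show ?case unfolding eq using insert single p by (auto intro!: sets.Int)
  qed
  then show "0 < measure (iid p) {z. \<forall>k\<in>J. z k = e k}" "{z. \<forall>k\<in>J. z k = e k} \<in> sets (iid p)" by auto
qed

text \<open>\<open>T_v\<close> is what turns the shift of indices into T. Density is asked only of
  the vectors at time 0, since full support comes from sequences whose nearby terms vanish at every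
  other time.\<close>

locale random_series = summable_weights p c a K
  for p :: "nat pmf" and c :: "nat \<Rightarrow> real" and a :: "int \<Rightarrow> real" and K :: real +
  fixes T :: "'a::{banach, second_countable_topology} \<Rightarrow> 'a" and v :: "int \<Rightarrow> nat \<Rightarrow> 'a"
  assumes T: "bounded_linear T" and T_v: "T (v k l) = v (k - 1) l"
    and v_bound: "norm (v k l) \<le> a k * c l"
    and p_pos: "0 < pmf p l" and v_dense: "closure (range (v 0)) = UNIV"
begin

definition X :: "(int \<Rightarrow> nat) \<Rightarrow> 'a" where "X z = rsum (\<lambda>k. v k (z k))"

definition \<mu> :: "'a measure" where "\<mu> = distr (iid p) borel X"

lemma measurable_X [measurable]: "X \<in> iid p \<rightarrow>\<^sub>M borel"
  unfolding X_def[abs_def] by measurable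

lemma X_has_sum:
  assumes "good z"
  shows "((\<lambda>k. v k (z k)) has_sum X z) UNIV"
  unfolding X_def
proof (rule has_sum_rsum, rule summable_on_comparison)
  show "(\<lambda>k. a k * c (z k)) summable_on UNIV" using good_c_summable[OF assms, of 0] by simp
qed (auto simp: v_bound)

lemma norm_X_le: "good z \<Longrightarrow> norm (X z) \<le> R 0 z"
  by (rule has_sum_norm_le[OF X_has_sum R_has_sum]) (simp_all add: v_bound)

lemma norm_X_diff_le:
  assumes good: "good z" "good z'" and J: "\<And>k. k \<notin> J \<Longrightarrow> z k = z' k"
  shows "norm (X z - X z') \<le> Z 0 J z z'"
proof (rule has_sum_norm_le[OF _ Z_has_sum[OF good]])
  have "((\<lambda>k. v k (z k) + - v k (z' k)) has_sum X z + - X z') UNIV"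
    using X_has_sum[OF good(2)] by (intro has_sum_add X_has_sum good) (simp add: has_sum_uminus)
  then show "((\<lambda>k. v k (z k) - v k (z' k)) has_sum X z - X z') UNIV" by simp
  fix k
  have "norm (v k (z k) - v k (z' k)) \<le> a k * c (z k) + a k * c (z' k)"
    by (rule order_trans[OF norm_triangle_ineq4 add_mono[OF v_bound v_bound]])
  then show "norm (v k (z k) - v k (z' k)) \<le> wt 0 J k * (c (z k) + c (z' k))"
    using J[of k] by (auto simp: wt_def distrib_left)
qed

lemma X_shift_1:
  assumes "good z"
  shows "X (shift 1 z) = T (X z)"
proof -
  have "((\<lambda>k. T (v k (z k))) has_sum T (X z)) UNIV"
    using has_sum_bounded_linear[OF T X_has_sum[OF assms]] by (simp add: comp_def)
  from has_sum_int_shift[OF this, of 1] have "((\<lambda>k. v k (z (k + 1))) has_sum T (X z)) UNIV"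
    by (simp add: T_v)
  then show ?thesis using has_sum_unique[OF X_has_sum[OF good_shift[OF assms]]] by blast
qed

lemma X_shift: "good z \<Longrightarrow> X (shift (int n) z) = (T ^^ n) (X z)"
proof (induction n)
  case (Suc n)
  have "X (shift (int (Suc n)) z) = X (shift 1 (shift (int n) z))" by (simp add: add_ac)
  also have "\<dots> = T (X (shift (int n) z))" by (rule X_shift_1[OF good_shift[OF Suc.prems]])
  finally show ?case using Suc by simp
qed simp

lemma T_pow_measurable [measurable]: "T ^^ n \<in> borel_measurable borel"
proof (induction n)
  case (Suc n)
  have [measurable]: "T \<in> borel_measurable borel"
    using linear_continuous_on[OF T] by (intro borel_measurable_continuous_onI)
  from Suc have [measurable]: "T ^^ n \<in> borel_measurable borel" .
  show ?case by (simp add: comp_def)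
qed (simp add: id_def)

section \<open>Invariance, mixing and support of the law of the series\<close>

lemma prob_space_\<mu>: "prob_space \<mu>"
  unfolding \<mu>_def by (rule prob_space.prob_space_distr[OF prob_space_iid measurable_X])

lemma sets_\<mu> [simp, measurable_cong]: "sets \<mu> = sets borel"
  by (simp add: \<mu>_def)

lemma X_vimage_sets: "A \<in> sets borel \<Longrightarrow> {z. X z \<in> A} \<in> sets (iid p)"
  using measurable_sets[OF measurable_X, of A] by (simp add: vimage_def)

lemma measure_\<mu>: "A \<in> sets borel \<Longrightarrow> measure \<mu> A = measure (iid p) {z. X z \<in> A}"
  unfolding \<mu>_def by (subst measure_distr) (simp_all add: vimage_def)

lemma integral_\<mu>:
  fixes f :: "'a \<Rightarrow> real"
  shows "f \<in> borel_measurable borel \<Longrightarrow> (\<integral>x. f x \<partial>\<mu>) = (\<integral>z. f (X z) \<partial>iid p)"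
  unfolding \<mu>_def by (rule integral_distr[OF measurable_X])

lemma T_pow_vimage_sets: "B \<in> sets borel \<Longrightarrow> (T ^^ n) -` B \<in> sets borel"
  using measurable_sets[OF T_pow_measurable, of B n] by simp

text \<open>Transfers the dynamics to the Bernoulli shift; invariance and mixing both follow from
  it. The events agree only almost everywhere, because X intertwines the shift with T only where the
  series converges.\<close>

lemma measure_\<mu>_Int_T_pow:
  assumes "A \<in> sets borel" "B \<in> sets borel"
  shows "measure \<mu> (A \<inter> (T ^^ n) -` B) =
    measure (iid p) ({z. X z \<in> A} \<inter> {z. shift (int n) z \<in> {z. X z \<in> B}})"
proof -
  interpret prob_space "iid p :: (int \<Rightarrow> nat) measure" by (rule prob_space_iid)
  have "measure \<mu> (A \<inter> (T ^^ n) -` B) = prob {z. X z \<in> A \<inter> (T ^^ n) -` B}"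
    using assms by (intro measure_\<mu> sets.Int T_pow_vimage_sets)
  also have "\<dots> = prob ({z. X z \<in> A} \<inter> {z. shift (int n) z \<in> {z. X z \<in> B}})"
  proof (rule finite_measure_eq_AE)
    show "AE z in iid p. (z \<in> {z. X z \<in> A \<inter> (T ^^ n) -` B}) =
        (z \<in> {z. X z \<in> A} \<inter> {z. shift (int n) z \<in> {z. X z \<in> B}})"
      using AE_good by eventually_elim (simp add: X_shift)
    show "{z. X z \<in> A \<inter> (T ^^ n) -` B} \<in> events"
      using assms by (intro X_vimage_sets sets.Int T_pow_vimage_sets)
    show "{z. X z \<in> A} \<inter> {z. shift (int n) z \<in> {z. X z \<in> B}} \<in> events"
      using assms by (intro sets.Int X_vimage_sets sets_iid_reindex)
  qed
  finally show ?thesis .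
qed

lemma \<mu>_invariant:
  assumes "A \<in> sets borel"
  shows "measure \<mu> (T -` A) = measure \<mu> A"
  using measure_\<mu>_Int_T_pow[of UNIV A 1] assms measure_iid_reindex[OF inj_add_int X_vimage_sets[OF assms], of 1]
  by (simp add: measure_\<mu>)

lemma \<mu>_strong_mixing:
  assumes "A \<in> sets borel" "B \<in> sets borel"
  shows "(\<lambda>n. measure \<mu> (A \<inter> (T ^^ n) -` B)) \<longlonglongrightarrow> measure \<mu> A * measure \<mu> B"
  unfolding measure_\<mu>_Int_T_pow[OF assms] measure_\<mu>[OF assms(1)] measure_\<mu>[OF assms(2)]
  by (rule iid_shift_strong_mixing[OF X_vimage_sets[OF assms(1)] X_vimage_sets[OF assms(2)]])

text \<open>On A the indices in a window are l at time 0 and 0 elsewhere; on B the terms off the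
  window add up to less than \<epsilon>. The two events see disjoint coordinates, so they are
  independent, both have positive probability, and on their intersection X is within \<epsilon> of
  \<open>v 0 l\<close>.\<close>

lemma \<mu>_full_support:
  assumes "open U" "U \<noteq> {}"
  shows "0 < measure \<mu> U"
proof -
  interpret prob_space "iid p :: (int \<Rightarrow> nat) measure" by (rule prob_space_iid)
  obtain l where l: "v 0 l \<in> U"
  proof -
    have "U \<inter> closure (range (v 0)) \<noteq> {}" using assms v_dense by simp
    then have "U \<inter> range (v 0) \<noteq> {}" using open_Int_closure_eq_empty[OF assms(1)] by blast
    then show ?thesis using that by blast
  qed
  obtain \<epsilon> where \<epsilon>: "0 < \<epsilon>" "ball (v 0 l) \<epsilon> \<subseteq> U"
    using assms(1) l open_contains_ball by blast
  \<comment> \<open>\<open>tail * M 1\<close> is the mean of the majorant of the outer terms. A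
    window that brings it below \<epsilon> lets Markov's inequality give B a positive
    probability.\<close>
  have "(\<lambda>N. tail 0 (- {- int N..int N}) * M 1) \<longlonglongrightarrow> 0 * M 1"
    by (intro tendsto_intros tail_compl_LIMSEQ)
  then have "\<forall>\<^sub>F N in sequentially. tail 0 (- {- int N..int N}) * M 1 < \<epsilon>"
    using \<epsilon> by (intro order_tendstoD) auto
  then obtain N where N: "tail 0 (- {- int N..int N}) * M 1 < \<epsilon>"
    by (auto simp: eventually_sequentially)
  define J where "J = {- int N..int N}"
  let ?V = "V (wt 0 (- J)) 1"
  define A where "A = {z. \<forall>k\<in>J. z k = (if k = 0 then l else 0)}"
  define B where "B = {z. ?V z < \<epsilon>}"
  have A: "0 < prob A" "A \<in> events"
    unfolding A_def by (rule measure_iid_coordinates_pos[OF p_pos]; simp add: J_def)+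
  have V_meas: "?V \<in> borel_measurable (iid p)" using integrable_V_wt by blast
  have V_nonneg: "AE z in iid p. 0 \<le> ?V z"
    using AE_good by eventually_elim (rule has_sum_nonneg[OF V_wt_has_sum], simp_all add: wt_bounds)
  have B_ev: "B \<in> events" using V_meas measurable_sets[of ?V "iid p" borel "{..<\<epsilon>}"] by (simp add: B_def vimage_def)
  have "prob {z. \<epsilon> \<le> ?V z} \<le> (\<integral>z. ?V z \<partial>iid p) / \<epsilon>"
    using integral_Markov_inequality_measure[OF integrable_V_wt sets.empty_sets V_nonneg \<epsilon>(1)] by simp
  also have "\<dots> < 1" using N \<epsilon>(1) by (simp add: integral_V_wt J_def)
  also have "{z. \<epsilon> \<le> ?V z} = space (iid p) - B" by (auto simp: B_def)
  finally have B: "0 < prob B" using prob_compl[OF B_ev] by simp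
  have "prob (A \<inter> B) = prob A * prob B"
  proof (rule measure_iid_Int[OF _ _ _ A(2) B_ev])
    show "J \<inter> - J = {}" by simp
    show "depends_on J (\<lambda>z. z \<in> A)" by (rule depends_onI) (simp add: A_def)
    show "depends_on (- J) (\<lambda>z. z \<in> B)"
    proof (rule depends_onI)
      fix z z' :: "int \<Rightarrow> nat" assume *: "\<And>i. i \<in> - J \<Longrightarrow> z i = z' i"
      have "?V z = ?V z'" unfolding V_def using * by (intro arg_cong[of _ _ rsum] ext) (simp add: wt_def)
      then show "(z \<in> B) = (z' \<in> B)" by (simp add: B_def)
    qed
  qed
  also have "\<dots> > 0" using A B by simp
  finally have "0 < prob (A \<inter> B)" .
  also have "prob (A \<inter> B) \<le> prob {z. X z \<in> U}"
  proof (rule finite_measure_mono_AE)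
    show "{z. X z \<in> U} \<in> events" using assms(1) by (intro X_vimage_sets) simp
    show "AE z in iid p. z \<in> A \<inter> B \<longrightarrow> z \<in> {z. X z \<in> U}"
      using AE_good
    proof eventually_elim
      case (elim z)
      show ?case
      proof
        assume z: "z \<in> A \<inter> B"
        have "norm (X z - v 0 l) \<le> ?V z"
        proof (rule has_sum_norm_le[OF _ V_wt_has_sum[OF elim]])
          have "((\<lambda>k. if k = 0 then v 0 l else 0) has_sum v 0 l) UNIV"
            by (rule has_sum_finite_neutralI[of "{0}"]) auto
          then have "((\<lambda>k. - (if k = 0 then v 0 l else 0)) has_sum - v 0 l) UNIV"
            by (subst has_sum_uminus) simp
          then have "((\<lambda>k. v k (z k) + - (if k = 0 then v 0 l else 0)) has_sum X z + - v 0 l) UNIV"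
            by (intro has_sum_add X_has_sum elim)
          then show "((\<lambda>k. v k (z k) - (if k = 0 then v 0 l else 0)) has_sum X z - v 0 l) UNIV" by simp
          fix k
          have v0: "v j 0 = 0" for j using v_bound[of j 0] by (simp add: c_0)
          show "norm (v k (z k) - (if k = 0 then v 0 l else 0)) \<le> wt 0 (- J) k * exp (real 1 * c (z k))"
          proof (cases "k \<in> J")
            case True
            then have "z k = (if k = 0 then l else 0)" using z by (auto simp: A_def)
            then show ?thesis by (auto simp: v0 wt_bounds)
          next
            case False
            then have "k \<noteq> 0" by (auto simp: J_def)
            then have "norm (v k (z k) - (if k = 0 then v 0 l else 0)) \<le> a k * c (z k)" by (simp add: v_bound)
            also have "\<dots> \<le> a k * exp (c (z k))"
              using exp_ge_add_one_self[of "c (z k)"] by (intro mult_left_mono a_nonneg) linarith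
            finally show ?thesis using False by (simp add: wt_def)
          qed
        qed
        also have "\<dots> < \<epsilon>" using z by (simp add: B_def)
        finally have "X z \<in> ball (v 0 l) \<epsilon>" by (simp add: dist_norm norm_minus_commute)
        then show "z \<in> {z. X z \<in> U}" using \<epsilon>(2) by blast
      qed
    qed
  qed
  also have "\<dots> = measure \<mu> U" using assms(1) by (intro measure_\<mu>[symmetric]) simp
  finally show ?thesis .
qed

section \<open>Observables with exponential growth\<close>

definition tame :: "real \<Rightarrow> ('a \<Rightarrow> real) \<Rightarrow> bool" where
  "tame C f \<longleftrightarrow> 0 \<le> C \<and> (\<forall>x. \<bar>f x\<bar> \<le> C * exp (norm x)) \<and>
    (\<forall>x y. \<bar>f x - f y\<bar> \<le> C * (norm (x - y) * exp (norm x + norm y)))"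

lemma tame_continuous:
  assumes "tame C f"
  shows "continuous_on UNIV f"
proof (rule continuous_at_imp_continuous_on, rule ballI)
  fix x :: 'a
  have "((\<lambda>y. C * (norm (y - x) * exp (norm y + norm x))) \<longlongrightarrow> C * (norm (x - x) * exp (norm x + norm x))) (at x)"
    by (intro tendsto_intros)
  then have "((\<lambda>y. C * (norm (y - x) * exp (norm y + norm x))) \<longlongrightarrow> 0) (at x)" by simp
  then have "((\<lambda>y. f y - f x) \<longlongrightarrow> 0) (at x)"
    by (rule Lim_null_comparison[rotated]) (use assms in \<open>simp add: tame_def\<close>)
  then show "isCont f x" unfolding isCont_def by (rule LIM_zero_cancel)
qed

lemma tame_measurable: "tame C f \<Longrightarrow> f \<in> borel_measurable borel"
  by (intro borel_measurable_continuous_onI tame_continuous)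

lemma tame_Loc:
  assumes f: "tame C f"
  shows "Loc C 0 (\<lambda>z. f (X z))"
  unfolding Loc_def
proof (intro conjI allI impI)
  show C: "0 \<le> C" using f by (simp add: tame_def)
  show "(\<lambda>z. f (X z)) \<in> borel_measurable (iid p)"
    by (rule measurable_compose[OF measurable_X tame_measurable[OF f]])
  show "\<bar>f (X z)\<bar> \<le> C * exp (R 0 z)" if "good z" for z
  proof -
    have "\<bar>f (X z)\<bar> \<le> C * exp (norm (X z))" using f by (simp add: tame_def)
    also have "\<dots> \<le> C * exp (R 0 z)" using norm_X_le[OF that] C by (intro mult_left_mono) auto
    finally show ?thesis .
  qed
  fix z z' J assume *: "good z" "good z'" "\<forall>k. k \<notin> J \<longrightarrow> z k = z' k"
  have "\<bar>f (X z) - f (X z')\<bar> \<le> C * (norm (X z - X z') * exp (norm (X z) + norm (X z')))"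
    using f by (simp add: tame_def)
  also have "\<dots> \<le> C * (Z 0 J z z' * exp (R 0 z + R 0 z'))"
    using * norm_X_le[of z] norm_X_le[of z']
    by (intro mult_left_mono mult_mono C norm_X_diff_le Z_nonneg) auto
  finally show "\<bar>f (X z) - f (X z')\<bar> \<le> C * (Z 0 J z z' * exp (R 0 z + R 0 z'))" .
qed

lemma tame_square_integrable:
  assumes f: "tame C f"
  shows "integrable \<mu> (\<lambda>x. (f x)\<^sup>2)"
proof -
  have "integrable (iid p) (\<lambda>z. f (X z) * f (X z))" by (rule Loc_mult_integrable[OF tame_Loc[OF f] tame_Loc[OF f]])
  then show ?thesis
    unfolding \<mu>_def using tame_measurable[OF f]
    by (subst integrable_distr_eq) (simp_all add: power2_eq_square)
qed

text \<open>Almost everywhere \<open>f\<close> composed with \<open>T ^^ n\<close> is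
  \<open>f (X z)\<close> read along the shifted sequence, hence localized at time n, while g is
  localized at time 0.\<close>

lemma tame_covariance:
  assumes f: "tame C f" and g: "tame C' g"
  shows "\<bar>Cov \<mu> (\<lambda>x. f ((T ^^ n) x)) g\<bar> \<le> C * C' * Kc * a (int n)"
proof -
  have [measurable]: "f \<in> borel_measurable borel" "g \<in> borel_measurable borel"
    using f g by (auto intro: tame_measurable)
  have [measurable]: "shift (int n) \<in> iid p \<rightarrow>\<^sub>M iid p" by (rule measurable_iid_reindex)
  have F: "Loc C (int n) (\<lambda>z. f (X (shift (int n) z)))"
    using Loc_shift[OF tame_Loc[OF f], of "int n"] by simp
  have [measurable]: "(\<lambda>z. f (X (shift (int n) z))) \<in> borel_measurable (iid p)"
    by (rule LocD(2)[OF F])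
  have "(\<integral>x. f ((T ^^ n) x) * g x \<partial>\<mu>) = (\<integral>z. f (X (shift (int n) z)) * g (X z) \<partial>iid p)"
    by (subst integral_\<mu>, measurable, rule integral_cong_AE, measurable)
      (rule AE_mp[OF AE_good], rule AE_I2, simp add: X_shift)
  moreover have "(\<integral>x. f ((T ^^ n) x) \<partial>\<mu>) = (\<integral>z. f (X (shift (int n) z)) \<partial>iid p)"
    by (subst integral_\<mu>, measurable, rule integral_cong_AE, measurable)
      (rule AE_mp[OF AE_good], rule AE_I2, simp add: X_shift)
  moreover have "(\<integral>x. g x \<partial>\<mu>) = (\<integral>z. g (X z) \<partial>iid p)"
    by (rule integral_\<mu>) measurable
  ultimately show ?thesis
    unfolding Cov_def using Loc_covariance[OF F tame_Loc[OF g]] by simp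
qed

lemma tame_central_limit:
  assumes f: "tame C f" and mean: "(\<integral>x. f x \<partial>\<mu>) = 0"
  obtains \<sigma> where "0 \<le> \<sigma>"
    "weak_conv_m (\<lambda>n. distr \<mu> borel (\<lambda>x. (\<Sum>i<n. f ((T ^^ i) x)) / sqrt (real n))) (centered_normal \<sigma>)"
proof -
  have [measurable]: "f \<in> borel_measurable borel" by (rule tame_measurable[OF f])
  have "(\<integral>z. f (X z) \<partial>iid p) = 0" using mean integral_\<mu>[of f] by simp
  then obtain \<sigma> where \<sigma>: "0 \<le> \<sigma>"
    "weak_conv_m (\<lambda>n. distr (iid p) borel (\<lambda>z. (\<Sum>i<n. f (X (shift (int i) z))) / sqrt (real n))) (centered_normal \<sigma>)"
    by (rule Loc_central_limit[OF tame_Loc[OF f]])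
  have "distr \<mu> borel (\<lambda>x. (\<Sum>i<n. f ((T ^^ i) x)) / sqrt (real n)) =
      distr (iid p) borel (\<lambda>z. (\<Sum>i<n. f (X (shift (int i) z))) / sqrt (real n))" for n
  proof -
    have [measurable]: "(\<lambda>z. f (X (shift (int i) z))) \<in> borel_measurable (iid p)" for i
      by (rule measurable_compose[OF measurable_compose[OF measurable_iid_reindex measurable_X]]) measurable
    have "distr \<mu> borel (\<lambda>x. (\<Sum>i<n. f ((T ^^ i) x)) / sqrt (real n)) =
        distr (iid p) borel (\<lambda>z. (\<Sum>i<n. f ((T ^^ i) (X z))) / sqrt (real n))"
      unfolding \<mu>_def by (subst distr_distr) (simp_all add: comp_def)
    also have "\<dots> = distr (iid p) borel (\<lambda>z. (\<Sum>i<n. f (X (shift (int i) z))) / sqrt (real n))"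
      by (rule distr_cong_AE[OF refl refl]) (rule AE_mp[OF AE_good], rule AE_I2, simp add: X_shift, measurable)
    finally show ?thesis .
  qed
  with \<sigma> show ?thesis by (intro that[of \<sigma>]) simp_all
qed

end

section \<open>The invariant measure\<close>

text \<open>The sequence must lie in D, where the maps S have their properties; one point is picked
  from each basic open set that meets D.\<close>

lemma countable_dense_subset:
  fixes D :: "'a::second_countable_topology set"
  assumes "closure D = UNIV"
  obtains D0 where "countable D0" "D0 \<subseteq> D" "closure D0 = UNIV"
proof -
  obtain B :: "'a set set" where B: "countable B" "topological_basis B"
    using ex_countable_basis by blast
  define pick where "pick U = (SOME x. x \<in> U \<inter> D)" for U
  define D0 where "D0 = pick ` {U \<in> B. U \<inter> D \<noteq> {}}"
  have pick: "pick U \<in> U \<inter> D" if "U \<inter> D \<noteq> {}" for U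
  proof -
    from that have "\<exists>x. x \<in> U \<inter> D" by blast
    then show ?thesis unfolding pick_def by (rule someI_ex)
  qed
  have "closure D0 = UNIV"
  proof (rule ccontr)
    assume "closure D0 \<noteq> UNIV"
    then obtain x where "x \<in> - closure D0" by blast
    moreover have "open (- closure D0)" by (intro open_Compl closed_closure)
    ultimately obtain U where U: "U \<in> B" "x \<in> U" "U \<subseteq> - closure D0"
      using topological_basisE[OF B(2)] by metis
    have "U \<inter> closure D \<noteq> {}" using U(2) assms by blast
    then have "U \<inter> D \<noteq> {}" using open_Int_closure_eq_empty topological_basis_open[OF B(2) U(1)] by blast
    then have "pick U \<in> D0" "pick U \<in> U" using U(1) pick by (auto simp: D0_def)
    then show False using U(3) closure_subset by blast
  qed
  moreover have "countable D0" "D0 \<subseteq> D" using B(1) pick by (auto simp: D0_def)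
  ultimately show ?thesis by (rule that[rotated 2])
qed

text \<open>No growth of \<open>c\<close> is assumed. The weight
  \<open>exp (- (c l)\<^sup>2)\<close> beats \<open>exp (m * c l)\<close> for every m, up to the
  constant \<open>exp (m\<^sup>2)\<close>, and the geometric factor makes the sum finite.\<close>

lemma exists_pmf_exp_integrable:
  fixes c :: "nat \<Rightarrow> real"
  shows "\<exists>p. (\<forall>l. 0 < pmf p l) \<and> (\<forall>m::nat. integrable (measure_pmf p) (\<lambda>l. exp (real m * c l)))"
proof -
  define w where "w l = (1 / 2) ^ l * exp (- (c l)\<^sup>2)" for l
  have geom: "summable (\<lambda>l. (1 / 2) ^ l :: real)" by (simp add: summable_geometric)
  have le: "w l * exp (real m * c l) \<le> (1 / 2) ^ l * exp ((real m)\<^sup>2)" for l m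
  proof -
    have "2 * (real m * c l) \<le> (real m)\<^sup>2 + (c l)\<^sup>2"
      using sum_squares_bound[of "real m" "c l"] by (simp add: mult.assoc)
    then have "- (c l)\<^sup>2 + real m * c l \<le> (real m)\<^sup>2" using zero_le_power2[of "real m"] zero_le_power2[of "c l"] by linarith
    then show ?thesis by (simp add: w_def mult.assoc mult_left_mono flip: exp_add)
  qed
  have w_pos: "0 < w l" for l by (simp add: w_def)
  have ws: "summable (\<lambda>l. w l * exp (real m * c l))" for m
    by (rule summable_comparison_test'[OF summable_mult2[OF geom, of "exp ((real m)\<^sup>2)"], of 0])
      (use le w_pos in \<open>simp add: less_imp_le\<close>)
  have w_sum: "summable w" using ws[of 0] by simp
  define W where "W = suminf w"
  have W: "0 < W" unfolding W_def by (rule suminf_pos[OF w_sum w_pos])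
  define p where "p = embed_pmf (\<lambda>l. w l / W)"
  have "(\<lambda>l. w l / W) sums (W / W)"
    unfolding W_def using summable_sums[OF w_sum] by (rule sums_divide)
  then have "(\<integral>\<^sup>+l. ennreal (w l / W) \<partial>count_space UNIV) = 1"
    using W w_pos by (simp add: nn_integral_count_space_nat suminf_ennreal2 sums_iff less_imp_le)
  then have p: "pmf p l = w l / W" for l
    unfolding p_def using W w_pos by (intro pmf_embed_pmf) (auto simp: less_imp_le)
  show ?thesis
  proof (intro exI[of _ p] conjI allI)
    show "0 < pmf p l" for l using W w_pos by (simp add: p)
    fix m :: nat
    have "(\<lambda>l. norm (pmf p l *\<^sub>R exp (real m * c l))) = (\<lambda>l. w l * exp (real m * c l) / W)"
      using W w_pos by (simp add: p fun_eq_iff less_imp_le)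
    then have "summable (\<lambda>l. norm (pmf p l *\<^sub>R exp (real m * c l)))"
      using summable_divide[OF ws[of m], of W] by simp
    then show "integrable (measure_pmf p) (\<lambda>l. exp (real m * c l))"
      unfolding measure_pmf_eq_density
      by (subst integrable_density) (auto simp: integrable_count_space_nat_iff)
  qed
qed

section \<open>Polynomial weights on the integers\<close>

lemma decay_uniform_bound:
  fixes g :: "nat \<Rightarrow> 'b::real_normed_vector"
  assumes g: "(\<lambda>n. norm (g n)) \<in> O(\<lambda>n. real n powr (- \<alpha>))" and \<alpha>: "0 < \<alpha>"
  obtains C where "0 \<le> C" "\<And>n. norm (g n) \<le> C * (1 + real n) powr (- \<alpha>)"
proof -
  let ?b = "\<lambda>n. (1 + real n) powr (- \<alpha>)"
  obtain C where C: "0 < C" "\<forall>\<^sub>F n in sequentially. norm (norm (g n)) \<le> C * norm (real n powr (- \<alpha>))"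
    using landau_o.bigE[OF g] by blast
  from eventually_conj[OF C(2) eventually_ge_at_top[of 1]] obtain N where
    N: "\<And>n. n \<ge> N \<Longrightarrow> norm (g n) \<le> C * real n powr (- \<alpha>) \<and> 1 \<le> n"
    by (auto simp: eventually_sequentially)
  \<comment> \<open>The sum covers the finitely many n below the threshold. Beyond it n is at least
    1, so \<open>1 + n \<le> 2 * n\<close>, and passing from n to \<open>1 + n\<close> costs the
    factor \<open>2 powr \<alpha>\<close>.\<close>
  define B where "B = (\<Sum>n<N. norm (g n) / ?b n) + C * 2 powr \<alpha>"
  have S0: "0 \<le> (\<Sum>n<N. norm (g n) / ?b n)" by (intro sum_nonneg) simp
  show ?thesis
  proof (rule that[of B])
    show "0 \<le> B" unfolding B_def using C(1) S0 by (intro add_nonneg_nonneg) auto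
    fix n
    show "norm (g n) \<le> B * ?b n"
    proof (cases "n < N")
      case True
      have "norm (g n) / ?b n \<le> (\<Sum>n<N. norm (g n) / ?b n)"
        using True by (intro member_le_sum) auto
      also have "\<dots> \<le> B" unfolding B_def using C(1) by simp
      finally show ?thesis by (simp add: divide_le_eq)
    next
      case False
      then have n: "norm (g n) \<le> C * real n powr (- \<alpha>)" "1 \<le> n" using N[of n] by auto
      have "real n powr (- \<alpha>) = 2 powr \<alpha> * (2 * real n) powr (- \<alpha>)"
        using n(2) by (simp add: powr_mult powr_minus)
      also have "\<dots> \<le> 2 powr \<alpha> * ?b n"
        using n(2) \<alpha> by (intro mult_left_mono powr_mono2') auto
      finally have "C * real n powr (- \<alpha>) \<le> C * (2 powr \<alpha> * ?b n)" using C(1) by (intro mult_left_mono) auto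
      then have "norm (g n) \<le> (C * 2 powr \<alpha>) * ?b n" using n(1) by simp
      also have "\<dots> \<le> B * ?b n" unfolding B_def using S0 by (intro mult_right_mono) auto
      finally show ?thesis .
    qed
  qed
qed

lemma int_powr_summable:
  assumes "1 < \<alpha>"
  shows "(\<lambda>k::int. (1 + \<bar>real_of_int k\<bar>) powr (- \<alpha>)) summable_on UNIV"
proof -
  let ?b = "\<lambda>k::int. (1 + \<bar>real_of_int k\<bar>) powr (- \<alpha>)"
  have "summable (\<lambda>n. real n powr (- \<alpha>))" using assms by (simp add: summable_real_powr_iff)
  then have "summable (\<lambda>n. real (Suc n) powr (- \<alpha>))" by (rule iffD2[OF summable_Suc_iff])
  then have s: "(\<lambda>n. (1 + real n) powr (- \<alpha>)) summable_on UNIV"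
    by (subst summable_on_UNIV_nonneg_real_iff) (simp_all add: add.commute)
  have "?b summable_on range int" "?b summable_on range (\<lambda>n. - int n)"
    using s by (subst summable_on_reindex; simp add: comp_def inj_on_def)+
  then have "?b summable_on (range int \<union> range (\<lambda>n. - int n))"
    by (rule summable_on_union)
  also have "range int \<union> range (\<lambda>n. - int n) = UNIV"
    by (auto simp: image_iff) (metis int_cases2)
  finally show ?thesis .
qed

text \<open>As |n| is at most |k| + |k - n|, one of the two is at least |n| / 2, and that factor is
  at most \<open>2 powr \<alpha> * b n\<close>.\<close>

lemma powr_convolution_bound:
  fixes k n :: int
  assumes "0 < \<alpha>"
  defines "b \<equiv> \<lambda>k::int. (1 + \<bar>real_of_int k\<bar>) powr (- \<alpha>)"
  shows "b k * b (k - n) \<le> 2 powr \<alpha> * b n * (b k + b (k - n))"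
proof -
  have b0: "0 \<le> b k" for k by (simp add: b_def)
  have half: "b k \<le> 2 powr \<alpha> * b n" if "1 + \<bar>real_of_int n\<bar> \<le> 2 * (1 + \<bar>real_of_int k\<bar>)" for k
  proof -
    have "b k = 2 powr \<alpha> * (2 * (1 + \<bar>real_of_int k\<bar>)) powr (- \<alpha>)"
      unfolding b_def by (simp only: powr_mult powr_minus) simp
    also have "\<dots> \<le> 2 powr \<alpha> * b n"
      unfolding b_def using that assms(1) by (intro mult_left_mono powr_mono2') auto
    finally show ?thesis .
  qed
  have "1 + \<bar>real_of_int n\<bar> \<le> 2 * (1 + \<bar>real_of_int k\<bar>) \<or> 1 + \<bar>real_of_int n\<bar> \<le> 2 * (1 + \<bar>real_of_int (k - n)\<bar>)"
    by (simp add: abs_if) linarith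
  then show ?thesis
  proof
    assume "1 + \<bar>real_of_int n\<bar> \<le> 2 * (1 + \<bar>real_of_int k\<bar>)"
    then have "b k * b (k - n) \<le> 2 powr \<alpha> * b n * b (k - n)" by (intro mult_right_mono half b0)
    also have "\<dots> \<le> 2 powr \<alpha> * b n * (b k + b (k - n))" using b0 by (intro mult_left_mono) auto
    finally show ?thesis .
  next
    assume "1 + \<bar>real_of_int n\<bar> \<le> 2 * (1 + \<bar>real_of_int (k - n)\<bar>)"
    then have "b k * b (k - n) \<le> b k * (2 powr \<alpha> * b n)" by (intro mult_left_mono half b0)
    also have "\<dots> \<le> 2 powr \<alpha> * b n * (b k + b (k - n))"
      using b0 by (simp add: distrib_left mult_ac)
    finally show ?thesis .
  qed
qed

theorem theorem2p3:
  fixes T :: "'a::{banach, second_countable_topology} \<Rightarrow> 'a"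
    and \<omega> :: "nat \<Rightarrow> real" and \<alpha> :: real
    and D :: "'a set" and S :: "nat \<Rightarrow> 'a \<Rightarrow> 'a"
  assumes T_lin: "bounded_linear T"
    and \<omega>_gt1: "\<forall>k. \<omega> k > 1"
    and \<omega>_lim: "filterlim \<omega> at_top sequentially"
    and \<alpha>_gt1: "\<alpha> > 1"
    and D_dense: "closure D = UNIV"
    and S_right_inv: "\<forall>x\<in>D. \<forall>n. (T ^^ n) (S n x) = x"
    and S_shift: "\<forall>x\<in>D. \<forall>n m. n > m \<longrightarrow> (T ^^ m) (S n x) = S (n - m) x"
    and T_decay: "\<forall>x\<in>D. (\<lambda>n. norm ((T ^^ n) x)) \<in> O(\<lambda>n. real n powr (- \<alpha>))"
    and S_decay: "\<forall>x\<in>D. (\<lambda>n. norm (S n x)) \<in> O(\<lambda>n. real n powr (- \<alpha>))"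
  shows "\<exists>\<mu> :: 'a measure.
           prob_space \<mu> \<and> sets \<mu> = sets borel \<and>
           (\<forall>A\<in>sets borel. measure \<mu> (T -` A) = measure \<mu> A) \<and>
           (\<forall>U. open U \<and> U \<noteq> {} \<longrightarrow> measure \<mu> U > 0) \<and>
           (\<forall>A\<in>sets borel. \<forall>B\<in>sets borel.
              (\<lambda>n. measure \<mu> (A \<inter> (T ^^ n) -` B)) \<longlonglongrightarrow> measure \<mu> A * measure \<mu> B) \<and>
           (\<forall>f\<in>E_omega \<omega>. f \<in> borel_measurable \<mu> \<and> integrable \<mu> (\<lambda>x. (f x)\<^sup>2)) \<and>
           (\<forall>f\<in>E_omega \<omega>. \<forall>g\<in>E_omega \<omega>. \<exists>C. \<forall>n\<ge>1.
              \<bar>Cov \<mu> (\<lambda>x. f ((T ^^ n) x)) g\<bar> \<le> C * real n powr (- \<alpha>)) \<and>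
           (\<forall>f\<in>E_omega \<omega>. (\<integral>x. f x \<partial>\<mu>) = 0 \<longrightarrow>
              (\<exists>\<sigma>::real. \<sigma> \<ge> 0 \<and>
                 weak_conv_m (\<lambda>n. distr \<mu> borel (\<lambda>x. (\<Sum>i<n. f ((T ^^ i) x)) / sqrt (real n)))
                   (if \<sigma> = 0 then return borel 0 else density lborel (normal_density 0 \<sigma>))))"
proof -
  obtain D0 where D0: "countable D0" "D0 \<subseteq> D" "closure D0 = UNIV"
    using countable_dense_subset[OF D_dense] .
  have D0_ne: "D0 \<noteq> {}" using D0(3) by auto
  \<comment> \<open>Index 0 is reserved for the zero vector, which need not belong to D; the dense
    sequence starts at index 1.\<close>
  define x where "x l = (if l = 0 then 0 else from_nat_into D0 (l - 1))" for l :: nat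
  have xD: "x l \<in> D" if "l \<noteq> 0" for l
    using that from_nat_into[OF D0_ne] D0(2) by (auto simp: x_def)
  define v where "v k l = (if l = 0 then 0 else if k > 0 then S (nat k) (x l) else (T ^^ nat (- k)) (x l))"
    for k :: int and l :: nat
  define b where "b k = (1 + \<bar>real_of_int k\<bar>) powr (- \<alpha>)" for k :: int
  have b_pos: "0 < b k" for k by (simp add: b_def)
  have b_sum: "b summable_on UNIV" unfolding b_def by (rule int_powr_summable[OF \<alpha>_gt1])
  have "\<exists>C. 0 \<le> C \<and> (\<forall>k. norm (v k l) \<le> C * b k)" if l: "l \<noteq> 0" for l
  proof -
    obtain C1 where C1: "0 \<le> C1" "\<And>n. norm ((T ^^ n) (x l)) \<le> C1 * (1 + real n) powr (- \<alpha>)"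
      by (rule decay_uniform_bound[OF bspec[OF T_decay xD[OF l]]]) (use \<alpha>_gt1 in auto)
    obtain C2 where C2: "0 \<le> C2" "\<And>n. norm (S n (x l)) \<le> C2 * (1 + real n) powr (- \<alpha>)"
      by (rule decay_uniform_bound[OF bspec[OF S_decay xD[OF l]]]) (use \<alpha>_gt1 in auto)
    have "norm (v k l) \<le> (C1 + C2) * b k" for k
    proof (cases "k > 0")
      case True
      then have "norm (v k l) \<le> C2 * b k" using C2(2)[of "nat k"] l by (simp add: v_def b_def)
      also have "\<dots> \<le> (C1 + C2) * b k" using C1(1) b_pos[of k] by (intro mult_right_mono) auto
      finally show ?thesis .
    next
      case False
      then have "norm (v k l) \<le> C1 * b k" using C1(2)[of "nat (- k)"] l by (simp add: v_def b_def)
      also have "\<dots> \<le> (C1 + C2) * b k" using C2(1) b_pos[of k] by (intro mult_right_mono) auto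
      finally show ?thesis .
    qed
    with C1(1) C2(1) show ?thesis by (intro exI[of _ "C1 + C2"]) auto
  qed
  then obtain cb where cb: "\<And>l. l \<noteq> 0 \<Longrightarrow> 0 \<le> cb l" "\<And>l k. l \<noteq> 0 \<Longrightarrow> norm (v k l) \<le> cb l * b k"
    by metis
  \<comment> \<open>Dividing the weights by A gives them total mass 1; multiplying \<open>c\<close>
    by A compensates, so the bound on \<open>norm (v k l)\<close> is unchanged.\<close>
  define A where "A = infsum b UNIV"
  have A: "0 < A"
  proof -
    have "sum b {0} \<le> A" unfolding A_def using b_sum b_pos by (intro finite_sum_le_infsum) (auto simp: less_imp_le)
    then show ?thesis using b_pos[of 0] by simp
  qed
  define a where "a k = b k / A" for k
  define c where "c l = (if l = 0 then 0 else A * cb l)" for l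
  obtain p where p: "\<And>l. 0 < pmf p l" "\<And>m::nat. integrable (measure_pmf p) (\<lambda>l. exp (real m * c l))"
    using exists_pmf_exp_integrable[of c] by blast
  have T0: "T 0 = 0" by (rule linear_0[OF bounded_linear.linear[OF T_lin]])
  interpret random_series p c a "2 powr \<alpha>" T v
  proof (intro random_series.intro summable_weights.intro random_series_axioms.intro)
    show "0 \<le> c l" for l using cb(1)[of l] A by (simp add: c_def)
    show "c 0 = 0" by (simp add: c_def)
    show "integrable (measure_pmf p) (\<lambda>l. exp (real m * c l))" for m by (rule p)
    show "0 < a k" for k using b_pos A by (simp add: a_def)
    have "((\<lambda>k. b k * (1 / A)) has_sum A * (1 / A)) UNIV"
      unfolding A_def by (intro has_sum_cmult_left has_sum_infsum b_sum)
    then show "(a has_sum 1) UNIV" using A by (simp add: a_def[abs_def])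
    show "a k * a (k - n) \<le> 2 powr \<alpha> * a n * (a k + a (k - n))" for k n
    proof -
      \<comment> \<open>Both sides are quadratic in the weights, so normalization does not affect
        the constant.\<close>
      have "b k * b (k - n) / (A * A) \<le> 2 powr \<alpha> * b n * (b k + b (k - n)) / (A * A)"
        using powr_convolution_bound[of \<alpha> k n] \<alpha>_gt1 A unfolding b_def by (intro divide_right_mono) auto
      then show ?thesis by (simp add: a_def flip: add_divide_distrib)
    qed
    show "bounded_linear T" by (rule T_lin)
    show "T (v k l) = v (k - 1) l" for k l
    proof (cases "l = 0 \<or> k \<le> 0")
      case True
      have "T ((T ^^ nat (- k)) (x l)) = (T ^^ nat (- (k - 1))) (x l)" if "k \<le> 0"
      proof -
        have "nat (- (k - 1)) = Suc (nat (- k))" using that by simp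
        then show ?thesis by simp
      qed
      with True show ?thesis by (auto simp: v_def T0)
    next
      case False
      then have l: "l \<noteq> 0" and k: "0 < k" by auto
      show ?thesis
      \<comment> \<open>At k = 1 the orbit passes from the maps S to the powers of T, by the
        identity T S_1 x = x; for larger k the shift relation of S applies.\<close>
      proof (cases "k = 1")
        case True
        then show ?thesis using l S_right_inv[rule_format, OF xD[OF l], of 1] by (simp add: v_def)
      next
        case False
        then have "T (S (nat k) (x l)) = S (nat k - 1) (x l)"
          using k S_shift[rule_format, OF xD[OF l], of 1 "nat k"] by simp
        moreover have "nat k - 1 = nat (k - 1)" using k by simp
        ultimately show ?thesis using l k False by (simp add: v_def)
      qed
    qed
    show "norm (v k l) \<le> a k * c l" for k l
      using cb(2)[of l k] A by (cases "l = 0") (auto simp: v_def a_def c_def mult.commute)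
    show "0 < pmf p l" for l by (rule p)
    have "D0 \<subseteq> range (v 0)"
    proof
      fix y assume "y \<in> D0"
      then obtain n where "y = from_nat_into D0 n" using from_nat_into_surj[OF D0(1)] by metis
      then have "y = v 0 (Suc n)" by (simp add: v_def x_def)
      then show "y \<in> range (v 0)" by blast
    qed
    then show "closure (range (v 0)) = UNIV" using closure_mono[of D0 "range (v 0)"] D0(3) by auto
  qed
  have tame: "\<exists>C. tame C f" if f: "f \<in> E_omega \<omega>" for f
    using E_omega_bounds[OF \<omega>_gt1 f] unfolding tame_def by metis
  have cov: "\<exists>C. \<forall>n\<ge>1. \<bar>Cov \<mu> (\<lambda>x. f ((T ^^ n) x)) g\<bar> \<le> C * real n powr (- \<alpha>)"
    if fg: "f \<in> E_omega \<omega>" "g \<in> E_omega \<omega>" for f g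
  proof -
    obtain C C' where f: "tame C f" and g: "tame C' g" using tame fg by blast
    have C: "0 \<le> C * C' * Kc" using f g Kc_pos by (simp add: tame_def)
    have "\<bar>Cov \<mu> (\<lambda>x. f ((T ^^ n) x)) g\<bar> \<le> C * C' * Kc / A * real n powr (- \<alpha>)" if "n \<ge> 1" for n
    proof -
      \<comment> \<open>Here n at least 1 matters: 0 powr a negative exponent is 0 by
        convention.\<close>
      have "b (int n) \<le> real n powr (- \<alpha>)"
        unfolding b_def using that \<alpha>_gt1 by (intro powr_mono2') auto
      then have "C * C' * Kc * a (int n) \<le> C * C' * Kc * (real n powr (- \<alpha>) / A)"
        unfolding a_def using A by (intro mult_left_mono C divide_right_mono) auto
      then show ?thesis using tame_covariance[OF f g, of n] by simp
    qed
    then show ?thesis by blast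
  qed
  have clt: "\<exists>\<sigma>::real. \<sigma> \<ge> 0 \<and>
      weak_conv_m (\<lambda>n. distr \<mu> borel (\<lambda>x. (\<Sum>i<n. f ((T ^^ i) x)) / sqrt (real n)))
        (if \<sigma> = 0 then return borel 0 else density lborel (normal_density 0 \<sigma>))"
    if f: "f \<in> E_omega \<omega>" and mean: "(\<integral>x. f x \<partial>\<mu>) = 0" for f
  proof -
    obtain C where C: "tame C f" using tame[OF f] by blast
    obtain \<sigma> where "0 \<le> \<sigma>"
      "weak_conv_m (\<lambda>n. distr \<mu> borel (\<lambda>x. (\<Sum>i<n. f ((T ^^ i) x)) / sqrt (real n))) (centered_normal \<sigma>)"
      by (rule tame_central_limit[OF C mean])
    then show ?thesis unfolding centered_normal_def by blast
  qed
  have sq: "f \<in> borel_measurable \<mu> \<and> integrable \<mu> (\<lambda>x. (f x)\<^sup>2)" if mem: "f \<in> E_omega \<omega>" for f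
  proof -
    obtain C where f: "tame C f" using tame[OF mem] by blast
    have "f \<in> borel_measurable \<mu>" using tame_measurable[OF f] by (simp cong: measurable_cong_sets)
    then show ?thesis using tame_square_integrable[OF f] by blast
  qed
  show ?thesis
  proof (intro exI[of _ \<mu>] conjI ballI allI impI)
    show "prob_space \<mu>" by (rule prob_space_\<mu>)
    show "sets \<mu> = sets borel" by (rule sets_\<mu>)
    show "measure \<mu> (T -` A) = measure \<mu> A" if "A \<in> sets borel" for A
      using that by (rule \<mu>_invariant)
    show "0 < measure \<mu> U" if "open U \<and> U \<noteq> {}" for U
      using that \<mu>_full_support by blast
    show "(\<lambda>n. measure \<mu> (A \<inter> (T ^^ n) -` B)) \<longlonglongrightarrow> measure \<mu> A * measure \<mu> B"
      if "A \<in> sets borel" "B \<in> sets borel" for A B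
      using that by (rule \<mu>_strong_mixing)
    show "f \<in> borel_measurable \<mu>" "integrable \<mu> (\<lambda>x. (f x)\<^sup>2)" if "f \<in> E_omega \<omega>" for f
      using sq[OF that] by blast+
  qed (rule cov clt; assumption)+
qed

end
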